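(* Let $p\ge1$ and let $$R_n=\inf_{\hat\tau_n}\ \sup_{P\in\mathcal{P}^{d,D}_{\tau_{\min},L,f_{\min}}}\mathbb{E}_{P^n}\left|\frac{1}{\tau_P}-\frac{1}{\hat\tau_n}\right|^p,$$ where the infimum ranges over all estimators $\hat\tau_n=\hat\tau_n\bigl((X_1,T_1),\dots,(X_n,T_n)\bigr)$ based on an i.i.d. sample of size $n$ from $P$. Assume that $L\ge(2\tau_{\min}^2)^{-1}$ and $f_{\min}\le(2^{d+1}\tau_{\min}^d\sigma_d)^{-1}$. Then for $n$ large enough, $$R_n\ge\left(\frac{c_d}{\tau_{\min}}\right)^p n^{-p/d},$$ where $c_d>0$ depends only on $d$.
   Context: $\sigma_d$ is the $d$-dimensional volume of the unit sphere $\mathcal{S}^d\subset\mathbb{R}^{d+1}$. $D\ge2$; $\mathbb{R}^D$ carries the Euclidean norm. $1\le d<D$; $\tau_{\min},L,f_{\min}>0$. Submanifolds are embedded, of class at least $\mathcal{C}^2$. For closed $A\subset\mathbb{R}^D$, $d(z,A)=\inf_{p\in A}\|p-z\|$, $Med(A)=\{z : \exists\, p\ne q\in A,\ \|p-z\|=\|q-z\|=d(z,A)\}$, and the reach is $\tau_A=\inf_{z\in Med(A)}d(z,A)$. $\mathcal{M}^{d,D}_{\tau_{\min},L}$: the set of compact connected $d$-dimensional submanifolds $M\subset\mathbb{R}^D$ without boundary with $\tau_M\ge\tau_{\min}$ and for which every arc-length parametrized geodesic $\gamma_{p,v}$ (starting at $p\in M$ with unit velocity $v\in T_pM$) is $\mathcal{C}^3$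 and satisfies $\|\gamma_{p,v}'''(0)\|\le L$. $\mathcal{Q}^{d,D}_{\tau_{\min},L,f_{\min}}$: the set of probability distributions $Q$ with support some $M\in\mathcal{M}^{d,D}_{\tau_{\min},L}$ and with a density $f$ with respect to the $d$-dimensional Hausdorff measure on $M$ satisfying $\inf_{x\in M}f(x)\ge f_{\min}$. $\mathcal{P}^{d,D}_{\tau_{\min},L,f_{\min}}$: the set of distributions $P$ of $(X,T_XM)$ on $\mathbb{R}^D\times\mathbb{G}^{d,D}$ ($\mathbb{G}^{d,D}$ the Grassmannian of $d$-dimensional linear subspaces of $\mathbb{R}^D$) where $X\sim Q\in\mathcal{Q}^{d,D}_{\tau_{\min},L,f_{\min}}$ and $M$ is the support of $Q$; then $\tau_P:=\tau_M$. Estimators are measurable functions of the sample with values in $(0,\infty]$, with $1/\infty=0$. *)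

theory Defs
  imports "HOL-Probability.Probability"
begin

section \<open>The Euclidean spaces of all finite dimensions in one type\<close>

text \<open>
  The constant of the theorem depends on the dimension \<open>d\<close> but not on the ambient dimension
  \<open>D\<close>, so \<open>D\<close> has to be quantified inside the formula and cannot be a type.
  The type \<open>fsvec\<close> of finitely supported real sequences, with the inner product
  \<open>\<Sum>i. x i * y i\<close>, contains \<open>\<real>\<^sup>D\<close>, for every \<open>D\<close>, as the subspace \<open>euclid D\<close> of the sequences
  supported in \<open>{0..<D}\<close>; the norm induced on it is the Euclidean one.
\<close>

typedef fsvec = "{f :: nat \<Rightarrow> real. finite {i. f i \<noteq> 0}}"
  morphisms coord Abs_fsvec
  by (rule exI[of _ "\<lambda>_. 0"]) simp

setup_lifting type_definition_fsvec

lemma finite_support: "finite {i. coord x i \<noteq> 0}"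
  using coord[of x] by simp

lemma fsvec_eqI: "(\<And>i. coord x i = coord y i) \<Longrightarrow> x = y"
  by (simp add: coord_inject[symmetric] ext)

instantiation fsvec :: real_vector
begin

lift_definition zero_fsvec :: fsvec is "\<lambda>_. 0" by simp

lift_definition plus_fsvec :: "fsvec \<Rightarrow> fsvec \<Rightarrow> fsvec" is "\<lambda>x y i. x i + y i"
  by (erule (1) rev_finite_subset[OF finite_UnI]) auto

lift_definition uminus_fsvec :: "fsvec \<Rightarrow> fsvec" is "\<lambda>x i. - x i" by simp

lift_definition minus_fsvec :: "fsvec \<Rightarrow> fsvec \<Rightarrow> fsvec" is "\<lambda>x y i. x i - y i"
  by (erule (1) rev_finite_subset[OF finite_UnI]) auto

lift_definition scaleR_fsvec :: "real \<Rightarrow> fsvec \<Rightarrow> fsvec" is "\<lambda>r x i. r * x i"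
  by (erule rev_finite_subset) auto

instance
  by standard (transfer; simp add: algebra_simps)+

end

instantiation fsvec :: real_inner
begin

definition inner_fsvec :: "fsvec \<Rightarrow> fsvec \<Rightarrow> real" where
  "inner_fsvec x y = (\<Sum>i | coord x i \<noteq> 0. coord x i * coord y i)"

definition norm_fsvec :: "fsvec \<Rightarrow> real" where
  "norm_fsvec x = sqrt (x \<bullet> x)"

definition sgn_fsvec :: "fsvec \<Rightarrow> fsvec" where
  "sgn_fsvec x = x /\<^sub>R norm x"

definition dist_fsvec :: "fsvec \<Rightarrow> fsvec \<Rightarrow> real" where
  "dist_fsvec x y = norm (x - y)"

definition uniformity_fsvec :: "(fsvec \<times> fsvec) filter" where
  "uniformity_fsvec = (INF e\<in>{0<..}. principal {(x, y). dist x y < e})"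

definition open_fsvec :: "fsvec set \<Rightarrow> bool" where
  "open_fsvec U \<longleftrightarrow> (\<forall>x\<in>U. \<forall>\<^sub>F (x', y) in uniformity. x' = x \<longrightarrow> y \<in> U)"

lemma inner_fsvec_superset:
  assumes "finite S" "{i. coord x i \<noteq> 0} \<subseteq> S"
  shows "x \<bullet> y = (\<Sum>i\<in>S. coord x i * coord y i)"
  unfolding inner_fsvec_def by (rule sum.mono_neutral_left) (use assms in auto)

instance
proof
  fix x y z :: fsvec and r :: real
  let ?S = "{i. coord x i \<noteq> 0} \<union> {i. coord y i \<noteq> 0}"
  have S: "finite ?S" by (simp add: finite_support)
  have x: "x \<bullet> w = (\<Sum>i\<in>?S. coord x i * coord w i)" for w
    by (rule inner_fsvec_superset[OF S]) auto
  have y: "y \<bullet> w = (\<Sum>i\<in>?S. coord y i * coord w i)" for w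
    by (rule inner_fsvec_superset[OF S]) auto
  show "x \<bullet> y = y \<bullet> x" by (simp add: x y mult.commute)
  have "(x + y) \<bullet> z = (\<Sum>i\<in>?S. coord (x + y) i * coord z i)"
    by (rule inner_fsvec_superset[OF S]) (auto simp: plus_fsvec.rep_eq)
  then show "(x + y) \<bullet> z = x \<bullet> z + y \<bullet> z"
    by (simp add: x y plus_fsvec.rep_eq sum.distrib algebra_simps)
  have "(r *\<^sub>R x) \<bullet> y = (\<Sum>i\<in>?S. coord (r *\<^sub>R x) i * coord y i)"
    by (rule inner_fsvec_superset[OF S]) (auto simp: scaleR_fsvec.rep_eq)
  then show "(r *\<^sub>R x) \<bullet> y = r * (x \<bullet> y)"
    by (simp add: x scaleR_fsvec.rep_eq sum_distrib_left mult.assoc)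
  show "0 \<le> x \<bullet> x" by (simp add: inner_fsvec_def sum_nonneg)
  show "x \<bullet> x = 0 \<longleftrightarrow> x = 0"
  proof
    assume "x \<bullet> x = 0"
    then have "\<forall>i\<in>{i. coord x i \<noteq> 0}. coord x i * coord x i = 0"
      unfolding inner_fsvec_def by (subst (asm) sum_nonneg_eq_0_iff) (auto simp: finite_support)
    then show "x = 0" by (intro fsvec_eqI) (auto simp: zero_fsvec.rep_eq)
  qed (simp add: inner_fsvec_def zero_fsvec.rep_eq)
qed (simp_all add: norm_fsvec_def sgn_fsvec_def dist_fsvec_def uniformity_fsvec_def open_fsvec_def)

end

definition euclid :: "nat \<Rightarrow> fsvec set" where
  "euclid n = {x. \<forall>i\<ge>n. coord x i = 0}"

lemma inner_euclid:
  assumes "x \<in> euclid n"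
  shows "x \<bullet> y = (\<Sum>i<n. coord x i * coord y i)"
  by (rule inner_fsvec_superset) (use assms in \<open>auto simp: euclid_def not_less[symmetric]\<close>)

lemma norm_euclid:
  assumes "x \<in> euclid n"
  shows "norm x = L2_set (coord x) {..<n}"
  by (simp add: norm_eq_sqrt_inner inner_euclid[OF assms] L2_set_def power2_eq_square)

lemma subspace_euclid: "subspace (euclid n)"
  by (auto simp: subspace_def euclid_def zero_fsvec.rep_eq plus_fsvec.rep_eq scaleR_fsvec.rep_eq)

lift_definition unit_fsvec :: "nat \<Rightarrow> fsvec" is "\<lambda>k i. of_bool (i = k)" by simp

lemma coord_sum: "coord (sum f A) i = (\<Sum>a\<in>A. coord (f a) i)"
  by (induction A rule: infinite_finite_induct) (auto simp: zero_fsvec.rep_eq plus_fsvec.rep_eq)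

lemma dim_euclid: "dim (euclid n) = n"
proof (rule dim_unique)
  let ?B = "unit_fsvec ` {..<n}"
  have inj: "inj unit_fsvec"
    by (rule injI) (metis unit_fsvec.rep_eq of_bool_eq_iff)
  show "?B \<subseteq> euclid n" by (auto simp: euclid_def unit_fsvec.rep_eq)
  show "euclid n \<subseteq> span ?B"
  proof
    fix x assume "x \<in> euclid n"
    then have "x = (\<Sum>k<n. coord x k *\<^sub>R unit_fsvec k)"
      by (intro fsvec_eqI)
        (auto simp: coord_sum scaleR_fsvec.rep_eq unit_fsvec.rep_eq euclid_def of_bool_def
          if_distrib[of "\<lambda>u. _ * u"] cong: if_cong)
    also have "\<dots> \<in> span ?B" by (intro span_sum span_scale span_base) auto
    finally show "x \<in> span ?B" .
  qed
  show "independent ?B"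
  proof (rule independent_if_scalars_zero)
    show "finite ?B" by simp
    fix f v assume *: "(\<Sum>x\<in>?B. f x *\<^sub>R x) = 0" and "v \<in> ?B"
    then obtain k where k: "k < n" "v = unit_fsvec k" by auto
    have "(\<Sum>j<n. f (unit_fsvec j) *\<^sub>R unit_fsvec j) = 0"
      using * by (simp add: sum.reindex inj_on_subset[OF inj])
    then have "coord (\<Sum>j<n. f (unit_fsvec j) *\<^sub>R unit_fsvec j) k = 0"
      by (simp add: zero_fsvec.rep_eq)
    then show "f v = 0"
      using k by (simp add: coord_sum scaleR_fsvec.rep_eq unit_fsvec.rep_eq of_bool_def
          if_distrib[of "\<lambda>u. _ * u"] cong: if_cong)
  qed
  show "card ?B = n" by (simp add: card_image inj_on_subset[OF inj])
qed

section \<open>Medial axis and reach\<close>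

text \<open>
  Throughout, \<open>E\<close> is the ambient Euclidean space, a finite-dimensional subspace of a real inner
  product space; the theorem uses \<open>E = euclid D\<close>.
\<close>

definition medial_axis :: "'v::real_inner set \<Rightarrow> 'v set \<Rightarrow> 'v set" where
  "medial_axis E A =
     {z \<in> E. \<exists>p\<in>A. \<exists>q\<in>A. p \<noteq> q \<and> norm (p - z) = infdist z A \<and> norm (q - z) = infdist z A}"

definition reach :: "'v::real_inner set \<Rightarrow> 'v set \<Rightarrow> ennreal" where
  "reach E A = (INF z\<in>medial_axis E A. ennreal (infdist z A))"

section \<open>Submanifolds and geodesics\<close>

text \<open>
  \<open>S\<close> is meant to be open in a finite-dimensional subspace \<open>E\<close>. Then \<open>f'\<close> and \<open>f''\<close> are determined
  by \<open>f\<close> on the vectors of \<open>E\<close> only; as the orthogonal projection onto \<open>E\<close> is bounded, being able to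
  choose them continuous on \<open>S\<close> is the same as the usual derivatives in \<open>E\<close> being continuous.
\<close>

definition C2_on :: "'v::real_normed_vector set \<Rightarrow> ('v \<Rightarrow> 'v) \<Rightarrow> bool" where
  "C2_on S f \<longleftrightarrow>
     (\<exists>(f' :: 'v \<Rightarrow> 'v \<Rightarrow>\<^sub>L 'v) (f'' :: 'v \<Rightarrow> 'v \<Rightarrow>\<^sub>L 'v \<Rightarrow>\<^sub>L 'v).
        (\<forall>x\<in>S. (f has_derivative blinfun_apply (f' x)) (at x within S)) \<and>
        (\<forall>x\<in>S. (f' has_derivative blinfun_apply (f'' x)) (at x within S)) \<and>
        continuous_on S f'')"

definition C2_submanifold :: "'v::real_inner set \<Rightarrow> nat \<Rightarrow> 'v set \<Rightarrow> bool" where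
  "C2_submanifold E d M \<longleftrightarrow> M \<subseteq> E \<and>
     (\<forall>p\<in>M. \<exists>U V F \<phi> \<psi>.
        openin (top_of_set E) U \<and> p \<in> U \<and> openin (top_of_set E) V \<and>
        subspace F \<and> F \<subseteq> E \<and> dim F = d \<and>
        homeomorphism U V \<phi> \<psi> \<and> C2_on U \<phi> \<and> C2_on V \<psi> \<and>
        \<phi> ` (M \<inter> U) = F \<inter> V)"

definition tangent_space :: "'v::real_normed_vector set \<Rightarrow> 'v \<Rightarrow> 'v set" where
  "tangent_space M p =
     {v. \<exists>\<gamma> \<epsilon>. \<epsilon> > 0 \<and> \<gamma> C1_differentiable_on {-\<epsilon><..<\<epsilon>} \<and> \<gamma> ` {-\<epsilon><..<\<epsilon>} \<subseteq> M \<and>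
         \<gamma> 0 = p \<and> (\<gamma> has_vector_derivative v) (at 0)}"

definition curve_deriv :: "nat \<Rightarrow> (real \<Rightarrow> 'v::real_normed_vector) \<Rightarrow> real \<Rightarrow> 'v" where
  "curve_deriv k = (\<lambda>\<gamma> t. vector_derivative \<gamma> (at t)) ^^ k"

definition Ck_curve :: "nat \<Rightarrow> (real \<Rightarrow> 'v::real_normed_vector) \<Rightarrow> bool" where
  "Ck_curve k \<gamma> \<longleftrightarrow>
     (\<forall>j<k. \<forall>t. curve_deriv j \<gamma> differentiable at t) \<and> continuous_on UNIV (curve_deriv k \<gamma>)"

text \<open>
  Geodesics of a \<open>C\<^sup>2\<close> submanifold are the curves in it whose acceleration is normal to it. The
  submanifolds considered are compact, hence complete, so geodesics are defined on all of \<open>\<real>\<close>.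
\<close>

definition unit_speed_geodesic ::
    "'v::real_inner set \<Rightarrow> 'v \<Rightarrow> 'v \<Rightarrow> (real \<Rightarrow> 'v) \<Rightarrow> bool" where
  "unit_speed_geodesic M p v \<gamma> \<longleftrightarrow>
     range \<gamma> \<subseteq> M \<and> Ck_curve 2 \<gamma> \<and> \<gamma> 0 = p \<and> curve_deriv 1 \<gamma> 0 = v \<and>
     (\<forall>t. norm (curve_deriv 1 \<gamma> t) = 1) \<and>
     (\<forall>t. \<forall>w\<in>tangent_space M (\<gamma> t). curve_deriv 2 \<gamma> t \<bullet> w = 0)"

definition manifold_class :: "'v::real_inner set \<Rightarrow> nat \<Rightarrow> real \<Rightarrow> real \<Rightarrow> 'v set set" where
  "manifold_class E d \<tau>min L =
     {M. C2_submanifold E d M \<and> compact M \<and> connected M \<and> reach E M \<ge> ennreal \<tau>min \<and>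
         (\<forall>p\<in>M. \<forall>v\<in>tangent_space M p. \<forall>\<gamma>. norm v = 1 \<and> unit_speed_geodesic M p v \<gamma> \<longrightarrow>
            Ck_curve 3 \<gamma> \<and> norm (curve_deriv 3 \<gamma> 0) \<le> L)}"

section \<open>Hausdorff measure\<close>

text \<open>
  The normalisation makes the \<open>d\<close>-dimensional Hausdorff measure agree with Lebesgue measure on
  \<open>\<real>\<^sup>d\<close>. Boundedness is required because \<^const>\<open>diameter\<close> is unspecified on unbounded sets. Only
  \<open>d \<ge> 1\<close> is meaningful, as empty covering sets must count \<open>0\<close>.
\<close>

definition hausdorff_content :: "nat \<Rightarrow> real \<Rightarrow> 'v::metric_space set \<Rightarrow> ennreal" where
  "hausdorff_content d \<delta> A =
     (INF C\<in>{C :: nat \<Rightarrow> 'v set. A \<subseteq> (\<Union>i. C i) \<and> (\<forall>i. bounded (C i) \<and> diameter (C i) \<le> \<delta>)}.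
        \<Sum>i. ennreal (unit_ball_vol (real d) * (diameter (C i) / 2) ^ d))"

definition hausdorff_measure :: "nat \<Rightarrow> 'v::metric_space measure" where
  "hausdorff_measure d =
     measure_of UNIV (sets borel) (\<lambda>A. SUP \<delta>\<in>{0<..}. hausdorff_content d \<delta> A)"

definition sphere_vol :: "nat \<Rightarrow> real" where
  "sphere_vol d = measure (hausdorff_measure d) {x \<in> euclid (d + 1). norm x = 1}"

section \<open>The Grassmannian\<close>

definition grassmannian :: "'v::real_inner set \<Rightarrow> nat \<Rightarrow> 'v set set" where
  "grassmannian E d = {T. subspace T \<and> T \<subseteq> E \<and> dim T = d}"

definition orth_proj :: "'v::real_inner set \<Rightarrow> 'v \<Rightarrow> 'v" where
  "orth_proj T x = (THE y. y \<in> T \<and> (\<forall>w\<in>T. (x - y) \<bullet> w = 0))"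

definition grassmannian_dist :: "'v::real_inner set \<Rightarrow> 'v set \<Rightarrow> real" where
  "grassmannian_dist T T' = onorm (\<lambda>x. orth_proj T x - orth_proj T' x)"

definition grassmannian_borel :: "'v::real_inner set \<Rightarrow> nat \<Rightarrow> 'v set measure" where
  "grassmannian_borel E d = sigma (grassmannian E d)
     {\<U>. \<U> \<subseteq> grassmannian E d \<and>
         (\<forall>T\<in>\<U>. \<exists>\<epsilon>>0. \<forall>T'\<in>grassmannian E d. grassmannian_dist T T' < \<epsilon> \<longrightarrow> T' \<in> \<U>)}"

section \<open>Statistical model and minimax risk\<close>

definition measure_support :: "'v::topological_space measure \<Rightarrow> 'v set" where
  "measure_support Q = {x \<in> space Q. \<forall>U. open U \<and> x \<in> U \<longrightarrow> emeasure Q (U \<inter> space Q) > 0}"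

definition point_laws ::
    "'v::real_inner set \<Rightarrow> nat \<Rightarrow> real \<Rightarrow> real \<Rightarrow> real \<Rightarrow> 'v measure set" where
  "point_laws E d \<tau>min L fmin =
     {Q. prob_space Q \<and> sets Q = sets (restrict_space borel E) \<and>
         measure_support Q \<in> manifold_class E d \<tau>min L \<and>
         (\<exists>f :: 'v \<Rightarrow> real. f \<in> borel_measurable borel \<and>
            (\<forall>x\<in>measure_support Q. f x \<ge> fmin) \<and>
            Q = density (restrict_space (hausdorff_measure d) E)
                  (\<lambda>x. ennreal (f x) * indicator (measure_support Q) x))}"

definition obs_space :: "'v::real_inner set \<Rightarrow> nat \<Rightarrow> ('v \<times> 'v set) measure" where
  "obs_space E d = restrict_space borel E \<Otimes>\<^sub>M grassmannian_borel E d"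

text \<open>
  The law of \<open>(X, T\<^sub>X M)\<close> for \<open>X \<sim> Q\<close>. The tangent space is defined only on the support \<open>M\<close> of \<open>Q\<close>,
  which has full measure; hence the restriction.
\<close>

definition tangent_law :: "'v::real_inner set \<Rightarrow> nat \<Rightarrow> 'v measure \<Rightarrow> ('v \<times> 'v set) measure" where
  "tangent_law E d Q =
     distr (restrict_space Q (measure_support Q)) (obs_space E d)
       (\<lambda>x. (x, tangent_space (measure_support Q) x))"

definition model ::
    "'v::real_inner set \<Rightarrow> nat \<Rightarrow> real \<Rightarrow> real \<Rightarrow> real \<Rightarrow> ('v \<times> 'v set) measure set" where
  "model E d \<tau>min L fmin = tangent_law E d ` point_laws E d \<tau>min L fmin"

definition law_reach :: "'v::real_inner set \<Rightarrow> ('v \<times> 'v set) measure \<Rightarrow> ennreal" where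
  "law_reach E P = reach E (measure_support (distr P (restrict_space borel E) fst))"

definition estimators ::
    "'v::real_inner set \<Rightarrow> nat \<Rightarrow> nat \<Rightarrow> ((nat \<Rightarrow> 'v \<times> 'v set) \<Rightarrow> ennreal) set" where
  "estimators E d n =
     {\<tau>h. \<tau>h \<in> borel_measurable (PiM {..<n} (\<lambda>_. obs_space E d)) \<and>
          (\<forall>s\<in>space (PiM {..<n} (\<lambda>_. obs_space E d)). \<tau>h s > 0)}"

text \<open>
  In \<^typ>\<open>ennreal\<close>, \<open>inverse \<infinity> = 0\<close>. The reach of a law in the model and the values of an estimator
  are positive, so the inverses are finite and \<^const>\<open>enn2real\<close> loses nothing; the difference is
  taken in \<open>\<real>\<close> because subtraction of extended nonnegative reals is truncated.
\<close>

definition minimax_risk ::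
    "'v::real_inner set \<Rightarrow> nat \<Rightarrow> real \<Rightarrow> real \<Rightarrow> real \<Rightarrow> real \<Rightarrow> nat \<Rightarrow> ennreal" where
  "minimax_risk E d \<tau>min L fmin p n =
     (INF \<tau>h\<in>estimators E d n. SUP P\<in>model E d \<tau>min L fmin.
        \<integral>\<^sup>+ s. ennreal (\<bar>enn2real (inverse (law_reach E P)) - enn2real (inverse (\<tau>h s))\<bar> powr p)
          \<partial>PiM {..<n} (\<lambda>_. P))"

end

theory Submission
  imports Defs
begin

text \<open>
  The bound is a two-point bound in the sense of Le Cam. One hypothesis is the uniform law on the
  sphere of radius \<open>r = 2 \<tau>\<close>, where \<open>\<tau>\<close> is the smallest reach that the model admits. The other is the
  uniform law on a hypersurface of revolution \<open>x \<bullet> x = r\<^sup>2 + \<beta> (norm (flat x)\<^sup>2)\<close>, where \<open>flat\<close> removes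
  the coordinate along the axis and \<open>\<beta>\<close> is a bump over the two poles, of width \<open>\<delta> r\<close> and height of
  order \<open>\<delta>\<^sup>3 r\<^sup>2\<close>. With this scaling the third derivatives of the bump stay of order \<open>1 / r\<close> for every
  \<open>\<delta>\<close>, while the curvature at the poles, and with it the inverse of the reach, grows by an amount of
  order \<open>\<delta> / r\<close>. Outside a set of mass of order \<open>\<delta>\<^sup>d\<close> the two laws differ only by their normalising
  constants, whose ratio is \<open>1\<close> up to the same order. With \<open>\<delta> = n powr (- 1 / d)\<close> a sample of size \<open>n\<close>
  therefore avoids that set with a probability bounded away from \<open>0\<close>. A sample that does so is
  distributed alike under both laws, and every estimator of the inverse reach is wrong by an amount of
  order \<open>\<delta> / \<tau>\<close> under one of them (\<open>two_point_bound\<close>, \<open>minimax_risk_two_point\<close>).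

  The factor \<open>2\<close> between \<open>r\<close> and \<open>\<tau>\<close> is the room in which the perturbation takes place: the sphere has
  reach \<open>r\<close>, third derivatives of geodesics of norm \<open>1 / r\<^sup>2\<close> and density \<open>1 / (r\<^sup>d \<sigma>)\<close>, where \<open>\<sigma>\<close> is the
  volume of the unit sphere, and the model admits \<open>r / 2\<close>, \<open>2 / r\<^sup>2\<close> and \<open>1 / (2 r\<^sup>d \<sigma>)\<close>. That the perturbed
  hypersurface remains in the model is checked on its equation, whose gradient is a multiple of the
  normal \<open>x - \<beta>' flat x\<close>. Taylor's formula along the segment between two points bounds the normal part
  of their difference by a multiple of their squared distance (\<open>second_order_normal\<close>), and this is
  Federer's criterion for a lower bound on the reach (\<open>reach_M\<close>). Differentiating the equation twice
  along a geodesic expresses its acceleration through position and velocity, and one further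
  differentiation gives the third derivative (\<open>geodesic_third_derivative\<close>). For the upper bound on the
  reach (\<open>reach_M_le\<close>), a point of the axis slightly off the centre is closer to the rim of the bump
  than to the pole above it; its nearest points then lie off the axis, and by symmetry there are two.

  Hausdorff measure enters only through Lipschitz maps between pieces of the hypersurface, of the
  sphere and of a disk. They bound the mass of the bump by \<open>\<delta>\<^sup>d\<close> times the volume of the sphere up to a
  constant that depends on \<open>d\<close> (\<open>emeasure_bump\<close>), and show that every relatively open piece of the
  hypersurface has positive mass (\<open>emeasure_M_open\<close>).
\<close>

section \<open>Finite-dimensional coordinate subspaces\<close>

lemma coord_inner_unit: "x \<bullet> unit_fsvec i = coord x i"
proof -
  have "unit_fsvec i \<bullet> x = (\<Sum>j\<in>{i}. coord (unit_fsvec i) j * coord x j)"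
    by (rule inner_fsvec_superset) (auto simp: unit_fsvec.rep_eq)
  then show ?thesis by (simp add: unit_fsvec.rep_eq inner_commute)
qed

lemma norm_unit_fsvec [simp]: "norm (unit_fsvec i) = 1"
  by (simp add: norm_eq_sqrt_inner coord_inner_unit unit_fsvec.rep_eq)

lemma unit_fsvec_in_euclid [simp]: "i < n \<Longrightarrow> unit_fsvec i \<in> euclid n"
  by (auto simp: euclid_def unit_fsvec.rep_eq)

lemma euclid_mono: "m \<le> n \<Longrightarrow> euclid m \<subseteq> euclid n"
  by (auto simp: euclid_def)

lemma euclid_eq_inner: "euclid n = {x. \<forall>i\<ge>n. x \<bullet> unit_fsvec i = 0}"
  by (simp add: euclid_def coord_inner_unit)

lemma closed_euclid: "closed (euclid n)"
proof -
  have "euclid n = (\<Inter>i\<in>{n..}. {x. x \<bullet> unit_fsvec i = 0})"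
    by (auto simp: euclid_eq_inner)
  moreover have "closed {x. x \<bullet> unit_fsvec i = 0}" for i
    by (intro closed_Collect_eq continuous_intros)
  ultimately show ?thesis by auto
qed

lemma compact_box_euclid: "compact {x \<in> euclid n. \<forall>i<n. \<bar>coord x i\<bar> \<le> c}"
proof (induction n)
  case 0
  have "euclid 0 = {0}"
    by (auto simp: euclid_def zero_fsvec.rep_eq intro!: fsvec_eqI)
  then show ?case by simp
next
  case (Suc n)
  let ?B = "{x \<in> euclid n. \<forall>i<n. \<bar>coord x i\<bar> \<le> c}"
  let ?f = "\<lambda>(x, t). x + t *\<^sub>R unit_fsvec n"
  have "{x \<in> euclid (Suc n). \<forall>i<Suc n. \<bar>coord x i\<bar> \<le> c} = ?f ` (?B \<times> {-c..c})" (is "?L = ?R")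
  proof
    show "?L \<subseteq> ?R"
    proof
      fix x assume x: "x \<in> ?L"
      let ?y = "x - coord x n *\<^sub>R unit_fsvec n"
      have "coord ?y i = (if i = n then 0 else coord x i)" for i
        by (auto simp: minus_fsvec.rep_eq scaleR_fsvec.rep_eq unit_fsvec.rep_eq)
      then have "?y \<in> ?B" "coord x n \<in> {-c..c}"
        using x by (auto simp: euclid_def le_Suc_eq abs_le_iff Suc_le_eq) 
      then show "x \<in> ?R"
        by (intro image_eqI[of _ _ "(?y, coord x n)"]) auto
    qed
    show "?R \<subseteq> ?L"
      by (auto simp: euclid_def plus_fsvec.rep_eq scaleR_fsvec.rep_eq unit_fsvec.rep_eq less_Suc_eq)
  qed
  moreover have "compact (?f ` (?B \<times> {-c..c}))"
    unfolding case_prod_beta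
    by (intro compact_continuous_image compact_Times Suc.IH continuous_intros compact_Icc)
  ultimately show ?case by simp
qed

text \<open>
  The ambient type is infinite-dimensional and not locally compact; compactness comes from the boxes
  of \<open>euclid n\<close>, built up one coordinate at a time.
\<close>

lemma compact_euclid:
  assumes "closed S" "S \<subseteq> euclid n" "\<And>x. x \<in> S \<Longrightarrow> norm x \<le> c"
  shows "compact S"
proof -
  have "\<bar>coord x i\<bar> \<le> c" if "x \<in> S" for x i
    using assms(3)[OF that] Cauchy_Schwarz_ineq2[of x "unit_fsvec i"] by (simp add: coord_inner_unit)
  then have "S = S \<inter> {x \<in> euclid n. \<forall>i<n. \<bar>coord x i\<bar> \<le> c}"
    using assms(2) by auto
  moreover have "compact \<dots>"
    by (intro closed_Int_compact compact_box_euclid assms)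
  ultimately show ?thesis by simp
qed

definition perp :: "'a::real_inner \<Rightarrow> 'a \<Rightarrow> 'a" where
  "perp e x = x - (x \<bullet> e) *\<^sub>R e"

lemma bounded_linear_perp: "bounded_linear (perp e)"
  unfolding perp_def [abs_def]
  by (intro bounded_linear_sub bounded_linear_ident bounded_linear_scaleR_const bounded_linear_inner_left)

lemmas perp_linear = bounded_linear.linear[OF bounded_linear_perp]
lemmas perp_add = linear_add[OF perp_linear]
lemmas perp_diff = linear_diff[OF perp_linear]
lemmas perp_scaleR = linear_scale[OF perp_linear]

lemma perp_decomp: "x = perp e x + (x \<bullet> e) *\<^sub>R e"
  by (simp add: perp_def)

lemma perp_uminus: "perp (- e) = perp e"
  by (simp add: perp_def fun_eq_iff)

lemma perp_inner_commute: "perp e x \<bullet> y = x \<bullet> perp e y"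
  by (simp add: perp_def inner_diff_left inner_diff_right inner_commute)

context
  fixes e :: "'a::real_inner"
  assumes e: "norm e = 1"
begin

lemma inner_unit: "e \<bullet> e = 1"
  using e by (simp add: norm_eq_1)

lemma perp_self: "perp e e = 0"
  by (simp add: perp_def inner_unit)

lemma perp_inner_unit: "perp e x \<bullet> e = 0"
  by (simp add: perp_inner_commute perp_self)

lemma perp_idem: "perp e (perp e x) = perp e x"
  by (simp add: perp_def[of e "perp e x"] perp_inner_unit)

lemma perp_inner_perp: "perp e x \<bullet> perp e y = perp e x \<bullet> y"
  by (simp add: perp_inner_commute[symmetric] perp_idem)

lemma perp_pythagoras: "x \<bullet> x = perp e x \<bullet> x + (x \<bullet> e)\<^sup>2"
  by (simp add: perp_def inner_diff_left power2_eq_square inner_commute[of e x])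

lemma perp_nonneg: "0 \<le> perp e x \<bullet> x"
  using perp_inner_perp[of x x] inner_ge_zero[of "perp e x"] by simp

lemma norm_perp: "norm (perp e x) = sqrt (perp e x \<bullet> x)"
  by (simp add: norm_eq_sqrt_inner perp_inner_perp)

lemma norm_perp_le: "norm (perp e x) \<le> norm x"
  using perp_pythagoras[of x] by (simp add: norm_perp norm_eq_sqrt_inner[of x])

lemma perp_add_unit: "perp e (x + t *\<^sub>R e) = perp e x"
  by (simp add: perp_add perp_scaleR perp_self)

end

lemma dim_hyperplane_section:
  assumes e: "norm e = 1" "e \<in> euclid (Suc n)"
  shows "dim {x \<in> euclid (Suc n). x \<bullet> e = 0} = n"
proof -
  let ?F = "{x \<in> euclid (Suc n). x \<bullet> e = 0}"
  have F: "subspace ?F"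
    using subspace_euclid[of "Suc n"] by (auto simp: subspace_def inner_left_distrib)
  obtain B where B: "B \<subseteq> ?F" "independent B" "?F \<subseteq> span B" "card B = dim ?F"
    by (rule basis_exists)
  have eB: "e \<notin> span B"
    using span_minimal[OF B(1) F] inner_unit[OF e(1)] by auto
  have fin: "finite B"
  proof -
    have "euclid (Suc n) \<subseteq> span (unit_fsvec ` {..<Suc n})"
    proof
      fix x assume "x \<in> euclid (Suc n)"
      then have "x = (\<Sum>k<Suc n. coord x k *\<^sub>R unit_fsvec k)"
        by (intro fsvec_eqI)
          (auto simp: coord_sum scaleR_fsvec.rep_eq unit_fsvec.rep_eq euclid_def of_bool_def
            if_distrib[of "\<lambda>u. _ * u"] simp del: sum.lessThan_Suc cong: if_cong)
      also have "\<dots> \<in> span (unit_fsvec ` {..<Suc n})"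
        by (intro span_sum span_scale span_base) auto
      finally show "x \<in> span (unit_fsvec ` {..<Suc n})" .
    qed
    then have "B \<subseteq> span (unit_fsvec ` {..<Suc n})" using B(1) by auto
    then show ?thesis using independent_span_bound[OF _ B(2)] by blast
  qed
  have "dim (euclid (Suc n)) = card (insert e B)"
  proof (rule dim_unique[OF _ _ _ refl])
    show "insert e B \<subseteq> euclid (Suc n)" using B e by auto
    show "independent (insert e B)" using B(2) eB by (simp add: independent_insert)
    show "euclid (Suc n) \<subseteq> span (insert e B)"
    proof
      fix x assume x: "x \<in> euclid (Suc n)"
      have "perp e x \<in> ?F"
        using x e subspace_euclid[of "Suc n"] perp_inner_unit[OF e(1)]
        by (auto simp: perp_def intro!: subspace_diff subspace_scale)
      then have "perp e x \<in> span (insert e B)"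
        using B(3) span_mono[of B "insert e B"] by blast
      then show "x \<in> span (insert e B)"
        by (subst perp_decomp[of x e], intro span_add)
          (auto intro: span_scale[OF span_base])
    qed
  qed
  moreover have "card (insert e B) = Suc (card B)"
    using eB fin span_base[of e B] by (intro card_insert_disjoint) auto
  ultimately show ?thesis
    using B(4) by (simp add: dim_euclid)
qed

section \<open>Graphs over a hyperplane\<close>

text \<open>
  The second derivative is a combination of a rank-one operator built from \<open>perp e x\<close> and of a fixed
  operator, with coefficients \<open>H2\<close> and \<open>H1\<close>; both operators are continuous in \<open>x\<close> for the operator norm.
\<close>

lemma C2_shear:
  fixes e :: "'v::real_inner" and H H1 H2 :: "real \<Rightarrow> real"
  assumes e: "norm e = 1"
    and H: "\<And>u. u \<in> I \<Longrightarrow> (H has_real_derivative H1 u) (at u)"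
    and H1: "\<And>u. u \<in> I \<Longrightarrow> (H1 has_real_derivative H2 u) (at u)"
    and H2: "continuous_on I H2"
    and S: "\<And>x. x \<in> S \<Longrightarrow> perp e x \<bullet> x \<in> I"
  shows "C2_on S (\<lambda>x. x + H (perp e x \<bullet> x) *\<^sub>R e)"
proof -
  define q where "q x = perp e x \<bullet> x" for x :: 'v
  define P where "P = Blinfun (perp e)"
  have P: "blinfun_apply P = perp e"
    unfolding P_def by (rule bounded_linear_Blinfun_apply[OF bounded_linear_perp])
  define B where "B x = blinfun_scaleR_left e o\<^sub>L blinfun_inner_left x" for x :: 'v
  have B: "blinfun_apply (B x) v = (v \<bullet> x) *\<^sub>R e" for x v
    by (simp add: B_def blinfun_inner_left.rep_eq)
  have BL: "bounded_linear B"
    unfolding B_def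
    by (intro bounded_linear_intros bounded_linear_blinfun_inner_left)
  define BB where "BB = Blinfun B"
  have BB: "blinfun_apply BB = B"
    unfolding BB_def by (rule bounded_linear_Blinfun_apply[OF BL])
  have sym: "perp e v \<bullet> x = perp e x \<bullet> v" for v x :: 'v
    using perp_inner_commute[of e v x] by (simp add: inner_commute[of v])
  have q: "(q has_derivative (\<lambda>v. 2 * (perp e x \<bullet> v))) (at x within S)" for x
    unfolding q_def
    by (rule has_derivative_eq_rhs,
        rule has_derivative_inner[OF bounded_linear_imp_has_derivative[OF bounded_linear_perp] has_derivative_ident])
      (simp add: fun_eq_iff sym inner_commute[of x])
  have qS: "q x \<in> I" if "x \<in> S" for x using S[OF that] by (simp add: q_def)
  have Hq: "((\<lambda>x. H (q x)) has_derivative (\<lambda>v. H1 (q x) * (2 * (perp e x \<bullet> v)))) (at x within S)"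
    if "x \<in> S" for x
    using has_derivative_compose[OF q H[OF qS[OF that], unfolded has_field_derivative_def]]
    by simp
  have H1q: "((\<lambda>x. H1 (q x)) has_derivative (\<lambda>v. H2 (q x) * (2 * (perp e x \<bullet> v)))) (at x within S)"
    if "x \<in> S" for x
    using has_derivative_compose[OF q H1[OF qS[OF that], unfolded has_field_derivative_def]]
    by simp
  have cq: "continuous_on S q"
    by (rule has_derivative_continuous_on[OF q])
  have cH1: "continuous_on S (\<lambda>x. H1 (q x))"
    by (rule has_derivative_continuous_on[OF H1q])
  have cH2: "continuous_on S (\<lambda>x. H2 (q x))"
    by (rule continuous_on_compose2[OF H2 cq]) (use qS in auto)
  define f' where "f' x = id_blinfun + (2 * H1 (q x)) *\<^sub>R B (perp e x)" for x
  define f'' where "f'' x = (4 * H2 (q x)) *\<^sub>R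
      (blinfun_scaleR_left (B (perp e x)) o\<^sub>L blinfun_inner_left (perp e x))
      + (2 * H1 (q x)) *\<^sub>R (BB o\<^sub>L P)" for x
  show ?thesis
    unfolding C2_on_def
  proof (intro exI conjI ballI)
    fix x assume x: "x \<in> S"
    show "((\<lambda>x. x + H (perp e x \<bullet> x) *\<^sub>R e) has_derivative blinfun_apply (f' x)) (at x within S)"
      unfolding q_def[symmetric]
      by (rule has_derivative_eq_rhs, rule has_derivative_add[OF has_derivative_ident],
          rule has_derivative_scaleR_left[OF Hq[OF x]])
        (auto simp: fun_eq_iff f'_def blinfun.add_left blinfun.scaleR_left B inner_commute)
    have PB: "((\<lambda>x. B (perp e x)) has_derivative (\<lambda>u. B (perp e u))) (at x within S)"
      by (rule bounded_linear_imp_has_derivative)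
        (intro bounded_linear_compose[OF BL] bounded_linear_perp)
    show "(f' has_derivative blinfun_apply (f'' x)) (at x within S)"
      unfolding f'_def [abs_def]
      by (rule has_derivative_eq_rhs, rule has_derivative_add[OF has_derivative_const],
          rule has_derivative_scaleR[OF has_derivative_mult_right[OF H1q[OF x]] PB])
        (auto simp: fun_eq_iff f''_def blinfun.add_left blinfun.scaleR_left B BB P
          blinfun_inner_left.rep_eq inner_commute algebra_simps)
  next
    have cP: "continuous_on S (perp e)"
      by (rule linear_continuous_on[OF bounded_linear_perp])
    have cB: "continuous_on S (\<lambda>x. B (perp e x))"
      by (intro linear_continuous_on bounded_linear_compose[OF BL] bounded_linear_perp)
    have 1: "continuous_on S (\<lambda>x. blinfun_scaleR_left (B (perp e x)))"
      by (rule bounded_linear.continuous_on[OF bounded_linear_blinfun_scaleR_left cB])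
    have 2: "continuous_on S (\<lambda>x. blinfun_inner_left (perp e x))"
      by (rule bounded_linear.continuous_on[OF bounded_linear_blinfun_inner_left cP])
    have 3: "continuous_on S (\<lambda>x. blinfun_scaleR_left (B (perp e x)) o\<^sub>L blinfun_inner_left (perp e x))"
      by (rule bounded_bilinear.continuous_on[OF bounded_bilinear_blinfun_compose 1 2])
    show "continuous_on S f''"
      unfolding f''_def [abs_def]
      by (intro continuous_on_add continuous_on_scaleR continuous_on_mult continuous_on_const cH1 cH2 3)
  qed
qed

text \<open>
  Inside \<open>U\<close>, the set \<open>M\<close> is the graph of a \<open>C\<^sup>2\<close> function of the squared distance to the line spanned
  by the unit vector \<open>e\<close>. Spheres have this shape for every direction \<open>e\<close>, and hypersurfaces of
  revolution for the direction of their axis. Letting the height depend on this one real number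
  reduces all differentiability to that of a real function.
\<close>

definition C2_graph_on ::
    "'v::real_inner set \<Rightarrow> 'v set \<Rightarrow> 'v \<Rightarrow> 'v set \<Rightarrow> real set \<Rightarrow> (real \<Rightarrow> real) \<Rightarrow>
      (real \<Rightarrow> real) \<Rightarrow> (real \<Rightarrow> real) \<Rightarrow> bool" where
  "C2_graph_on W M e U I H H1 H2 \<longleftrightarrow> open U \<and> open I \<and>
     (\<forall>u\<in>I. (H has_real_derivative H1 u) (at u)) \<and>
     (\<forall>u\<in>I. (H1 has_real_derivative H2 u) (at u)) \<and> continuous_on I H2 \<and>
     (\<forall>x\<in>U. perp e x \<bullet> x \<in> I) \<and>
     (\<forall>x\<in>W \<inter> U. x \<in> M \<longleftrightarrow> x \<bullet> e = H (perp e x \<bullet> x))"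

definition C2_graph_at :: "'v::real_inner set \<Rightarrow> 'v set \<Rightarrow> 'v \<Rightarrow> 'v \<Rightarrow> bool" where
  "C2_graph_at W M p e \<longleftrightarrow> norm e = 1 \<and> e \<in> W \<and>
     (\<exists>U I H H1 H2. p \<in> U \<and> C2_graph_on W M e U I H H1 H2)"

text \<open>
  The shear along \<open>e\<close> that subtracts the height of the graph flattens \<open>M\<close>, and its inverse is
  the shear that adds it back.
\<close>

lemma C2_graph_at_chart:
  assumes G: "C2_graph_at W M p e"
    and W: "subspace W" "W \<subseteq> E" and E: "subspace E" and p: "p \<in> M" "M \<subseteq> W"
    and d: "dim {x \<in> W. x \<bullet> e = 0} = d"
  shows "\<exists>U V F \<phi> \<psi>. openin (top_of_set E) U \<and> p \<in> U \<and> openin (top_of_set E) V \<and>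
        subspace F \<and> F \<subseteq> E \<and> dim F = d \<and>
        homeomorphism U V \<phi> \<psi> \<and> C2_on U \<phi> \<and> C2_on V \<psi> \<and> \<phi> ` (M \<inter> U) = F \<inter> V"
proof -
  obtain O' I H H1 H2 where e: "norm e = 1" "e \<in> W" and pO: "p \<in> O'"
    and data: "C2_graph_on W M e O' I H H1 H2"
    using G unfolding C2_graph_at_def by auto
  have O': "open O'" "p \<in> O'" and I: "open I" and H2: "continuous_on I H2"
    and H: "\<And>u. u \<in> I \<Longrightarrow> (H has_real_derivative H1 u) (at u)"
    and H1: "\<And>u. u \<in> I \<Longrightarrow> (H1 has_real_derivative H2 u) (at u)"
    and OI: "\<And>x. x \<in> O' \<Longrightarrow> perp e x \<bullet> x \<in> I"
    and M: "\<And>x. x \<in> W \<Longrightarrow> x \<in> O' \<Longrightarrow> x \<in> M \<longleftrightarrow> x \<bullet> e = H (perp e x \<bullet> x)"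
    using data pO unfolding C2_graph_on_def by simp_all
  define q where "q x = perp e x \<bullet> x" for x
  define \<phi> where "\<phi> x = x - H (q x) *\<^sub>R e" for x
  define \<psi> where "\<psi> x = x + H (q x) *\<^sub>R e" for x
  define F where "F = {x \<in> W. x \<bullet> e = 0}"
  define Q where "Q = {x. q x \<in> I}"
  define N where "N = Q \<inter> \<psi> -` O'"
  have qe: "q (x + t *\<^sub>R e) = q x" for x t
    using e(1) by (simp add: q_def perp_add_unit inner_right_distrib perp_inner_unit)
  have q\<phi>: "q (\<phi> x) = q x" for x
    using qe[of x "- H (q x)"] by (simp add: \<phi>_def)
  have q\<psi>: "q (\<psi> x) = q x" for x
    using qe[of x "H (q x)"] by (simp add: \<psi>_def)
  have \<phi>\<psi>: "\<phi> (\<psi> x) = x" "\<psi> (\<phi> x) = x" for x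
    using q\<phi>[of x] q\<psi>[of x] by (simp_all add: \<phi>_def[of "\<psi> x"] \<psi>_def[of "\<phi> x"]) (simp_all add: \<phi>_def \<psi>_def)
  have EE: "\<phi> x \<in> E" "\<psi> x \<in> E" if "x \<in> E" for x
    using that e W E by (auto simp: \<phi>_def \<psi>_def intro!: subspace_add subspace_diff subspace_scale)
  have cq: "continuous_on S q" for S
    unfolding q_def by (intro continuous_on_inner linear_continuous_on bounded_linear_perp continuous_on_id)
  have cH: "continuous_on I H"
    using H by (meson DERIV_continuous_on has_field_derivative_at_within)
  have cHq: "continuous_on Q (\<lambda>x. H (q x))"
    by (rule continuous_on_compose2[OF cH cq]) (auto simp: Q_def)
  have c\<phi>: "continuous_on Q \<phi>" and c\<psi>: "continuous_on Q \<psi>"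
    unfolding \<phi>_def \<psi>_def by (intro continuous_intros cHq)+
  have oQ: "open Q"
    using continuous_open_preimage[OF cq[of UNIV] open_UNIV I] by (simp add: Q_def vimage_def)
  have oN: "open N"
    unfolding N_def by (rule continuous_open_preimage[OF c\<psi> oQ O'(1)])
  have OQ: "O' \<subseteq> Q" using OI by (auto simp: Q_def q_def)
  have \<phi>N: "\<phi> x \<in> N \<longleftrightarrow> x \<in> O'" for x
    using OQ by (auto simp: N_def \<phi>\<psi> Q_def q\<phi>)
  have img: "\<phi> ` (E \<inter> O') = E \<inter> N" "\<psi> ` (E \<inter> N) = E \<inter> O'"
  proof -
    show "\<phi> ` (E \<inter> O') = E \<inter> N"
    proof
      show "\<phi> ` (E \<inter> O') \<subseteq> E \<inter> N" using EE \<phi>N by auto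
      show "E \<inter> N \<subseteq> \<phi> ` (E \<inter> O')"
        by (rule subsetI, rule image_eqI[where x = "\<psi> _"]) (auto simp: \<phi>\<psi> EE N_def)
    qed
    then have "\<psi> ` (E \<inter> N) = \<psi> ` \<phi> ` (E \<inter> O')" by simp
    then show "\<psi> ` (E \<inter> N) = E \<inter> O'" by (simp add: image_image \<phi>\<psi>)
  qed
  have hom: "homeomorphism (E \<inter> O') (E \<inter> N) \<phi> \<psi>"
    unfolding homeomorphism_def using img
    by (auto simp: \<phi>\<psi> intro!: continuous_on_subset[OF c\<phi>] continuous_on_subset[OF c\<psi>])
      (use OQ in \<open>auto simp: N_def\<close>)
  have inter: "\<phi> ` (M \<inter> (E \<inter> O')) = F \<inter> (E \<inter> N)"
  proof
    have \<phi>e: "\<phi> x \<bullet> e = x \<bullet> e - H (q x)" for x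
      by (simp add: \<phi>_def inner_diff_left inner_unit[OF e(1)])
    show "\<phi> ` (M \<inter> (E \<inter> O')) \<subseteq> F \<inter> (E \<inter> N)"
    proof
      fix y assume "y \<in> \<phi> ` (M \<inter> (E \<inter> O'))"
      then obtain x where x: "x \<in> M" "x \<in> E" "x \<in> O'" "y = \<phi> x" by auto
      have "x \<in> W" using x(1) p by auto
      then have "\<phi> x \<in> W" using e W by (auto simp: \<phi>_def intro!: subspace_diff subspace_scale)
      moreover have "\<phi> x \<bullet> e = 0" using M[OF \<open>x \<in> W\<close> x(3)] x(1) by (simp add: \<phi>e q_def)
      ultimately show "y \<in> F \<inter> (E \<inter> N)" using x EE \<phi>N by (auto simp: F_def)
    qed
    show "F \<inter> (E \<inter> N) \<subseteq> \<phi> ` (M \<inter> (E \<inter> O'))"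
    proof
      fix y assume y: "y \<in> F \<inter> (E \<inter> N)"
      have 1: "\<psi> y \<in> W" using y e W by (auto simp: F_def \<psi>_def intro!: subspace_add subspace_scale)
      have 2: "\<psi> y \<in> O'" using y by (auto simp: N_def)
      have "\<psi> y \<bullet> e = H (q (\<psi> y))"
        unfolding q\<psi> using y inner_unit[OF e(1)] by (simp add: F_def \<psi>_def inner_left_distrib)
      then have "\<psi> y \<in> M" using M[OF 1 2] by (simp add: q_def)
      then show "y \<in> \<phi> ` (M \<inter> (E \<inter> O'))"
        using 2 EE y by (intro image_eqI[of _ _ "\<psi> y"]) (auto simp: \<phi>\<psi>)
    qed
  qed
  have C\<psi>: "C2_on (E \<inter> N) \<psi>"
    unfolding \<psi>_def q_def by (rule C2_shear[OF e(1) H H1 H2]) (auto simp: N_def Q_def q_def)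
  have C\<phi>: "C2_on (E \<inter> O') \<phi>"
    unfolding \<phi>_def q_def
    using C2_shear[where H = "\<lambda>u. - H u" and ?H1.0 = "\<lambda>u. - H1 u" and ?H2.0 = "\<lambda>u. - H2 u" and S = "E \<inter> O'",
        OF e(1) DERIV_minus[OF H] DERIV_minus[OF H1] continuous_on_minus[OF H2]] OI
    by simp
  show ?thesis
  proof (intro exI conjI)
    show "openin (top_of_set E) (E \<inter> O')" "openin (top_of_set E) (E \<inter> N)"
      using O'(1) oN by (auto simp: openin_open)
    show "p \<in> E \<inter> O'" using p W O'(2) by auto
    show "subspace F" using W(1) by (auto simp: subspace_def F_def inner_left_distrib)
    show "F \<subseteq> E" using W by (auto simp: F_def)
    show "dim F = d" using d by (simp add: F_def)
  qed (rule hom C\<phi> C\<psi> inter)+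
qed

text \<open>
  Lifting a line of the flat model to the graph moves its velocity along \<open>e\<close> only.
\<close>

lemma C2_graph_at_tangent:
  assumes G: "C2_graph_at W M p e" and W: "subspace W" and p: "p \<in> M" "M \<subseteq> W" and v: "v \<in> W"
  shows "\<exists>c. v + c *\<^sub>R e \<in> tangent_space M p"
proof -
  obtain O' I H H1 H2 where e: "norm e = 1" "e \<in> W" and pO: "p \<in> O'"
    and data: "C2_graph_on W M e O' I H H1 H2"
    using G unfolding C2_graph_at_def by auto
  have O': "open O'" "p \<in> O'" and I: "open I" and H2: "continuous_on I H2"
    and H: "\<And>u. u \<in> I \<Longrightarrow> (H has_real_derivative H1 u) (at u)"
    and H1: "\<And>u. u \<in> I \<Longrightarrow> (H1 has_real_derivative H2 u) (at u)"
    and OI: "\<And>x. x \<in> O' \<Longrightarrow> perp e x \<bullet> x \<in> I"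
    and M: "\<And>x. x \<in> W \<Longrightarrow> x \<in> O' \<Longrightarrow> x \<in> M \<longleftrightarrow> x \<bullet> e = H (perp e x \<bullet> x)"
    using data pO unfolding C2_graph_on_def by simp_all
  define l where "l t = perp e p + t *\<^sub>R perp e v" for t :: real
  define Q where "Q t = l t \<bullet> l t" for t
  define \<gamma> where "\<gamma> t = l t + H (Q t) *\<^sub>R e" for t
  define \<gamma>' where "\<gamma>' t = perp e v + (H1 (Q t) * (2 * (l t \<bullet> perp e v))) *\<^sub>R e" for t
  have le: "perp e (l t) = l t" "l t \<bullet> e = 0" for t
    using e by (simp_all add: l_def perp_add perp_scaleR perp_idem inner_left_distrib perp_inner_unit)
  have q\<gamma>: "perp e (\<gamma> t) \<bullet> \<gamma> t = Q t" "\<gamma> t \<bullet> e = H (Q t)" for t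
    using e le by (simp_all add: \<gamma>_def perp_add_unit inner_left_distrib inner_right_distrib Q_def inner_unit)
  have pI: "perp e p \<bullet> p \<in> I" using OI O' by auto
  have Q0: "Q 0 = perp e p \<bullet> p"
    using e by (simp add: Q_def l_def perp_inner_perp)
  have \<gamma>0: "\<gamma> 0 = p"
    using M[of p] p O' perp_decomp[of p e] by (auto simp: \<gamma>_def Q0 l_def)
  have cQ: "continuous_on UNIV Q"
    unfolding Q_def l_def by (intro continuous_intros)
  have dl: "(l has_vector_derivative perp e v) (at t)" for t
    unfolding l_def by (auto intro!: derivative_eq_intros)
  have dQ: "(Q has_real_derivative 2 * (l t \<bullet> perp e v)) (at t)" for t
    unfolding Q_def has_real_derivative_iff_has_vector_derivative
    using bounded_bilinear.has_vector_derivative[OF bounded_bilinear_inner dl[of t] dl[of t]]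
    by (simp add: inner_commute)
  have d\<gamma>: "(\<gamma> has_vector_derivative \<gamma>' t) (at t)" if "Q t \<in> I" for t
  proof -
    have "((\<lambda>t. H (Q t)) has_real_derivative H1 (Q t) * (2 * (l t \<bullet> perp e v))) (at t)"
      by (rule DERIV_chain2[OF H[OF that] dQ])
    then show ?thesis
      unfolding \<gamma>_def \<gamma>'_def
      by (intro has_vector_derivative_add dl)
        (auto intro!: derivative_eq_intros simp: has_real_derivative_iff_has_vector_derivative)
  qed
  let ?J = "{t. Q t \<in> I}"
  have oJ: "open ?J"
    using continuous_open_preimage[OF cQ open_UNIV I] by (simp add: vimage_def)
  have c\<gamma>: "continuous_on ?J \<gamma>"
    using d\<gamma> by (auto intro!: continuous_at_imp_continuous_on has_vector_derivative_continuous)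
  have "open (?J \<inter> \<gamma> -` O')" "0 \<in> ?J \<inter> \<gamma> -` O'"
    using continuous_open_preimage[OF c\<gamma> oJ O'(1)] Q0 pI \<gamma>0 O' by auto
  then obtain \<epsilon> where \<epsilon>: "\<epsilon> > 0" "ball 0 \<epsilon> \<subseteq> ?J \<inter> \<gamma> -` O'"
    unfolding open_contains_ball by blast
  then have int: "Q t \<in> I" "\<gamma> t \<in> O'" if "t \<in> {-\<epsilon><..<\<epsilon>}" for t
    using that by (auto simp: subset_eq dist_real_def abs_less_iff)
  have cont: "continuous_on {-\<epsilon><..<\<epsilon>} \<gamma>'"
  proof -
    have "continuous_on I H1" using H1 by (meson DERIV_continuous_on has_field_derivative_at_within)
    then have "continuous_on {-\<epsilon><..<\<epsilon>} (\<lambda>t. H1 (Q t))"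
      by (rule continuous_on_compose2) (use int continuous_on_subset[OF cQ] in auto)
    then show ?thesis
      unfolding \<gamma>'_def l_def by (intro continuous_intros)
  qed
  have "\<gamma> t \<in> W" for t
    using p v e W by (auto simp: \<gamma>_def l_def perp_def intro!: subspace_add subspace_diff subspace_scale)
  then have \<gamma>M: "\<gamma> ` {-\<epsilon><..<\<epsilon>} \<subseteq> M"
    using M int q\<gamma> by auto
  have "\<gamma> C1_differentiable_on {-\<epsilon><..<\<epsilon>}"
    unfolding C1_differentiable_on_def using cont d\<gamma> int by blast
  then have "\<gamma>' 0 \<in> tangent_space M p"
    unfolding tangent_space_def using \<epsilon>(1) \<gamma>M \<gamma>0 d\<gamma>[of 0] Q0 pI by auto
  moreover have "\<gamma>' 0 = v + (H1 (Q 0) * (2 * (l 0 \<bullet> perp e v)) - v \<bullet> e) *\<^sub>R e"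
    by (simp add: \<gamma>'_def perp_def algebra_simps)
  ultimately show ?thesis by metis
qed

abbreviation axis :: fsvec where "axis \<equiv> unit_fsvec 0"

abbreviation flat :: "fsvec \<Rightarrow> fsvec" where "flat \<equiv> perp axis"

lemmas flat_inner_axis = perp_inner_unit[OF norm_unit_fsvec[of 0]]
lemmas flat_idem = perp_idem[OF norm_unit_fsvec[of 0]]
lemmas flat_inner_flat = perp_inner_perp[OF norm_unit_fsvec[of 0]]
lemmas flat_pythagoras = perp_pythagoras[OF norm_unit_fsvec[of 0]]
lemmas flat_nonneg = perp_nonneg[OF norm_unit_fsvec[of 0]]
lemmas norm_flat = norm_perp[OF norm_unit_fsvec[of 0]]
lemmas norm_flat_le = norm_perp_le[OF norm_unit_fsvec[of 0]]

section \<open>Hypersurfaces of revolution close to a sphere\<close>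

lemma deriv_imp_continuous_on:
  fixes G G1 :: "real \<Rightarrow> real"
  assumes "\<And>u. (G has_real_derivative G1 u) (at u)"
  shows "continuous_on A G"
  by (rule continuous_at_imp_continuous_on) (auto intro: DERIV_isCont[OF assms])

text \<open>
  The height is given through its square \<open>G\<close>, which is what the equation of the hypersurface provides;
  \<open>U\<close> selects the positive root.
\<close>

lemma C2_graph_at_sqrt:
  fixes G G1 G2 :: "real \<Rightarrow> real"
  assumes G: "\<And>u. (G has_real_derivative G1 u) (at u)" "\<And>u. (G1 has_real_derivative G2 u) (at u)"
    and G2: "continuous_on UNIV G2"
    and e: "norm e = 1" "e \<in> W" and U: "open U" "p \<in> U"
    and pos: "\<And>x. x \<in> U \<Longrightarrow> 0 < x \<bullet> e" "\<And>x. x \<in> U \<Longrightarrow> 0 < G (perp e x \<bullet> x)"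
    and M: "\<And>x. x \<in> W \<Longrightarrow> x \<in> U \<Longrightarrow> x \<in> M \<longleftrightarrow> (x \<bullet> e)\<^sup>2 = G (perp e x \<bullet> x)"
  shows "C2_graph_at W M p e"
proof -
  have c: "continuous_on UNIV G" "continuous_on UNIV G1"
    by (rule deriv_imp_continuous_on[OF G(1)] deriv_imp_continuous_on[OF G(2)])+
  define I where "I = {u. G u > 0}"
  define H1 where "H1 u = G1 u / (2 * sqrt (G u))" for u
  define H2 where "H2 u = G2 u / (2 * sqrt (G u)) - (G1 u)\<^sup>2 / (4 * (sqrt (G u) * sqrt (G u)) * sqrt (G u))" for u
  have I: "open I" unfolding I_def by (intro open_Collect_less c continuous_on_const)
  have d1: "((\<lambda>u. sqrt (G u)) has_real_derivative H1 u) (at u)" if "u \<in> I" for u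
  proof -
    have "0 < G u" using that unfolding I_def by (rule CollectD)
    show ?thesis
      by (rule DERIV_cong[OF DERIV_chain2[OF DERIV_real_sqrt[OF \<open>0 < G u\<close>] G(1)]])
        (simp add: H1_def field_simps)
  qed
  have d2: "(H1 has_real_derivative H2 u) (at u)" if "u \<in> I" for u
  proof -
    have pos: "0 < sqrt (G u)" using that by (simp add: I_def)
    then have nz: "2 * sqrt (G u) \<noteq> 0" by simp
    have "(H1 has_real_derivative
        (G2 u * (2 * sqrt (G u)) - G1 u * (2 * H1 u)) / ((2 * sqrt (G u)) * (2 * sqrt (G u)))) (at u)"
      unfolding H1_def
      by (rule DERIV_divide[OF G(2) DERIV_cmult[OF d1[OF that, unfolded H1_def]] nz])
    moreover have "(b * (2 * w) - a * (2 * (a / (2 * w)))) / ((2 * w) * (2 * w)) =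
        b / (2 * w) - a\<^sup>2 / (4 * (w * w) * w)" if "0 < w" for a b w :: real
      using that by (simp add: field_simps power2_eq_square)
    from this[OF pos] have "(G2 u * (2 * sqrt (G u)) - G1 u * (2 * H1 u)) / ((2 * sqrt (G u)) * (2 * sqrt (G u))) = H2 u"
      unfolding H2_def H1_def .
    ultimately show ?thesis by (rule DERIV_cong)
  qed
  have cH2: "continuous_on I H2"
    unfolding H2_def I_def
    by (intro continuous_intros continuous_on_subset[OF G2] continuous_on_subset[OF c(1)]
        continuous_on_subset[OF c(2)]) auto
  have graph: "x \<in> M \<longleftrightarrow> x \<bullet> e = sqrt (G (perp e x \<bullet> x))" if x: "x \<in> W" "x \<in> U" for x
  proof -
    have "(x \<bullet> e)\<^sup>2 = G (perp e x \<bullet> x) \<longleftrightarrow> x \<bullet> e = sqrt (G (perp e x \<bullet> x))"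
    proof
      assume "(x \<bullet> e)\<^sup>2 = G (perp e x \<bullet> x)"
      from real_sqrt_unique[OF this less_imp_le[OF pos(1)[OF x(2)]]]
      show "x \<bullet> e = sqrt (G (perp e x \<bullet> x))" by (rule sym)
    next
      assume "x \<bullet> e = sqrt (G (perp e x \<bullet> x))"
      then show "(x \<bullet> e)\<^sup>2 = G (perp e x \<bullet> x)"
        using real_sqrt_pow2[OF less_imp_le[OF pos(2)[OF x(2)]]] by (simp only:)
    qed
    then show ?thesis using M[OF x] by simp
  qed
  have "C2_graph_on W M e U I (\<lambda>u. sqrt (G u)) H1 H2"
    unfolding C2_graph_on_def
  proof (intro conjI ballI)
    fix u assume "u \<in> I"
    then show "((\<lambda>u. sqrt (G u)) has_real_derivative H1 u) (at u)" by (rule d1)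
  next
    fix u assume "u \<in> I"
    then show "(H1 has_real_derivative H2 u) (at u)" by (rule d2)
  next
    fix x assume "x \<in> U"
    then show "perp e x \<bullet> x \<in> I" unfolding I_def by (intro CollectI pos)
  next
    fix x assume "x \<in> W \<inter> U"
    then show "x \<in> M \<longleftrightarrow> x \<bullet> e = sqrt (G (perp e x \<bullet> x))" by (intro graph) auto
  qed (rule U I cH2)+
  then show ?thesis
    unfolding C2_graph_at_def using e U(2) by blast
qed

text \<open>
  The hypersurface is \<open>x \<bullet> x = r\<^sup>2 + \<beta> (Y x)\<close> with \<open>Y x = norm (flat x)\<^sup>2\<close>. As \<open>norm (flat x)\<close> is the square root
  of the argument of \<open>\<beta>\<close>, the last four bounds say that the derivatives of \<open>\<lambda>x. \<beta> (Y x)\<close> of orders two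
  and three are of order \<open>\<kappa>\<close> and \<open>\<kappa> / r\<close>. The sphere is the case \<open>\<beta> = 0\<close>, \<open>\<kappa> = 0\<close>. The bound on \<open>s\<close> keeps
  the bump within distance \<open>r / 4\<close> of the axis, away from the equator.
\<close>

locale revolution =
  fixes d D :: nat and r s \<kappa> :: real and \<beta> \<beta>1 \<beta>2 \<beta>3 :: "real \<Rightarrow> real"
  assumes dims: "1 \<le> d" "d < D"
    and r: "0 < r" and s: "0 < s" "16 * s \<le> r\<^sup>2" and \<kappa>: "0 \<le> \<kappa>" "\<kappa> \<le> 1 / 100"
    and deriv_\<beta>: "\<And>u. (\<beta> has_real_derivative \<beta>1 u) (at u)"
    and deriv_\<beta>1: "\<And>u. (\<beta>1 has_real_derivative \<beta>2 u) (at u)"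
    and deriv_\<beta>2: "\<And>u. (\<beta>2 has_real_derivative \<beta>3 u) (at u)"
    and cont_\<beta>3: "continuous_on UNIV \<beta>3"
    and \<beta>_nonneg: "\<And>u. 0 \<le> \<beta> u"
    and \<beta>_zero: "\<And>u. s \<le> u \<Longrightarrow> \<beta> u = 0" and \<beta>1_zero: "\<And>u. s \<le> u \<Longrightarrow> \<beta>1 u = 0"
    and \<beta>1_le: "\<And>u. 0 \<le> u \<Longrightarrow> \<bar>\<beta>1 u\<bar> \<le> \<kappa>"
    and \<beta>2_le: "\<And>u. 0 \<le> u \<Longrightarrow> \<bar>\<beta>2 u\<bar> * u \<le> \<kappa>"
    and \<beta>2_sqrt_le: "\<And>u. 0 \<le> u \<Longrightarrow> \<bar>\<beta>2 u\<bar> * sqrt u \<le> \<kappa> / r"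
    and \<beta>3_le: "\<And>u. 0 \<le> u \<Longrightarrow> \<bar>\<beta>3 u\<bar> * (sqrt u) ^ 3 \<le> \<kappa> / r"
begin

abbreviation "W \<equiv> euclid (Suc d)"

definition Y :: "fsvec \<Rightarrow> real" where "Y x = flat x \<bullet> x"

definition M :: "fsvec set" where "M = {x \<in> W. x \<bullet> x = r\<^sup>2 + \<beta> (Y x)}"

text \<open>
  Half the gradient of \<open>\<lambda>x. x \<bullet> x - \<beta> (Y x)\<close>.
\<close>

definition nrm :: "fsvec \<Rightarrow> fsvec" where "nrm x = x - \<beta>1 (Y x) *\<^sub>R flat x"

lemma axis_W [simp]: "axis \<in> W"
  by simp

lemma W_sub: "W \<subseteq> euclid D"
  using dims by (intro euclid_mono) auto

lemma flat_W: "x \<in> W \<Longrightarrow> flat x \<in> W"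
  unfolding perp_def by (intro subspace_diff subspace_scale subspace_euclid axis_W)

lemma nrm_W: "x \<in> W \<Longrightarrow> nrm x \<in> W"
  unfolding nrm_def by (intro subspace_diff subspace_scale subspace_euclid flat_W)

lemma Y_nonneg: "0 \<le> Y x"
  by (simp add: Y_def flat_nonneg)

lemma Y_axis: "x \<bullet> x = Y x + (x \<bullet> axis)\<^sup>2"
  unfolding Y_def by (rule flat_pythagoras)

lemma norm_flat_Y: "norm (flat x) = sqrt (Y x)"
  by (simp add: Y_def norm_flat)

lemma continuous_on_Y: "continuous_on A Y"
  unfolding Y_def by (intro continuous_on_inner linear_continuous_on bounded_linear_perp continuous_on_id)

lemma continuous_on_\<beta>: "continuous_on A \<beta>"
  by (rule deriv_imp_continuous_on[OF deriv_\<beta>])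

lemma continuous_on_\<beta>1: "continuous_on A \<beta>1"
  by (rule deriv_imp_continuous_on[OF deriv_\<beta>1])

lemma continuous_on_\<beta>2: "continuous_on A \<beta>2"
  by (rule deriv_imp_continuous_on[OF deriv_\<beta>2])

lemma continuous_on_nrm: "continuous_on A nrm"
  unfolding nrm_def
  by (intro continuous_on_diff continuous_on_id continuous_on_scaleR linear_continuous_on bounded_linear_perp
      continuous_on_compose2[OF continuous_on_\<beta>1[of UNIV] continuous_on_Y]) auto

lemma closed_M: "closed M"
proof -
  have "M = W \<inter> {x. x \<bullet> x = r\<^sup>2 + \<beta> (Y x)}" by (auto simp: M_def)
  moreover have "closed {x. x \<bullet> x = r\<^sup>2 + \<beta> (Y x)}"
    by (intro closed_Collect_eq continuous_intros
        continuous_on_compose2[OF continuous_on_\<beta>[of UNIV] continuous_on_Y]) auto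
  ultimately show ?thesis using closed_euclid by auto
qed

lemma M_W: "M \<subseteq> W" by (auto simp: M_def)

lemma M_norm_ge: "x \<in> M \<Longrightarrow> r \<le> norm x"
  using \<beta>_nonneg[of "Y x"] r by (auto simp: M_def norm_eq_sqrt_inner intro: real_le_rsqrt)

lemma s_less_r2: "s < r\<^sup>2"
  using s by linarith

lemma M_axis_zero:
  assumes "x \<in> M" "x \<bullet> axis = 0"
  shows "Y x = r\<^sup>2" "norm x = r"
proof -
  have *: "Y x = r\<^sup>2 + \<beta> (Y x)" using assms Y_axis[of x] by (simp add: M_def)
  then have "s \<le> Y x" using \<beta>_nonneg[of "Y x"] s_less_r2 by linarith
  then show "Y x = r\<^sup>2" using * \<beta>_zero by simp
  then show "norm x = r" using Y_axis[of x] assms r by (simp add: norm_eq_sqrt_inner)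
qed

lemma M_Y_le: assumes "x \<in> M" shows "Y x \<le> r\<^sup>2"
proof (cases "s \<le> Y x")
  case True
  then have "Y x + (x \<bullet> axis)\<^sup>2 = r\<^sup>2" using assms Y_axis[of x] \<beta>_zero by (simp add: M_def)
  then show ?thesis using zero_le_power2[of "x \<bullet> axis"] by linarith
next
  case False
  then show ?thesis using s_less_r2 by simp
qed

lemma norm_nrm_ge:
  assumes "x \<in> M"
  shows "r * (1 - \<kappa>) \<le> norm (nrm x)"
proof -
  have "norm (\<beta>1 (Y x) *\<^sub>R flat x) \<le> \<kappa> * norm x"
    using \<beta>1_le[OF Y_nonneg, of x] norm_flat_le[of x] \<kappa> by (auto intro!: mult_mono)
  then have "norm x - \<kappa> * norm x \<le> norm (nrm x)"
    unfolding nrm_def using norm_triangle_ineq2[of x "\<beta>1 (Y x) *\<^sub>R flat x"] by linarith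
  moreover have "r * (1 - \<kappa>) \<le> norm x * (1 - \<kappa>)"
    using M_norm_ge[OF assms] \<kappa> by (intro mult_right_mono) auto
  ultimately show ?thesis by (simp add: algebra_simps)
qed

lemma nrm_pos: "x \<in> M \<Longrightarrow> 0 < norm (nrm x)"
  by (rule less_le_trans[OF mult_pos_pos norm_nrm_ge]) (use r \<kappa> in auto)

section \<open>Charts and tangent spaces\<close>

text \<open>
  Off the equator, \<open>M\<close> is a graph over the hyperplane orthogonal to the axis. On the equator the
  perturbation vanishes and \<open>M\<close> is locally the sphere, a graph in the direction of any of its points.
\<close>

lemma M_graph_at:
  assumes p: "p \<in> M"
  shows "\<exists>e. C2_graph_at W M p e \<and> nrm p \<bullet> e \<noteq> 0"
proof (cases "p \<bullet> axis = 0")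
  case False
  define e where "e = sgn (p \<bullet> axis) *\<^sub>R axis"
  have e: "norm e = 1" "e \<in> W"
    using False by (simp add: e_def sgn_if)
      (unfold e_def, intro subspace_scale subspace_euclid axis_W)
  have pe: "perp e = flat" using False by (auto simp: e_def sgn_if perp_uminus)
  define G where "G u = r\<^sup>2 + \<beta> u - u" for u
  have dG: "(G has_real_derivative (\<beta>1 u - 1)) (at u)"
    "((\<lambda>u. \<beta>1 u - 1) has_real_derivative \<beta>2 u) (at u)" for u
    unfolding G_def by (auto intro!: derivative_eq_intros deriv_\<beta> deriv_\<beta>1)
  let ?O = "{x. 0 < x \<bullet> e \<and> 0 < G (Y x)}"
  have cG: "continuous_on UNIV (\<lambda>x. G (Y x))"
    unfolding G_def by (intro continuous_intros continuous_on_Y continuous_on_compose2[OF continuous_on_\<beta>[of UNIV] continuous_on_Y]) auto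
  have op: "open ?O"
    by (intro open_Collect_conj open_Collect_less continuous_intros cG)
  have pe_pos: "0 < p \<bullet> e" using False by (auto simp: e_def sgn_if)
  have xe: "(x \<bullet> e)\<^sup>2 = (x \<bullet> axis)\<^sup>2" for x
    using False by (auto simp: e_def sgn_if)
  have MG: "x \<in> M \<longleftrightarrow> (x \<bullet> e)\<^sup>2 = G (Y x)" if "x \<in> W" for x
    using that Y_axis[of x] xe[of x] by (auto simp: M_def G_def)
  have pO: "p \<in> ?O"
  proof -
    have "(p \<bullet> e)\<^sup>2 = G (Y p)" using MG[of p] p M_W by blast
    moreover have "0 < (p \<bullet> e)\<^sup>2" using pe_pos by simp
    ultimately show ?thesis using pe_pos by simp
  qed
  have "C2_graph_at W M p e"
    by (rule C2_graph_at_sqrt[OF dG continuous_on_\<beta>2 e op pO])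
      (use MG in \<open>auto simp: pe Y_def[symmetric]\<close>)
  moreover have "nrm p \<bullet> e \<noteq> 0"
  proof -
    have "flat p \<bullet> e = 0" by (simp add: e_def flat_inner_axis)
    then show ?thesis using pe_pos by (simp add: nrm_def inner_diff_left)
  qed
  ultimately show ?thesis by blast
next
  case True
  note pY = M_axis_zero[OF p True]
  define e where "e = p /\<^sub>R r"
  have e: "norm e = 1" "e \<in> W"
    using pY r p M_W by (auto simp: e_def intro!: subspace_scale subspace_euclid)
  define G where "G u = r\<^sup>2 - u" for u
  have dG: "(G has_real_derivative (- 1)) (at u)" "((\<lambda>u. - 1) has_real_derivative 0) (at u)" for u :: real
    unfolding G_def by (auto intro!: derivative_eq_intros)
  let ?O = "{x. 0 < x \<bullet> e \<and> 0 < G (perp e x \<bullet> x) \<and> s < Y x}"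
  have op: "open ?O"
    unfolding G_def
    by (intro open_Collect_conj open_Collect_less continuous_intros continuous_on_Y linear_continuous_on bounded_linear_perp)
  have pp: "p \<bullet> p = r\<^sup>2" using pY(2) by (simp add: power2_norm_eq_inner[symmetric])
  have pe: "p \<bullet> e = r" using r by (simp add: e_def pp power2_eq_square)
  have "perp e p \<bullet> p = 0"
    using perp_pythagoras[OF e(1), of p] pp pe by simp
  then have pO: "p \<in> ?O" using pe r pY s_less_r2 by (simp add: G_def)
  have MG: "x \<in> M \<longleftrightarrow> (x \<bullet> e)\<^sup>2 = G (perp e x \<bullet> x)" if "x \<in> W" "x \<in> ?O" for x
    using that perp_pythagoras[OF e(1), of x] \<beta>_zero[of "Y x"] by (auto simp: M_def G_def)
  have "C2_graph_at W M p e"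
    by (rule C2_graph_at_sqrt[OF dG continuous_on_const e op pO])
      (use MG in auto)
  moreover have "nrm p = p" using pY \<beta>1_zero[of "r\<^sup>2"] s_less_r2 by (simp add: nrm_def)
  ultimately show ?thesis using pe r by auto
qed

lemma submanifold_M: "C2_submanifold (euclid D) d M"
  unfolding C2_submanifold_def
proof (intro conjI ballI)
  show "M \<subseteq> euclid D" using M_W W_sub by blast
  fix p assume p: "p \<in> M"
  obtain e where e: "C2_graph_at W M p e" using M_graph_at[OF p] by blast
  then have "dim {x \<in> W. x \<bullet> e = 0} = d"
    using dim_hyperplane_section[of e d] by (simp add: C2_graph_at_def)
  from C2_graph_at_chart[OF e subspace_euclid W_sub subspace_euclid p M_W this]
  show "\<exists>U V F \<phi> \<psi>. openin (top_of_set (euclid D)) U \<and> p \<in> U \<and> openin (top_of_set (euclid D)) V \<and>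
        subspace F \<and> F \<subseteq> euclid D \<and> dim F = d \<and>
        homeomorphism U V \<phi> \<psi> \<and> C2_on U \<phi> \<and> C2_on V \<psi> \<and> \<phi> ` (M \<inter> U) = F \<inter> V" .
qed

lemma has_vector_derivative_in_W:
  assumes "(\<gamma> has_vector_derivative v) (at t)" "open T" "t \<in> T" "\<And>u. u \<in> T \<Longrightarrow> \<gamma> u \<in> W"
  shows "v \<in> W"
  unfolding euclid_eq_inner
proof (intro CollectI allI impI)
  fix i assume i: "Suc d \<le> i"
  have "((\<lambda>t. \<gamma> t \<bullet> unit_fsvec i) has_vector_derivative v \<bullet> unit_fsvec i) (at t)"
    by (rule bounded_linear.has_vector_derivative[OF bounded_linear_inner_left assms(1)])
  moreover have "((\<lambda>t. \<gamma> t \<bullet> unit_fsvec i) has_vector_derivative 0) (at t)"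
    by (rule has_vector_derivative_transform_within_open[OF has_vector_derivative_const[of 0] assms(2,3)])
      (use assms(4) i in \<open>auto simp: euclid_eq_inner\<close>)
  ultimately show "v \<bullet> unit_fsvec i = 0" by (rule vector_derivative_unique_at)
qed

lemma deriv_Y:
  assumes "(\<gamma> has_vector_derivative v) (at t)"
  shows "((\<lambda>t. Y (\<gamma> t)) has_real_derivative 2 * (flat (\<gamma> t) \<bullet> v)) (at t)"
proof -
  have "((\<lambda>t. flat (\<gamma> t) \<bullet> \<gamma> t) has_vector_derivative flat (\<gamma> t) \<bullet> v + flat v \<bullet> \<gamma> t) (at t)"
    by (rule bounded_bilinear.has_vector_derivative[OF bounded_bilinear_inner
          bounded_linear.has_vector_derivative[OF bounded_linear_perp assms] assms])
  moreover have "flat v \<bullet> \<gamma> t = flat (\<gamma> t) \<bullet> v"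
    using perp_inner_commute[of axis v "\<gamma> t"] by (simp add: inner_commute)
  ultimately show ?thesis
    by (simp add: Y_def has_real_derivative_iff_has_vector_derivative)
qed

lemma nrm_orthogonal_velocity:
  assumes \<gamma>: "(\<gamma> has_vector_derivative v) (at t)" and T: "open T" "t \<in> T" "\<And>u. u \<in> T \<Longrightarrow> \<gamma> u \<in> M"
  shows "nrm (\<gamma> t) \<bullet> v = 0"
proof -
  let ?g = "\<lambda>t. \<gamma> t \<bullet> \<gamma> t - \<beta> (Y (\<gamma> t))"
  have 1: "((\<lambda>t. \<gamma> t \<bullet> \<gamma> t) has_real_derivative 2 * (\<gamma> t \<bullet> v)) (at t)"
    using bounded_bilinear.has_vector_derivative[OF bounded_bilinear_inner \<gamma> \<gamma>]
    by (simp add: has_real_derivative_iff_has_vector_derivative inner_commute)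
  have "(?g has_real_derivative 2 * (\<gamma> t \<bullet> v) - \<beta>1 (Y (\<gamma> t)) * (2 * (flat (\<gamma> t) \<bullet> v))) (at t)"
    by (intro DERIV_diff 1 DERIV_chain2[OF deriv_\<beta> deriv_Y[OF \<gamma>]])
  moreover have "(?g has_real_derivative 0) (at t)"
    by (rule has_field_derivative_transform_within_open[OF DERIV_const[of "r\<^sup>2"] T(1,2)])
      (use T(3) in \<open>auto simp: M_def\<close>)
  ultimately have "2 * (\<gamma> t \<bullet> v) - \<beta>1 (Y (\<gamma> t)) * (2 * (flat (\<gamma> t) \<bullet> v)) = 0"
    by (rule DERIV_unique)
  then show ?thesis by (simp add: nrm_def inner_diff_left)
qed

text \<open>
  One inclusion differentiates the equation along a curve. For the other, the curves lifted from a
  local graph reach every prescribed velocity up to a multiple of \<open>e\<close>, and that multiple vanishes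
  because \<open>e\<close> is not orthogonal to the normal.
\<close>

lemma tangent_space_M:
  assumes p: "p \<in> M"
  shows "tangent_space M p = {v \<in> W. nrm p \<bullet> v = 0}"
proof -
  have sub: "tangent_space M p \<subseteq> {v \<in> W. nrm p \<bullet> v = 0}"
  proof
    fix v assume "v \<in> tangent_space M p"
    then obtain \<gamma> \<epsilon> where *: "\<epsilon> > 0" "\<gamma> ` {-\<epsilon><..<\<epsilon>} \<subseteq> M" "\<gamma> 0 = p" "(\<gamma> has_vector_derivative v) (at 0)"
      by (auto simp: tangent_space_def)
    have \<gamma>M: "\<gamma> u \<in> M" if "u \<in> {-\<epsilon><..<\<epsilon>}" for u
      using *(2) that by blast
    have "v \<in> W" by (rule has_vector_derivative_in_W[OF *(4), of "{-\<epsilon><..<\<epsilon>}"]) (use *(1) \<gamma>M M_W in auto)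
    moreover have "nrm (\<gamma> 0) \<bullet> v = 0"
      by (rule nrm_orthogonal_velocity[OF *(4), of "{-\<epsilon><..<\<epsilon>}"]) (use *(1) \<gamma>M in auto)
    ultimately show "v \<in> {v \<in> W. nrm p \<bullet> v = 0}" using * by simp
  qed
  moreover have "v \<in> tangent_space M p" if v: "v \<in> W" "nrm p \<bullet> v = 0" for v
  proof -
    obtain e where e: "C2_graph_at W M p e" "nrm p \<bullet> e \<noteq> 0" using M_graph_at[OF p] by blast
    obtain c where c: "v + c *\<^sub>R e \<in> tangent_space M p"
      using C2_graph_at_tangent[OF e(1) subspace_euclid p M_W v(1)] by blast
    then have "nrm p \<bullet> (v + c *\<^sub>R e) = 0" using sub by auto
    then show ?thesis using v e c by (simp add: inner_right_distrib)
  qed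
  ultimately show ?thesis by blast
qed

end

section \<open>Lower bound on the reach\<close>

lemma nearest_point_orthogonal:
  fixes z p :: "'v::real_inner"
  assumes p: "norm (p - z) = infdist z A" and v: "v \<in> tangent_space A p"
  shows "(z - p) \<bullet> v = 0"
proof -
  obtain \<gamma> \<epsilon> where *: "\<epsilon> > 0" "\<gamma> ` {-\<epsilon><..<\<epsilon>} \<subseteq> A" "\<gamma> 0 = p" "(\<gamma> has_vector_derivative v) (at 0)"
    using v by (auto simp: tangent_space_def)
  have d: "((\<lambda>t. \<gamma> t - z) has_vector_derivative v) (at 0)"
    using has_vector_derivative_diff[OF *(4) has_vector_derivative_const[of z]] by simp
  have D: "((\<lambda>t. (\<gamma> t - z) \<bullet> (\<gamma> t - z)) has_real_derivative 2 * ((p - z) \<bullet> v)) (at 0)"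
    using bounded_bilinear.has_vector_derivative[OF bounded_bilinear_inner d d] *(3)
    by (simp add: has_real_derivative_iff_has_vector_derivative inner_commute)
  have "2 * ((p - z) \<bullet> v) = 0"
  proof (rule DERIV_local_min[OF D *(1)], intro allI impI)
    fix t assume "\<bar>0 - t\<bar> < \<epsilon>"
    then have "\<gamma> t \<in> A" using *(2) by (auto simp: abs_less_iff)
    then have "infdist z A \<le> norm (\<gamma> t - z)" by (metis infdist_le dist_norm norm_minus_commute)
    then have "norm (p - z) \<le> norm (\<gamma> t - z)" using p by simp
    then have "norm (p - z) ^ 2 \<le> norm (\<gamma> t - z) ^ 2" by (rule power_mono) simp
    then show "(\<gamma> 0 - z) \<bullet> (\<gamma> 0 - z) \<le> (\<gamma> t - z) \<bullet> (\<gamma> t - z)"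
      by (simp add: power2_norm_eq_inner *(3))
  qed
  then show ?thesis by (simp add: inner_diff_left)
qed

lemma infdist_compact_attained:
  assumes "compact A" "A \<noteq> {}"
  obtains p where "p \<in> A" "infdist z A = dist z p"
proof -
  have "continuous_on A (dist z)" by (intro continuous_intros)
  then obtain p where p: "p \<in> A" "\<And>y. y \<in> A \<Longrightarrow> dist z p \<le> dist z y"
    using continuous_attains_inf[OF assms] by blast
  have "infdist z A = dist z p"
    using p assms by (intro antisym infdist_le) (auto simp: infdist_def intro: cINF_greatest)
  with p(1) show thesis by (rule that)
qed

lemma norm_reflection:
  fixes n w :: "'v::real_inner"
  shows "norm (w - (2 * (n \<bullet> w) / (n \<bullet> n)) *\<^sub>R n) = norm w"
proof (cases "n = 0")
  case False
  then have n: "n \<bullet> n \<noteq> 0" by simp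
  let ?c = "2 * (n \<bullet> w) / (n \<bullet> n)"
  have "(w - ?c *\<^sub>R n) \<bullet> (w - ?c *\<^sub>R n) = w \<bullet> w - 2 * ?c * (n \<bullet> w) + ?c * ?c * (n \<bullet> n)"
    by (simp add: inner_diff_left inner_diff_right inner_commute)
  also have "?c * ?c * (n \<bullet> n) = 2 * ?c * (n \<bullet> w)" using n by (simp add: field_simps)
  finally show ?thesis by (simp add: norm_eq_sqrt_inner)
qed simp

context revolution
begin

text \<open>
  Federer's inequality. The equation of the hypersurface at \<open>p\<close> and \<open>q\<close> makes the normal part of \<open>q - p\<close>
  equal to the second-order remainders of \<open>\<lambda>x. x \<bullet> x\<close> and of \<open>\<lambda>x. \<beta> (Y x)\<close>. The second one is taken along
  the segment from \<open>p\<close> to \<open>q\<close>, which leaves the hypersurface; hence the bounds on the derivatives of \<open>\<beta>\<close>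
  are used at arbitrary points.
\<close>

lemma second_order_normal:
  assumes p: "p \<in> M" and q: "q \<in> M"
  shows "\<bar>nrm p \<bullet> (q - p)\<bar> \<le> (1 + 3 * \<kappa>) / 2 * (norm (q - p))\<^sup>2"
proof -
  define h where "h = q - p"
  define l where "l t = p + t *\<^sub>R h" for t :: real
  have dl: "(l has_vector_derivative h) (at t)" for t
    unfolding l_def by (auto intro!: derivative_eq_intros)
  define F where "F t = \<beta> (Y (l t))" for t
  define F1 where "F1 t = \<beta>1 (Y (l t)) * (2 * (flat (l t) \<bullet> h))" for t
  define F2 where "F2 t = \<beta>2 (Y (l t)) * (2 * (flat (l t) \<bullet> h)) * (2 * (flat (l t) \<bullet> h))
     + (2 * (flat h \<bullet> h)) * \<beta>1 (Y (l t))" for t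
  have 1: "(F has_real_derivative F1 t) (at t)" for t
    unfolding F_def F1_def by (rule DERIV_chain2[OF deriv_\<beta> deriv_Y[OF dl]])
  have dfl: "((\<lambda>t. 2 * (flat (l t) \<bullet> h)) has_real_derivative 2 * (flat h \<bullet> h)) (at t)" for t
    by (intro DERIV_cmult)
      (simp add: has_real_derivative_iff_has_vector_derivative
        bounded_linear.has_vector_derivative[OF bounded_linear_compose[OF bounded_linear_inner_left bounded_linear_perp] dl])
  have 2: "(F1 has_real_derivative F2 t) (at t)" for t
    unfolding F1_def F2_def
    by (rule DERIV_mult[OF DERIV_chain2[OF deriv_\<beta>1 deriv_Y[OF dl]] dfl])
  define df where "df m = (if m = 0 then F else if m = 1 then F1 else F2)" for m :: nat
  have "\<exists>t>0. t < 1 \<and> F 1 = (\<Sum>m<2. df m 0 / fact m * 1 ^ m) + df 2 t / fact 2 * 1 ^ 2"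
    by (rule Maclaurin) (auto simp: df_def less_2_cases_iff 1 2)
  then obtain t where t: "F 1 = F 0 + F1 0 + F2 t / 2"
    by (auto simp: df_def eval_nat_numeral)
  have F2: "\<bar>F2 t\<bar> \<le> 6 * \<kappa> * (norm h)\<^sup>2"
  proof -
    have "\<bar>flat (l t) \<bullet> h\<bar> \<le> sqrt (Y (l t)) * norm h"
      using Cauchy_Schwarz_ineq2[of "flat (l t)" h] by (simp add: norm_flat_Y)
    then have "(flat (l t) \<bullet> h)\<^sup>2 \<le> (sqrt (Y (l t)) * norm h)\<^sup>2"
      using Y_nonneg by (intro abs_le_square_iff[THEN iffD1]) (auto simp: abs_mult)
    also have "\<dots> = Y (l t) * (norm h)\<^sup>2" using Y_nonneg by (simp add: power_mult_distrib)
    finally have "\<bar>\<beta>2 (Y (l t))\<bar> * (flat (l t) \<bullet> h)\<^sup>2 \<le> \<bar>\<beta>2 (Y (l t))\<bar> * (Y (l t) * (norm h)\<^sup>2)"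
      by (intro mult_left_mono) auto
    also have "\<dots> = (\<bar>\<beta>2 (Y (l t))\<bar> * Y (l t)) * (norm h)\<^sup>2" by simp
    also have "\<dots> \<le> \<kappa> * (norm h)\<^sup>2" by (intro mult_right_mono \<beta>2_le Y_nonneg) auto
    finally have a: "\<bar>\<beta>2 (Y (l t)) * (2 * (flat (l t) \<bullet> h)) * (2 * (flat (l t) \<bullet> h))\<bar> \<le> 4 * (\<kappa> * (norm h)\<^sup>2)"
      by (simp add: abs_mult power2_eq_square)
    have "\<bar>flat h \<bullet> h\<bar> \<le> (norm h)\<^sup>2"
      using Cauchy_Schwarz_ineq2[of "flat h" h] mult_right_mono[OF norm_flat_le[of h] norm_ge_zero[of h]]
      by (simp add: power2_eq_square)
    then have "\<bar>flat h \<bullet> h\<bar> * \<bar>\<beta>1 (Y (l t))\<bar> \<le> (norm h)\<^sup>2 * \<kappa>"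
      using \<beta>1_le[OF Y_nonneg, of "l t"] by (intro mult_mono) auto
    then have b: "\<bar>(2 * (flat h \<bullet> h)) * \<beta>1 (Y (l t))\<bar> \<le> 2 * (\<kappa> * (norm h)\<^sup>2)"
      by (simp add: abs_mult mult.commute)
    show ?thesis unfolding F2_def using a b by linarith
  qed
  have "q \<bullet> q = p \<bullet> p + 2 * (p \<bullet> h) + h \<bullet> h"
    unfolding h_def by (simp add: inner_diff_left inner_diff_right inner_commute)
  moreover have "q \<bullet> q = r\<^sup>2 + F 1" "p \<bullet> p = r\<^sup>2 + F 0"
    using p q by (auto simp: F_def l_def h_def M_def)
  moreover have "nrm p \<bullet> h = p \<bullet> h - F1 0 / 2"
    by (simp add: nrm_def inner_diff_left F1_def l_def)
  ultimately have "nrm p \<bullet> h = (F2 t / 2 - h \<bullet> h) / 2" using t by argo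
  then have "nrm p \<bullet> h = F2 t / 4 - (norm h)\<^sup>2 / 2"
    by (simp add: power2_norm_eq_inner)
  moreover have "(1 + 3 * \<kappa>) / 2 * (norm h)\<^sup>2 = (norm h)\<^sup>2 / 2 + (6 * \<kappa> * (norm h)\<^sup>2) / 4"
    by (simp add: field_simps)
  moreover have "0 \<le> (norm h)\<^sup>2" by simp
  ultimately show ?thesis
    using F2 unfolding h_def[symmetric] by linarith
qed

lemma tangential_part:
  assumes "p \<in> M" "w \<in> W"
  shows "w - (nrm p \<bullet> w / (nrm p \<bullet> nrm p)) *\<^sub>R nrm p \<in> tangent_space M p"
proof -
  have "nrm p \<bullet> nrm p \<noteq> 0" using nrm_pos[OF assms(1)] by auto
  moreover have "p \<in> W" using assms M_W by blast
  ultimately show ?thesis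
    unfolding tangent_space_M[OF assms(1)] using assms
    by (auto intro!: subspace_diff subspace_scale subspace_euclid nrm_W simp: inner_diff_right)
qed

text \<open>
  If \<open>p\<close> and \<open>q\<close> are both nearest to \<open>z\<close>, then \<open>z - p\<close> is normal at \<open>p\<close>, and equality of the distances
  says that its inner product with \<open>q - p\<close> is half the squared distance of \<open>p\<close> and \<open>q\<close>. Only the normal
  part of \<open>q - p\<close> contributes, so Federer's inequality bounds \<open>norm (z - p)\<close> from below.
\<close>

lemma reach_M: "ennreal (r * (1 - \<kappa>) / (1 + 3 * \<kappa>)) \<le> reach (euclid D) M"
  unfolding reach_def
proof (rule INF_greatest)
  fix z assume "z \<in> medial_axis (euclid D) M"
  then obtain p q where pq: "p \<in> M" "q \<in> M" "p \<noteq> q" "norm (p - z) = infdist z M" "norm (q - z) = infdist z M"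
    by (auto simp: medial_axis_def)
  define h where "h = q - p"
  define \<rho> where "\<rho> = infdist z M"
  define n where "n = nrm p"
  have hW: "h \<in> W" using pq M_W by (auto simp: h_def intro!: subspace_diff subspace_euclid)
  have n: "r * (1 - \<kappa>) \<le> norm n" "0 < norm n" using norm_nrm_ge nrm_pos pq by (auto simp: n_def)
  have "(q - z) \<bullet> (q - z) = (p - z) \<bullet> (p - z)"
    using pq(4,5) by (metis power2_norm_eq_inner)
  then have 1: "h \<bullet> h = 2 * ((z - p) \<bullet> h)"
    unfolding h_def by (simp add: inner_diff_left inner_diff_right inner_commute)
  have "(z - p) \<bullet> (h - (n \<bullet> h / (n \<bullet> n)) *\<^sub>R n) = 0"
    unfolding n_def by (rule nearest_point_orthogonal[OF pq(4) tangential_part[OF pq(1) hW]])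
  then have "(z - p) \<bullet> h = (n \<bullet> h / (n \<bullet> n)) * ((z - p) \<bullet> n)"
    by (simp add: inner_diff_right)
  also have "\<dots> \<le> \<bar>n \<bullet> h / (n \<bullet> n)\<bar> * \<bar>(z - p) \<bullet> n\<bar>"
    by (metis abs_ge_self abs_mult)
  also have "\<dots> \<le> \<bar>n \<bullet> h / (n \<bullet> n)\<bar> * (\<rho> * norm n)"
    using Cauchy_Schwarz_ineq2[of "z - p" n] pq(4)
    by (intro mult_left_mono) (auto simp: \<rho>_def norm_minus_commute)
  also have "\<dots> = \<bar>n \<bullet> h\<bar> * \<rho> / norm n"
  proof -
    have "n \<bullet> n = norm n * norm n"
      using power2_norm_eq_inner[of n] by (simp only: power2_eq_square)
    then show ?thesis using n(2) by (simp add: abs_mult)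
  qed
  also have "\<dots> \<le> ((1 + 3 * \<kappa>) / 2 * (norm h)\<^sup>2) * \<rho> / norm n"
    using second_order_normal[OF pq(1,2)] n(2)
    by (intro divide_right_mono mult_right_mono) (auto simp: n_def h_def \<rho>_def infdist_nonneg)
  finally have "h \<bullet> h / 2 \<le> ((1 + 3 * \<kappa>) / 2 * (h \<bullet> h)) * \<rho> / norm n"
    using 1 by (simp add: power2_norm_eq_inner)
  then have "(h \<bullet> h) * norm n \<le> (h \<bullet> h) * ((1 + 3 * \<kappa>) * \<rho>)"
    using n(2) by (simp add: field_simps)
  then have "norm n \<le> (1 + 3 * \<kappa>) * \<rho>"
    using pq(3) by (simp add: h_def)
  then have "r * (1 - \<kappa>) \<le> (1 + 3 * \<kappa>) * \<rho>" using n by linarith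
  then show "ennreal (r * (1 - \<kappa>) / (1 + 3 * \<kappa>)) \<le> ennreal (infdist z M)"
    using \<kappa> by (intro ennreal_leI) (simp add: \<rho>_def field_simps)
qed

section \<open>The two halves of the hypersurface\<close>

definition disk :: "real \<Rightarrow> fsvec set" where
  "disk \<rho> = {y \<in> W. y \<bullet> axis = 0 \<and> norm y \<le> \<rho>}"

text \<open>
  The inverse of the projection \<open>flat\<close> on the half of the hypersurface on the side \<open>\<sigma> = 1\<close> or \<open>\<sigma> = -1\<close> of
  the equatorial hyperplane.
\<close>

definition cap :: "real \<Rightarrow> fsvec \<Rightarrow> fsvec" where
  "cap \<sigma> y = y + (\<sigma> * sqrt (r\<^sup>2 + \<beta> (y \<bullet> y) - y \<bullet> y)) *\<^sub>R axis"

lemma continuous_on_cap: "continuous_on A (cap \<sigma>)"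
  unfolding cap_def
  by (intro continuous_intros continuous_on_compose2[OF continuous_on_\<beta>[of UNIV]]) auto

lemma compact_disk: "compact (disk \<rho>)"
proof (rule compact_euclid[of _ "Suc d" \<rho>])
  have "disk \<rho> = W \<inter> {y. y \<bullet> axis = 0} \<inter> {y. norm y \<le> \<rho>}" by (auto simp: disk_def)
  then show "closed (disk \<rho>)"
    by (simp add: closed_Int closed_euclid closed_Collect_eq closed_Collect_le continuous_intros)
qed (auto simp: disk_def)

lemma convex_disk: "convex (disk \<rho>)"
proof -
  have "disk \<rho> = W \<inter> {y. y \<bullet> axis = 0} \<inter> cball 0 \<rho>" by (auto simp: disk_def)
  moreover have "convex {y. y \<bullet> axis = 0}"
    by (auto simp: convex_def inner_left_distrib)
  ultimately show ?thesis
    by (simp add: convex_Int subspace_imp_convex[OF subspace_euclid])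
qed

lemma disk_cap:
  assumes "y \<in> disk \<rho>"
  shows "flat (cap \<sigma> y) = y" "Y (cap \<sigma> y) = y \<bullet> y" "cap \<sigma> y \<in> W"
    "cap \<sigma> y \<bullet> axis = \<sigma> * sqrt (r\<^sup>2 + \<beta> (y \<bullet> y) - y \<bullet> y)"
proof -
  have y: "y \<bullet> axis = 0" "y \<in> W" using assms by (auto simp: disk_def)
  then have fy: "flat y = y" by (simp add: perp_def)
  show f: "flat (cap \<sigma> y) = y" by (simp add: cap_def perp_add_unit fy)
  show "Y (cap \<sigma> y) = y \<bullet> y" using y by (simp add: Y_def f) (simp add: cap_def inner_right_distrib)
  show "cap \<sigma> y \<in> W" using y unfolding cap_def by (intro subspace_add subspace_scale subspace_euclid axis_W)
  show "cap \<sigma> y \<bullet> axis = \<sigma> * sqrt (r\<^sup>2 + \<beta> (y \<bullet> y) - y \<bullet> y)"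
    using y by (simp add: cap_def inner_left_distrib inner_unit)
qed

lemma cap_in_M:
  assumes "y \<in> disk r" "\<bar>\<sigma>\<bar> = 1"
  shows "cap \<sigma> y \<in> M"
proof -
  have "y \<bullet> y \<le> r\<^sup>2" using assms r by (auto simp: disk_def power2_norm_eq_inner[symmetric] intro: power_mono)
  then have "0 \<le> r\<^sup>2 + \<beta> (y \<bullet> y) - y \<bullet> y" using \<beta>_nonneg[of "y \<bullet> y"] by linarith
  then have "(cap \<sigma> y \<bullet> axis)\<^sup>2 = r\<^sup>2 + \<beta> (y \<bullet> y) - y \<bullet> y"
    using assms(2) disk_cap(4)[OF assms(1), of \<sigma>] by (simp add: power_mult_distrib abs_square_eq_1[THEN iffD2])
  then show ?thesis
    using Y_axis[of "cap \<sigma> y"] disk_cap[OF assms(1), of \<sigma>] by (simp add: M_def)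
qed

lemma M_eq_cap:
  assumes "x \<in> M" "\<sigma> = 1 \<or> \<sigma> = -1" "0 \<le> \<sigma> * (x \<bullet> axis)"
  shows "x = cap \<sigma> (flat x)" "flat x \<in> disk r"
proof -
  have ff: "flat x \<bullet> flat x = Y x" by (simp add: Y_def flat_inner_flat)
  have "(\<sigma> * (x \<bullet> axis))\<^sup>2 = r\<^sup>2 + \<beta> (Y x) - Y x"
    using assms Y_axis[of x] by (auto simp: M_def)
  from real_sqrt_unique[OF this assms(3)]
  have "x \<bullet> axis = \<sigma> * sqrt (r\<^sup>2 + \<beta> (Y x) - Y x)" using assms(2) by auto
  then show "x = cap \<sigma> (flat x)"
    using perp_decomp[of x axis] by (simp add: cap_def ff)
  have "norm (flat x) \<le> r"
    using M_Y_le[OF assms(1)] r by (simp add: norm_flat_Y real_le_lsqrt)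
  then show "flat x \<in> disk r"
    using assms(1) M_W flat_W by (auto simp: disk_def flat_inner_axis)
qed

lemma M_caps: "M = cap 1 ` disk r \<union> cap (-1) ` disk r"
proof
  show "M \<subseteq> cap 1 ` disk r \<union> cap (-1) ` disk r"
  proof
    fix x assume x: "x \<in> M"
    show "x \<in> cap 1 ` disk r \<union> cap (-1) ` disk r"
    proof (cases "0 \<le> x \<bullet> axis")
      case True
      then show ?thesis using M_eq_cap[OF x, of 1] by auto
    next
      case False
      then show ?thesis using M_eq_cap[OF x, of "-1"] by auto
    qed
  qed
qed (auto intro: cap_in_M)

lemma compact_M: "compact M"
  unfolding M_caps by (intro compact_Un compact_continuous_image continuous_on_cap compact_disk)

definition equator_point :: fsvec where "equator_point = unit_fsvec 1"

lemma equator_point: "equator_point \<in> W" "equator_point \<bullet> axis = 0" "norm equator_point = 1"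
  using dims by (auto simp: equator_point_def coord_inner_unit unit_fsvec.rep_eq)

lemma equator_in_disk: "0 \<le> c \<Longrightarrow> c \<le> \<rho> \<Longrightarrow> c *\<^sub>R equator_point \<in> disk \<rho>"
  using equator_point by (auto simp: disk_def intro!: subspace_scale subspace_euclid)

text \<open>
  Each half is the continuous image of a ball, and the halves meet along the equator. The equator is
  nonempty since \<open>1 \<le> d\<close>.
\<close>

lemma connected_M: "connected M"
  unfolding M_caps
proof (rule connected_Un)
  show "connected (cap \<sigma> ` disk r)" for \<sigma>
    by (intro connected_continuous_image continuous_on_cap convex_connected convex_disk)
  then show "connected (cap (-1) ` disk r)" .
  let ?y = "r *\<^sub>R equator_point"
  have y: "?y \<in> disk r" using r by (intro equator_in_disk) auto
  have "?y \<bullet> ?y = r\<^sup>2" using equator_point(3) by (simp add: norm_eq_1 power2_eq_square)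
  then have "cap 1 ?y = cap (-1) ?y"
    using \<beta>_zero[of "r\<^sup>2"] s_less_r2 by (simp add: cap_def)
  then show "cap 1 ` disk r \<inter> cap (-1) ` disk r \<noteq> {}" using y by auto
qed

section \<open>Third derivatives of geodesics\<close>

lemma curve_deriv_has_vector_derivative:
  assumes "Ck_curve k \<gamma>" "j < k"
  shows "(curve_deriv j \<gamma> has_vector_derivative curve_deriv (Suc j) \<gamma> t) (at t)"
  using assms by (auto simp: Ck_curve_def curve_deriv_def vector_derivative_works)

text \<open>
  The acceleration is normal, hence a multiple of the normal \<open>n\<close>, and differentiating \<open>n \<bullet> v = 0\<close>
  determines the multiple: \<open>a = - (A / N) n\<close> with \<open>A = n' \<bullet> v\<close> and \<open>N = n \<bullet> n\<close>. The right-hand side is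
  differentiable because \<open>\<beta>\<close> has a continuous third derivative. In the derivative of \<open>a\<close>, the terms without \<open>A'\<close>
  form \<open>- (A / N)\<close> times the reflection of \<open>n'\<close> in the hyperplane orthogonal to \<open>n\<close>. A reflection is
  isometric, so their norm is close to the value \<open>1 / r\<^sup>2\<close> that it has on the sphere; the triangle
  inequality applied to them would lose a factor \<open>3\<close>, more than the factor \<open>2\<close> at hand.
\<close>

lemma geodesic_third_derivative:
  assumes geo: "unit_speed_geodesic M p v0 \<gamma>"
  shows "Ck_curve 3 \<gamma>" "norm (curve_deriv 3 \<gamma> t) \<le> 2 / r\<^sup>2"
proof -
  have C2: "Ck_curve 2 \<gamma>" and \<gamma>M: "\<And>t. \<gamma> t \<in> M" and v1: "\<And>t. norm (curve_deriv 1 \<gamma> t) = 1"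
    and orth: "\<And>t w. w \<in> tangent_space M (\<gamma> t) \<Longrightarrow> curve_deriv 2 \<gamma> t \<bullet> w = 0"
    using geo by (auto simp: unit_speed_geodesic_def)
  define v where "v = curve_deriv 1 \<gamma>"
  define a where "a = curve_deriv 2 \<gamma>"
  have dx: "(\<gamma> has_vector_derivative v t) (at t)" for t
    using curve_deriv_has_vector_derivative[OF C2, of 0 t] by (simp add: v_def curve_deriv_def)
  have dv: "(v has_vector_derivative a t) (at t)" for t
    using curve_deriv_has_vector_derivative[OF C2, of 1 t] by (simp add: v_def a_def numeral_2_eq_2)
  have nv: "norm (v t) = 1" "v t \<bullet> v t = 1" for t
    using v1[of t] by (simp_all add: v_def norm_eq_1)
  define y where "y t = Y (\<gamma> t)" for t
  define f where "f t = flat (\<gamma> t) \<bullet> v t" for t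
  define f' where "f' t = flat (v t) \<bullet> v t + flat (\<gamma> t) \<bullet> a t" for t
  define n where "n t = nrm (\<gamma> t)" for t
  define n' where "n' t = v t - (\<beta>1 (y t) *\<^sub>R flat (v t) + (\<beta>2 (y t) * (2 * f t)) *\<^sub>R flat (\<gamma> t))" for t
  define A where "A t = 1 - (\<beta>1 (y t) * Y (v t) + 2 * (\<beta>2 (y t) * (f t * f t)))" for t
  define A' where "A' t = - ((\<beta>2 (y t) * (2 * f t)) * Y (v t) + (2 * (flat (v t) \<bullet> a t)) * \<beta>1 (y t)
      + 2 * ((\<beta>3 (y t) * (2 * f t)) * (f t * f t) + (f' t * f t + f' t * f t) * \<beta>2 (y t)))" for t
  define N where "N t = n t \<bullet> n t" for t
  have dflat: "((\<lambda>t. flat (g t)) has_vector_derivative flat g') (at t)"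
    if "(g has_vector_derivative g') (at t)" for g g' t
    by (rule bounded_linear.has_vector_derivative[OF bounded_linear_perp that])
  have dy: "(y has_real_derivative 2 * f t) (at t)" for t
    unfolding y_def f_def by (rule deriv_Y[OF dx])
  have df: "(f has_real_derivative f' t) (at t)" for t
    unfolding f_def f'_def has_real_derivative_iff_has_vector_derivative
    using bounded_bilinear.has_vector_derivative[OF bounded_bilinear_inner dflat[OF dx[of t]] dv[of t]]
    by (simp add: add.commute)
  have db: "((\<lambda>t. \<beta>1 (y t)) has_real_derivative \<beta>2 (y t) * (2 * f t)) (at t)"
    "((\<lambda>t. \<beta>2 (y t)) has_real_derivative \<beta>3 (y t) * (2 * f t)) (at t)" for t
    by (rule DERIV_chain2[OF deriv_\<beta>1 dy] DERIV_chain2[OF deriv_\<beta>2 dy])+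
  have dn: "(n has_vector_derivative n' t) (at t)" for t
    unfolding n_def n'_def nrm_def y_def[symmetric]
    using has_vector_derivative_diff[OF dx[of t] has_vector_derivative_scaleR[OF db(1)[of t] dflat[OF dx[of t]]]]
    by simp
  have dA: "(A has_real_derivative A' t) (at t)" for t
  proof -
    have 1: "((\<lambda>t. \<beta>1 (y t) * Y (v t)) has_real_derivative
        (\<beta>2 (y t) * (2 * f t)) * Y (v t) + (2 * (flat (v t) \<bullet> a t)) * \<beta>1 (y t)) (at t)"
      by (rule DERIV_mult[OF db(1) deriv_Y[OF dv]])
    have 2: "((\<lambda>t. \<beta>2 (y t) * (f t * f t)) has_real_derivative
        (\<beta>3 (y t) * (2 * f t)) * (f t * f t) + (f' t * f t + f' t * f t) * \<beta>2 (y t)) (at t)"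
      by (rule DERIV_mult[OF db(2) DERIV_mult[OF df df]])
    show ?thesis
      unfolding A_def A'_def
      using DERIV_diff[OF DERIV_const DERIV_add[OF 1 DERIV_cmult[OF 2, of 2]], of 1] by simp
  qed
  have dN: "(N has_real_derivative 2 * (n t \<bullet> n' t)) (at t)" for t
    unfolding N_def has_real_derivative_iff_has_vector_derivative
    using bounded_bilinear.has_vector_derivative[OF bounded_bilinear_inner dn[of t] dn[of t]]
    by (simp add: inner_commute)
  have nlow: "r * (1 - \<kappa>) \<le> norm (n t)" "0 < norm (n t)" "0 < N t" for t
    using norm_nrm_ge[OF \<gamma>M[of t]] nrm_pos[OF \<gamma>M[of t]] by (auto simp: n_def N_def)
  have nvz: "n t \<bullet> v t = 0" for t
    unfolding n_def by (rule nrm_orthogonal_velocity[OF dx, of UNIV]) (auto simp: \<gamma>M)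
  \<comment> \<open>differentiating \<open>n \<bullet> v = 0\<close>\<close>
  have na: "n t \<bullet> a t = - A t" for t
  proof -
    have "((\<lambda>t. n t \<bullet> v t) has_vector_derivative n t \<bullet> a t + n' t \<bullet> v t) (at t)"
      by (rule bounded_bilinear.has_vector_derivative[OF bounded_bilinear_inner dn dv])
    moreover have "((\<lambda>t. n t \<bullet> v t) has_vector_derivative 0) (at t)" by (simp add: nvz)
    ultimately have "n t \<bullet> a t + n' t \<bullet> v t = 0" by (rule vector_derivative_unique_at)
    moreover have "n' t \<bullet> v t = A t"
      unfolding n'_def A_def by (simp add: inner_diff_left inner_left_distrib nv Y_def f_def)
    ultimately show ?thesis by linarith
  qed
  have vW: "v t \<in> W" for t
    by (rule has_vector_derivative_in_W[OF dx, of UNIV]) (use \<gamma>M M_W in auto)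
  have aW: "a t \<in> W" for t
    by (rule has_vector_derivative_in_W[OF dv, of UNIV]) (use vW in auto)
  have a_eq: "a t = - (A t / N t) *\<^sub>R n t" for t
  proof -
    define w where "w = a t - (n t \<bullet> a t / N t) *\<^sub>R n t"
    have wT: "w \<in> tangent_space M (\<gamma> t)"
      unfolding w_def n_def N_def by (rule tangential_part[OF \<gamma>M aW])
    have "a t \<bullet> w = 0" unfolding a_def by (rule orth[OF wT])
    moreover have "n t \<bullet> w = 0" using wT unfolding tangent_space_M[OF \<gamma>M] n_def by simp
    moreover have "w \<bullet> w = a t \<bullet> w - (n t \<bullet> a t / N t) * (n t \<bullet> w)"
      by (subst (1) w_def) (simp add: inner_diff_left)
    ultimately have "w \<bullet> w = 0" by simp
    then show ?thesis by (simp add: w_def na eq_neg_iff_add_eq_0)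
  qed
  \<comment> \<open>the third derivative, grouped into the part with \<open>A'\<close> and the reflected \<open>n'\<close>\<close>
  define j where "j t = - ((A' t / N t) *\<^sub>R n t) - (A t / N t) *\<^sub>R (n' t - (2 * (n t \<bullet> n' t) / N t) *\<^sub>R n t)" for t
  have da: "(a has_vector_derivative j t) (at t)" for t
  proof -
    have nz: "N t \<noteq> 0" using nlow(3)[of t] by simp
    have q: "((\<lambda>t. A t / N t) has_real_derivative
        (A' t * N t - A t * (2 * (n t \<bullet> n' t))) / (N t * N t)) (at t)"
      by (rule DERIV_divide[OF dA dN nz])
    have "((\<lambda>t. - ((A t / N t) *\<^sub>R n t)) has_vector_derivative
        - ((A t / N t) *\<^sub>R n' t + ((A' t * N t - A t * (2 * (n t \<bullet> n' t))) / (N t * N t)) *\<^sub>R n t)) (at t)"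
      by (intro has_vector_derivative_minus has_vector_derivative_scaleR q dn)
    moreover have "(A' t * N t - A t * (2 * (n t \<bullet> n' t))) / (N t * N t) =
        A' t / N t - (A t / N t) * (2 * (n t \<bullet> n' t) / N t)"
      using nz by (simp add: field_simps)
    ultimately have "((\<lambda>t. - ((A t / N t) *\<^sub>R n t)) has_vector_derivative j t) (at t)"
      by (simp add: j_def algebra_simps)
    moreover have "a = (\<lambda>t. - ((A t / N t) *\<^sub>R n t))" using a_eq by (auto simp: fun_eq_iff)
    ultimately show ?thesis by simp
  qed
  have cj: "continuous_on UNIV j"
  proof -
    have cv: "continuous_on UNIV v" "continuous_on UNIV \<gamma>" "continuous_on UNIV a"
      using has_vector_derivative_continuous[OF dv] has_vector_derivative_continuous[OF dx]
        has_vector_derivative_continuous[OF da]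
      by (auto intro!: continuous_at_imp_continuous_on)
    have cfl: "continuous_on UNIV (\<lambda>t. flat (g t))" if "continuous_on UNIV g" for g :: "real \<Rightarrow> fsvec"
      by (rule bounded_linear.continuous_on[OF bounded_linear_perp that])
    have cf: "continuous_on UNIV f" "continuous_on UNIV f'" "continuous_on UNIV y"
        "continuous_on UNIV (\<lambda>t. Y (v t))"
      unfolding f_def f'_def y_def Y_def by (intro continuous_intros cfl cv)+
    have cb: "continuous_on UNIV (\<lambda>t. \<beta>1 (y t))" "continuous_on UNIV (\<lambda>t. \<beta>2 (y t))" "continuous_on UNIV (\<lambda>t. \<beta>3 (y t))"
      by (rule continuous_on_compose2[OF continuous_on_\<beta>1[of UNIV] cf(3)]
          continuous_on_compose2[OF continuous_on_\<beta>2[of UNIV] cf(3)]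
          continuous_on_compose2[OF cont_\<beta>3 cf(3)], simp)+
    have cn: "continuous_on UNIV n" "continuous_on UNIV n'"
      unfolding n_def n'_def nrm_def y_def[symmetric] by (intro continuous_intros cfl cv cb cf)+
    have cA: "continuous_on UNIV A" "continuous_on UNIV A'" "continuous_on UNIV N"
      unfolding A_def A'_def N_def by (intro continuous_intros cfl cv cb cf cn)+
    have "N t \<noteq> 0" for t using nlow(3)[of t] by simp
    then show ?thesis
      unfolding j_def by (intro continuous_intros cA cn) auto
  qed
  have d3: "curve_deriv 3 \<gamma> = j"
    using vector_derivative_at[OF da] by (auto simp: curve_deriv_def a_def fun_eq_iff eval_nat_numeral)
  show "Ck_curve 3 \<gamma>"
    unfolding Ck_curve_def
  proof (intro conjI allI impI)
    fix i t assume "i < (3::nat)"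
    then have "i = 0 \<or> i = 1 \<or> i = 2" by auto
    moreover have "curve_deriv 0 \<gamma> = \<gamma>" by (simp add: curve_deriv_def)
    ultimately show "curve_deriv i \<gamma> differentiable at t"
      using differentiableI_vector[OF dx] differentiableI_vector[OF dv] differentiableI_vector[OF da]
      unfolding v_def a_def by auto
  qed (simp add: d3 cj)
  show "norm (curve_deriv 3 \<gamma> t) \<le> 2 / r\<^sup>2"
  proof -
    define \<alpha> where "\<alpha> = norm (a t)"
    define m where "m = norm (n t)"
    define q where "q = sqrt (y t)"
    have y0: "0 \<le> y t" by (simp add: y_def Y_nonneg)
    have q0: "0 \<le> q" "q * q = y t" using y0 by (simp_all add: q_def)
    have mlow: "r * (99 / 100) \<le> m"
      unfolding m_def by (rule order_trans[OF mult_left_mono nlow(1)]) (use \<kappa> r in auto)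
    have m0: "0 < m" using mlow r by linarith
    have NN: "N t = m * m"
      using power2_norm_eq_inner[of "n t"] by (simp only: N_def m_def power2_eq_square)
    have fl: "norm (flat (\<gamma> t)) = q" by (simp add: norm_flat_Y q_def y_def)
    have fv: "norm (flat (v t)) \<le> 1" using norm_flat_le[of "v t"] nv by simp
    have fb: "\<bar>f t\<bar> \<le> q"
      using Cauchy_Schwarz_ineq2[of "flat (\<gamma> t)" "v t"] by (simp add: f_def fl nv)
    have Yv: "0 \<le> Y (v t)" "Y (v t) \<le> 1"
      using Y_nonneg[of "v t"] Y_axis[of "v t"] nv(2)[of t] zero_le_power2[of "v t \<bullet> axis"] by linarith+
    have va: "\<bar>flat (v t) \<bullet> a t\<bar> \<le> \<alpha>"
      using Cauchy_Schwarz_ineq2[of "flat (v t)" "a t"] mult_right_mono[OF fv norm_ge_zero[of "a t"]]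
      by (simp add: \<alpha>_def)
    have fa: "\<bar>flat (\<gamma> t) \<bullet> a t\<bar> \<le> q * \<alpha>"
      using Cauchy_Schwarz_ineq2[of "flat (\<gamma> t)" "a t"] by (simp add: \<alpha>_def fl)
    have f'b: "\<bar>f' t\<bar> \<le> 1 + q * \<alpha>" using fa Yv unfolding f'_def Y_def by linarith
    have b1: "\<bar>\<beta>1 (y t)\<bar> \<le> \<kappa>" by (rule \<beta>1_le[OF y0])
    have b2: "\<bar>\<beta>2 (y t)\<bar> * (q * q) \<le> \<kappa>" unfolding q0 by (rule \<beta>2_le[OF y0])
    have b2': "\<bar>\<beta>2 (y t)\<bar> * q \<le> \<kappa> / r" unfolding q_def by (rule \<beta>2_sqrt_le[OF y0])
    have b3: "\<bar>\<beta>3 (y t)\<bar> * (q * (q * q)) \<le> \<kappa> / r"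
      using \<beta>3_le[OF y0] by (simp only: q_def power3_eq_cube mult.assoc)
    have ff: "\<bar>f t * f t\<bar> \<le> q * q" unfolding abs_mult by (intro mult_mono fb) (use q0 in auto)
    have fff: "\<bar>f t\<bar> * \<bar>f t * f t\<bar> \<le> q * (q * q)" by (intro mult_mono fb ff) (use q0 in auto)
    have Y1: "\<bar>\<beta>1 (y t) * Y (v t)\<bar> \<le> \<kappa>"
      unfolding abs_mult using mult_mono[OF b1, of "\<bar>Y (v t)\<bar>" 1] Yv \<kappa> by simp
    have Y2: "\<bar>\<beta>2 (y t) * (f t * f t)\<bar> \<le> \<kappa>"
      unfolding abs_mult[of "\<beta>2 (y t)"] by (rule order_trans[OF mult_left_mono[OF ff] b2]) simp
    have A1: "\<bar>A t\<bar> \<le> 1 + 3 * \<kappa>" using Y1 Y2 unfolding A_def by linarith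
    have n'1: "norm (n' t) \<le> 1 + 3 * \<kappa>"
    proof -
      let ?a = "\<beta>1 (y t) *\<^sub>R flat (v t)" and ?b = "(\<beta>2 (y t) * (2 * f t)) *\<^sub>R flat (\<gamma> t)"
      have "norm (?a) \<le> \<kappa> * 1"
        using b1 fv \<kappa> by (simp only: norm_scaleR) (intro mult_mono, auto)
      moreover have "norm (?b) \<le> 2 * \<kappa>"
      proof -
        have "\<bar>\<beta>2 (y t)\<bar> * (\<bar>f t\<bar> * q) \<le> \<bar>\<beta>2 (y t)\<bar> * (q * q)"
          using fb q0 by (intro mult_left_mono mult_right_mono) auto
        then show ?thesis using b2 by (simp add: abs_mult fl)
      qed
      ultimately show ?thesis
        unfolding n'_def
        using norm_triangle_ineq4[of "v t" "?a + ?b"]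
          norm_triangle_ineq[of "?a" "?b"] nv(1)[of t]
        by linarith
    qed
    have A2: "\<bar>A t\<bar> \<le> 103 / 100" "norm (n' t) \<le> 103 / 100" using A1 n'1 \<kappa> by linarith+
    have \<alpha>_eq: "\<alpha> = \<bar>A t\<bar> / m"
      using m0 by (simp add: \<alpha>_def a_eq NN m_def[symmetric] abs_mult)
    have \<alpha>1: "\<alpha> \<le> (21 / 20) / r"
    proof -
      have "\<alpha> \<le> (103 / 100) / (r * (99 / 100))"
        unfolding \<alpha>_eq using A2 mlow r by (intro frac_le) auto
      also have "\<dots> \<le> (21 / 20) / r" using r by (simp add: field_simps)
      finally show ?thesis .
    qed
    have \<alpha>0: "0 \<le> \<alpha>" by (simp add: \<alpha>_def)
    have A'1: "\<bar>A' t\<bar> \<le> 10 * (\<kappa> / r) + 6 * (\<kappa> * \<alpha>)"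
    proof -
      have 1: "\<bar>(\<beta>2 (y t) * (2 * f t)) * Y (v t)\<bar> \<le> 2 * (\<kappa> / r)"
      proof -
        have "(\<bar>\<beta>2 (y t)\<bar> * \<bar>f t\<bar>) * \<bar>Y (v t)\<bar> \<le> (\<bar>\<beta>2 (y t)\<bar> * q) * 1"
          using fb Yv q0 by (intro mult_mono mult_left_mono) auto
        then show ?thesis using b2' by (simp add: abs_mult)
      qed
      have 2: "\<bar>(2 * (flat (v t) \<bullet> a t)) * \<beta>1 (y t)\<bar> \<le> 2 * (\<kappa> * \<alpha>)"
        using mult_mono[OF va b1 \<alpha>0] by (simp add: abs_mult mult.commute)
      have 3: "\<bar>(\<beta>3 (y t) * (2 * f t)) * (f t * f t)\<bar> \<le> 2 * (\<kappa> / r)"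
        using order_trans[OF mult_left_mono[OF fff, of "\<bar>\<beta>3 (y t)\<bar>"] b3] by (simp add: abs_mult)
      have 4: "\<bar>f' t * f t * \<beta>2 (y t)\<bar> \<le> \<kappa> / r + \<kappa> * \<alpha>"
      proof -
        have "\<bar>f' t\<bar> * (\<bar>f t\<bar> * \<bar>\<beta>2 (y t)\<bar>) \<le> (1 + q * \<alpha>) * (q * \<bar>\<beta>2 (y t)\<bar>)"
          using f'b fb q0 by (intro mult_mono mult_right_mono) auto
        also have "\<dots> = \<bar>\<beta>2 (y t)\<bar> * q + (\<bar>\<beta>2 (y t)\<bar> * (q * q)) * \<alpha>" by (simp add: algebra_simps)
        also have "\<dots> \<le> \<kappa> / r + \<kappa> * \<alpha>" by (intro add_mono b2' mult_right_mono b2 \<alpha>0)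
        finally show ?thesis by (simp add: abs_mult mult.assoc)
      qed
      have 5: "(f' t * f t + f' t * f t) * \<beta>2 (y t) = 2 * (f' t * f t * \<beta>2 (y t))" by (simp add: algebra_simps)
      have "\<bar>- (b1 + b2 + 2 * (b3 + 2 * b4))\<bar> \<le> 10 * k + 6 * l"
        if "\<bar>b1\<bar> \<le> 2 * k" "\<bar>b2\<bar> \<le> 2 * l" "\<bar>b3\<bar> \<le> 2 * k" "\<bar>b4\<bar> \<le> k + l" for b1 b2 b3 b4 k l :: real
        using that unfolding abs_le_iff by (elim conjE, intro conjI) argo+
      from this[OF 1 2 3 4] show ?thesis unfolding A'_def 5 .
    qed
    have A'2: "\<bar>A' t\<bar> \<le> (17 / 100) / r"
    proof -
      have "\<kappa> / r \<le> (1 / 100) / r" using \<kappa> r by (intro divide_right_mono) auto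
      moreover have "\<kappa> * \<alpha> \<le> (1 / 100) * ((21 / 20) / r)" using \<kappa> \<alpha>1 \<alpha>0 by (intro mult_mono) auto
      moreover have "(1 / 100) / r = (1 / 100) * (1 / r)" "(21 / 20) / r = (21 / 20) * (1 / r)"
        "(17 / 100) / r = (17 / 100) * (1 / r)" "0 < 1 / r" using r by auto
      ultimately show ?thesis using A'1 by linarith
    qed
    have "norm (j t) \<le> \<bar>A' t\<bar> / m + \<bar>A t\<bar> * norm (n' t) / (m * m)"
    proof -
      have "norm (j t) \<le> norm ((A' t / N t) *\<^sub>R n t) + norm ((A t / N t) *\<^sub>R (n' t - (2 * (n t \<bullet> n' t) / N t) *\<^sub>R n t))"
        unfolding j_def by (rule order_trans[OF norm_triangle_ineq4]) (simp only: norm_minus_cancel order_refl)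
      also have "norm ((A t / N t) *\<^sub>R (n' t - (2 * (n t \<bullet> n' t) / N t) *\<^sub>R n t)) = \<bar>A t\<bar> * norm (n' t) / (m * m)"
        using norm_reflection[of "n' t" "n t"] by (simp add: N_def[symmetric]) (simp add: NN abs_mult)
      also have "norm ((A' t / N t) *\<^sub>R n t) = \<bar>A' t\<bar> / m"
        using m0 by (simp add: NN m_def[symmetric] abs_mult)
      finally show ?thesis .
    qed
    also have "\<dots> \<le> ((17 / 100) / r) / (r * (99 / 100)) + (103 / 100) * (103 / 100) / ((r * (99 / 100)) * (r * (99 / 100)))"
      using A'2 A2 mlow m0 r by (intro add_mono frac_le mult_mono) auto
    also have "\<dots> \<le> 2 / r\<^sup>2" using r by (simp add: field_simps power2_eq_square)
    finally show ?thesis by (simp add: d3)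
  qed
qed

lemma manifold_class_M:
  assumes "t \<le> r * (1 - \<kappa>) / (1 + 3 * \<kappa>)" "2 / r\<^sup>2 \<le> L"
  shows "M \<in> manifold_class (euclid D) d t L"
  unfolding manifold_class_def
proof (intro CollectI conjI ballI allI impI)
  show "ennreal t \<le> reach (euclid D) M"
    by (rule order_trans[OF ennreal_leI[OF assms(1)] reach_M])
next
  fix p v \<gamma> assume g: "norm v = 1 \<and> unit_speed_geodesic M p v \<gamma>"
  show "Ck_curve 3 \<gamma>" using g geodesic_third_derivative(1) by blast
  show "norm (curve_deriv 3 \<gamma> 0) \<le> L"
    by (rule order_trans[OF geodesic_third_derivative(2) assms(2)]) (use g in blast)
qed (rule submanifold_M compact_M connected_M)+

section \<open>Upper bound on the reach\<close>

text \<open>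
  A point of the axis that is farther from the poles of \<open>M\<close> than from some other point of \<open>M\<close> has
  its nearest points off the axis; those come in pairs related by the reflection in the axis. The
  other point is taken on the rim \<open>Y x = s\<close> of the bump, where \<open>\<beta>\<close> vanishes and the position is explicit.
\<close>

lemma reach_M_le:
  assumes \<zeta>: "0 < \<zeta>" and gap: "2 * \<zeta> * (sqrt (r\<^sup>2 + \<beta> 0) - sqrt (r\<^sup>2 - s)) < \<beta> 0"
    and \<zeta>R: "\<zeta> \<le> sqrt (r\<^sup>2 + \<beta> 0)"
  shows "reach (euclid D) M \<le> ennreal (sqrt (r\<^sup>2 + \<beta> 0) - \<zeta>)"
proof -
  define R where "R = sqrt (r\<^sup>2 + \<beta> 0)"
  define z where "z = \<zeta> *\<^sub>R axis"
  have R2: "R\<^sup>2 = r\<^sup>2 + \<beta> 0" "0 \<le> R" using \<beta>_nonneg[of 0] by (simp_all add: R_def)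
  have dz: "(norm (x - z))\<^sup>2 = Y x + (x \<bullet> axis - \<zeta>)\<^sup>2" for x
  proof -
    have "axis \<bullet> axis = 1" by (simp add: inner_unit)
    then have "(x - z) \<bullet> (x - z) = x \<bullet> x - 2 * \<zeta> * (x \<bullet> axis) + \<zeta>\<^sup>2"
      unfolding z_def by (simp add: inner_diff_left inner_diff_right inner_commute[of axis x] power2_eq_square right_diff_distrib)
    then show ?thesis
      unfolding power2_norm_eq_inner power2_diff using Y_axis[of x]
      by (simp only: mult.assoc mult.commute[of \<zeta>])
  qed
  have d0: "0 \<in> disk r" using equator_in_disk[of 0 r] r by simp
  have M0: "M \<noteq> {}" using cap_in_M[OF d0, of 1] by auto
  define m where "m = cap 1 (sqrt s *\<^sub>R equator_point)"
  have sd: "sqrt s *\<^sub>R equator_point \<in> disk r"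
    using s r s_less_r2 by (intro equator_in_disk) (auto simp: real_le_lsqrt)
  have mM: "m \<in> M" unfolding m_def by (rule cap_in_M[OF sd]) simp
  have ss: "(sqrt s *\<^sub>R equator_point) \<bullet> (sqrt s *\<^sub>R equator_point) = s"
    using equator_point(3) s by (simp add: norm_eq_1)
  have "(norm (m - z))\<^sup>2 < (R - \<zeta>)\<^sup>2"
  proof -
    define a where "a = sqrt (r\<^sup>2 - s)"
    have m: "Y m = s" "m \<bullet> axis = a"
      using disk_cap(2,4)[OF sd, of 1] ss \<beta>_zero[of s] by (simp_all add: m_def a_def)
    have "a\<^sup>2 = r\<^sup>2 - s" unfolding a_def using s_less_r2 by (intro real_sqrt_pow2) simp
    moreover have "(w - \<zeta>)\<^sup>2 = w\<^sup>2 - 2 * \<zeta> * w + \<zeta>\<^sup>2" for w :: real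
      by (simp add: power2_diff)
    moreover have "2 * \<zeta> * R - 2 * \<zeta> * a < \<beta> 0"
      using gap by (simp only: R_def a_def right_diff_distrib)
    ultimately show ?thesis
      using R2(1) unfolding dz m by simp
  qed
  then have mz: "norm (m - z) < R - \<zeta>"
    using \<zeta>R by (auto intro: power2_less_imp_less simp: R_def)
  obtain p where p: "p \<in> M" "infdist z M = dist z p"
    using infdist_compact_attained[OF compact_M M0] .
  have pz: "norm (p - z) = infdist z M" by (simp add: p dist_norm norm_minus_commute)
  have "infdist z M \<le> norm (m - z)" using infdist_le[OF mM, of z] by (simp add: dist_norm norm_minus_commute)
  then have lt: "infdist z M < R - \<zeta>" using mz by linarith
  \<comment> \<open>the points of the hypersurface on the axis are the two poles, at distance at least \<open>R - \<zeta>\<close>\<close>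
  have fp: "flat p \<noteq> 0"
  proof
    assume f0: "flat p = 0"
    then have "Y p = 0" by (simp add: Y_def)
    then have "(p \<bullet> axis)\<^sup>2 = R\<^sup>2" using p(1) Y_axis[of p] by (simp add: M_def R2)
    then have "p \<bullet> axis = R \<or> p \<bullet> axis = - R" by (simp add: power2_eq_iff)
    moreover have "norm (p - z) = \<bar>p \<bullet> axis - \<zeta>\<bar>" using dz[of p] \<open>Y p = 0\<close> by (metis add_0 real_sqrt_abs abs_norm_cancel)
    ultimately show False using lt pz \<zeta> R2(2) by auto
  qed
  define q where "q = p - 2 *\<^sub>R flat p"
  have qf: "flat q = - flat p" by (simp add: q_def perp_diff perp_scaleR flat_idem) (simp add: scaleR_2)
  have qa: "q \<bullet> axis = p \<bullet> axis" by (simp add: q_def inner_diff_left flat_inner_axis)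
  have qY: "Y q = Y p"
    by (metis Y_def qf flat_inner_flat inner_minus_left inner_minus_right minus_minus)
  have "q \<in> W" using p(1) M_W flat_W unfolding q_def by (auto intro!: subspace_diff subspace_scale subspace_euclid)
  then have qM: "q \<in> M" using p(1) Y_axis[of q] Y_axis[of p] by (simp add: M_def qY qa)
  have "(norm (q - z))\<^sup>2 = (norm (p - z))\<^sup>2" by (simp add: dz qY qa)
  then have "norm (q - z) = norm (p - z)" by (rule power2_eq_imp_eq) simp_all
  then have qz: "norm (q - z) = infdist z M" using pz by simp
  have "p \<noteq> q" using fp by (simp add: q_def)
  moreover have "z \<in> euclid D" using W_sub unfolding z_def by (auto intro!: subspace_scale subspace_euclid)
  ultimately have "z \<in> medial_axis (euclid D) M"
    unfolding medial_axis_def using p(1) qM pz qz by blast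
  then have "reach (euclid D) M \<le> ennreal (infdist z M)" unfolding reach_def by (rule INF_lower)
  also have "\<dots> \<le> ennreal (R - \<zeta>)" using lt by (intro ennreal_leI) simp
  finally show ?thesis by (simp add: R_def)
qed

end

section \<open>Hausdorff measure of the hypersurfaces\<close>

definition hausdorff_outer :: "nat \<Rightarrow> 'v::metric_space set \<Rightarrow> ennreal" where
  "hausdorff_outer d A = (SUP \<delta>\<in>{0<..}. hausdorff_content d \<delta> A)"

lemma hausdorff_outer_mono: "A \<subseteq> B \<Longrightarrow> hausdorff_outer d A \<le> hausdorff_outer d B"
  unfolding hausdorff_outer_def hausdorff_content_def
  by (intro SUP_mono' INF_superset_mono) auto

text \<open>
  A cover of \<open>A\<close> by sets \<open>C i\<close> gives the cover of the image by the sets \<open>f ` (A \<inter> C i)\<close>. The constant is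
  moved to the other side before passing to the infimum over the covers.
\<close>

lemma hausdorff_content_lipschitz:
  fixes f :: "'a::real_normed_vector \<Rightarrow> 'b::real_normed_vector"
  assumes K: "0 < K" and f: "\<And>x y. x \<in> A \<Longrightarrow> y \<in> A \<Longrightarrow> dist (f x) (f y) \<le> K * dist x y"
  shows "hausdorff_content d (K * \<delta>) (f ` A) \<le> ennreal (K ^ d) * hausdorff_content d \<delta> A"
proof -
  let ?w = "\<lambda>t. ennreal (unit_ball_vol (real d) * (t / 2) ^ d)"
  let ?C = "hausdorff_content d (K * \<delta>) (f ` A)"
  have le: "?C \<le> ennreal (K ^ d) * (\<Sum>i. ?w (diameter (C i)))"
    if C: "A \<subseteq> (\<Union>i. C i)" "\<forall>i. bounded (C i) \<and> diameter (C i) \<le> \<delta>" for C :: "nat \<Rightarrow> 'a set"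
  proof -
    define C' where "C' i = f ` (A \<inter> C i)" for i
    have d: "dist (f x) (f y) \<le> K * diameter (C i)" if "x \<in> A \<inter> C i" "y \<in> A \<inter> C i" for x y i
    proof -
      have "dist (f x) (f y) \<le> K * dist x y" using f that by blast
      also have "\<dots> \<le> K * diameter (C i)"
        using diameter_bounded_bound[of "C i" x y] C(2) that K by (intro mult_left_mono) auto
      finally show ?thesis .
    qed
    have D0: "0 \<le> diameter (C i)" for i using C(2) diameter_ge_0 by blast
    have D: "diameter (C' i) \<le> K * diameter (C i)" for i
      by (rule diameter_le) (use D0[of i] K d in \<open>auto simp: C'_def dist_norm\<close>)
    have bd: "bounded (C' i)" for i
    proof (cases "A \<inter> C i = {}")
      case False
      then obtain x where "x \<in> A \<inter> C i" by blast
      then show ?thesis using d[of x i] unfolding bounded_def C'_def by blast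
    qed (simp add: C'_def)
    have D0': "0 \<le> diameter (C' i)" for i using bd diameter_ge_0 by blast
    have "diameter (C' i) \<le> K * \<delta>" for i
      using D[of i] C(2) K by (meson order_trans mult_left_mono less_imp_le)
    moreover have "f ` A \<subseteq> (\<Union>i. C' i)" using C(1) unfolding C'_def by blast
    ultimately have "?C \<le> (\<Sum>i. ?w (diameter (C' i)))"
      unfolding hausdorff_content_def using bd by (intro INF_lower) auto
    also have "\<dots> \<le> (\<Sum>i. ennreal (K ^ d) * ?w (diameter (C i)))"
    proof (rule suminf_le)
      fix i
      have "(diameter (C' i) / 2) ^ d \<le> (K * (diameter (C i) / 2)) ^ d"
        using D[of i] D0'[of i] by (intro power_mono) auto
      then have "unit_ball_vol (real d) * (diameter (C' i) / 2) ^ d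
          \<le> unit_ball_vol (real d) * (K ^ d * (diameter (C i) / 2) ^ d)"
        unfolding power_mult_distrib[of K] by (intro mult_left_mono) auto
      then show "?w (diameter (C' i)) \<le> ennreal (K ^ d) * ?w (diameter (C i))"
        using K by (subst ennreal_mult'[symmetric]) (auto intro!: ennreal_leI simp: algebra_simps)
    qed auto
    also have "\<dots> = ennreal (K ^ d) * (\<Sum>i. ?w (diameter (C i)))" by (rule ennreal_suminf_cmult)
    finally show ?thesis .
  qed
  define k where "k = ennreal (K ^ d)"
  define k' where "k' = ennreal (1 / K ^ d)"
  have kk: "k' * (k * x) = x" "k * (k' * x) = x" for x
    using K unfolding k_def k'_def by (simp_all add: mult.assoc[symmetric] ennreal_mult'[symmetric])
  have "k' * ?C \<le> hausdorff_content d \<delta> A"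
    unfolding hausdorff_content_def[of d \<delta> A]
  proof (rule INF_greatest)
    fix C assume "C \<in> {C :: nat \<Rightarrow> 'a set. A \<subseteq> (\<Union>i. C i) \<and> (\<forall>i. bounded (C i) \<and> diameter (C i) \<le> \<delta>)}"
    then have "?C \<le> k * (\<Sum>i. ?w (diameter (C i)))"
      unfolding k_def by (intro le) auto
    then have "k' * ?C \<le> k' * (k * (\<Sum>i. ?w (diameter (C i))))"
      by (intro mult_left_mono) auto
    then show "k' * ?C \<le> (\<Sum>i. ?w (diameter (C i)))"
      by (simp only: kk)
  qed
  then have "k * (k' * ?C) \<le> k * hausdorff_content d \<delta> A"
    by (intro mult_left_mono) auto
  then show ?thesis by (simp only: kk) (simp only: k_def)
qed

lemma hausdorff_outer_lipschitz:
  fixes f :: "'a::real_normed_vector \<Rightarrow> 'b::real_normed_vector"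
  assumes K: "0 < K" and f: "\<And>x y. x \<in> A \<Longrightarrow> y \<in> A \<Longrightarrow> dist (f x) (f y) \<le> K * dist x y"
    and B: "B \<subseteq> f ` A"
  shows "hausdorff_outer d B \<le> ennreal (K ^ d) * hausdorff_outer d A"
proof -
  have "hausdorff_outer d (f ` A) \<le> ennreal (K ^ d) * hausdorff_outer d A"
    unfolding hausdorff_outer_def[of d "f ` A"]
  proof (rule SUP_least)
    fix \<delta> :: real assume \<delta>: "\<delta> \<in> {0<..}"
    have "hausdorff_content d (K * (\<delta> / K)) (f ` A) \<le> ennreal (K ^ d) * hausdorff_content d (\<delta> / K) A"
      by (rule hausdorff_content_lipschitz[OF K f])
    also have "\<dots> \<le> ennreal (K ^ d) * hausdorff_outer d A"
      unfolding hausdorff_outer_def using \<delta> K by (intro mult_left_mono SUP_upper) auto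
    finally show "hausdorff_content d \<delta> (f ` A) \<le> ennreal (K ^ d) * hausdorff_outer d A"
      using K by simp
  qed
  then show ?thesis using hausdorff_outer_mono[OF B, of d] by (rule order_trans[rotated])
qed

definition sph :: "nat \<Rightarrow> real \<Rightarrow> fsvec set" where
  "sph d r = {x \<in> euclid (Suc d). norm x = r}"

lemma compact_sph: "compact (sph d r)"
proof (rule compact_euclid[of _ "Suc d" r])
  have "sph d r = euclid (Suc d) \<inter> {y. norm y = r}" by (auto simp: sph_def)
  then show "closed (sph d r)"
    by (simp add: closed_Int closed_euclid closed_Collect_eq continuous_intros)
qed (auto simp: sph_def)

lemma sets_hausdorff [simp, measurable_cong]: "sets (hausdorff_measure d) = sets borel"
  unfolding hausdorff_measure_def using sets.sigma_sets_eq[of borel] by (simp add: sets_measure_of_conv)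

lemma space_hausdorff [simp]: "space (hausdorff_measure d) = UNIV"
  unfolding hausdorff_measure_def by (simp add: space_measure_of_conv)

text \<open>
  The constant \<^const>\<open>measure_of\<close> turns a set function that is not countably additive into \<open>0\<close>, and
  \<^const>\<open>measure\<close> turns an infinite value into \<open>0\<close>. A nonzero volume of the unit sphere therefore implies that
  the Hausdorff outer measure is countably additive on Borel sets and finite on the sphere.
\<close>

locale nondegenerate =
  fixes d :: nat
  assumes vol: "sphere_vol d \<noteq> 0"
begin

lemma vol_pos: "0 < sphere_vol d"
  using vol measure_nonneg[of "hausdorff_measure d"] unfolding sphere_vol_def by (smt (verit))

lemma emeasure_hausdorff:
  fixes A :: "fsvec set"
  assumes "A \<in> sets borel"
  shows "emeasure (hausdorff_measure d) A = hausdorff_outer d A"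
proof -
  have ss: "sigma_sets UNIV (sets borel) = (sets borel :: fsvec set set)"
    using sets.sigma_sets_eq[of "borel :: fsvec measure"] by simp
  have ms: "measure_space UNIV (sets borel) (hausdorff_outer d :: fsvec set \<Rightarrow> ennreal)"
  proof (rule ccontr)
    assume "\<not> ?thesis"
    then have "emeasure (hausdorff_measure d) A = 0" for A :: "fsvec set"
      unfolding hausdorff_measure_def
      by (simp add: emeasure_measure_of_conv ss hausdorff_outer_def[abs_def])
    then show False using vol by (simp add: sphere_vol_def measure_def)
  qed
  then show ?thesis
    using assms unfolding hausdorff_measure_def
    by (simp add: emeasure_measure_of_conv ss hausdorff_outer_def[abs_def])
qed

lemma outer_unit_sphere: "hausdorff_outer d (sph d 1) = ennreal (sphere_vol d)"
proof -
  have eq: "sph d 1 = {x \<in> euclid (d + 1). norm x = 1}" by (simp add: sph_def)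
  have "emeasure (hausdorff_measure d) (sph d 1) \<noteq> \<infinity>"
    using vol by (auto simp: sphere_vol_def measure_def eq)
  then have "emeasure (hausdorff_measure d) (sph d 1) = ennreal (sphere_vol d)"
    unfolding sphere_vol_def eq[symmetric] by (intro emeasure_eq_ennreal_measure) simp
  moreover have "sph d 1 \<in> sets borel" using compact_imp_closed[OF compact_sph] by simp
  ultimately show ?thesis using emeasure_hausdorff by metis
qed

text \<open>
  Homotheties in both directions are Lipschitz with inverse constants, which gives equality.
\<close>

lemma outer_sphere:
  assumes r: "0 < r"
  shows "hausdorff_outer d (sph d r) = ennreal (r ^ d * sphere_vol d)"
proof (rule antisym)
  have scale: "hausdorff_outer d (sph d b) \<le> ennreal ((b / a) ^ d) * hausdorff_outer d (sph d a)"
    if "0 < a" "0 < b" for a b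
  proof (rule hausdorff_outer_lipschitz[where f = "\<lambda>x. (b / a) *\<^sub>R x"])
    show "sph d b \<subseteq> (\<lambda>x. (b / a) *\<^sub>R x) ` sph d a"
    proof
      fix x assume "x \<in> sph d b"
      then have "(a / b) *\<^sub>R x \<in> sph d a" "x = (b / a) *\<^sub>R ((a / b) *\<^sub>R x)"
        using that by (auto simp: sph_def intro!: subspace_scale subspace_euclid)
      then show "x \<in> (\<lambda>x. (b / a) *\<^sub>R x) ` sph d a" by blast
    qed
    show "dist ((b / a) *\<^sub>R x) ((b / a) *\<^sub>R y) \<le> b / a * dist x y" for x y :: fsvec
      using that by (simp add: dist_norm scaleR_diff_right[symmetric])
  qed (use that in auto)
  show "hausdorff_outer d (sph d r) \<le> ennreal (r ^ d * sphere_vol d)"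
    using scale[of 1 r] r by (simp add: outer_unit_sphere ennreal_mult')
  have "ennreal (sphere_vol d) \<le> ennreal ((1 / r) ^ d) * hausdorff_outer d (sph d r)"
    using scale[of r 1] r by (simp add: outer_unit_sphere)
  then have "ennreal (r ^ d) * ennreal (sphere_vol d) \<le> ennreal (r ^ d) * (ennreal ((1 / r) ^ d) * hausdorff_outer d (sph d r))"
    by (intro mult_left_mono) auto
  also have "\<dots> = hausdorff_outer d (sph d r)"
    using r by (simp add: mult.assoc[symmetric] ennreal_mult'[symmetric] power_mult_distrib[symmetric])
  finally show "ennreal (r ^ d * sphere_vol d) \<le> hausdorff_outer d (sph d r)"
    using r by (simp add: ennreal_mult')
qed

text \<open>
  The ball of the hyperplane orthogonal to the axis is the image of a sphere under a projection,
  which bounds its measure without computing it.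
\<close>

lemma outer_disk:
  assumes "0 < \<rho>"
  shows "hausdorff_outer d {y \<in> euclid (Suc d). y \<bullet> axis = 0 \<and> norm y \<le> \<rho>} \<le> ennreal (\<rho> ^ d * sphere_vol d)"
proof -
  let ?D = "{y \<in> euclid (Suc d). y \<bullet> axis = 0 \<and> norm y \<le> \<rho>}"
  have "hausdorff_outer d ?D
      \<le> ennreal (1 ^ d) * hausdorff_outer d (sph d \<rho>)"
  proof (rule hausdorff_outer_lipschitz[where f = flat])
    show "dist (flat x) (flat y) \<le> 1 * dist x y" for x y
      using norm_flat_le[of "x - y"] by (simp add: dist_norm perp_diff)
    show "?D \<subseteq> flat ` sph d \<rho>"
    proof
      fix y assume y: "y \<in> ?D"
      let ?x = "y + sqrt (\<rho>\<^sup>2 - y \<bullet> y) *\<^sub>R axis"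
      have fy: "flat ?x = y" using y by (simp add: perp_add_unit) (simp add: perp_def)
      have "(norm y)\<^sup>2 \<le> \<rho>\<^sup>2" using y by (intro power_mono) auto
      then have "0 \<le> \<rho>\<^sup>2 - y \<bullet> y" by (simp add: power2_norm_eq_inner)
      then have "(sqrt (\<rho>\<^sup>2 - y \<bullet> y))\<^sup>2 = \<rho>\<^sup>2 - y \<bullet> y" by simp
      moreover have "?x \<bullet> axis = sqrt (\<rho>\<^sup>2 - y \<bullet> y)" using y by (simp add: inner_left_distrib inner_unit)
      moreover have "flat ?x \<bullet> ?x = y \<bullet> y" unfolding fy using y by (simp add: inner_right_distrib)
      ultimately have "?x \<bullet> ?x = \<rho>\<^sup>2" using flat_pythagoras[of ?x] by simp
      then have "norm ?x = \<rho>" using assms by (simp add: norm_eq_sqrt_inner)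
      moreover have "?x \<in> euclid (Suc d)" using y by (intro subspace_add subspace_scale subspace_euclid) auto
      ultimately have "?x \<in> sph d \<rho>" by (simp add: sph_def)
      then show "y \<in> flat ` sph d \<rho>" using fy[symmetric] by (rule rev_image_eqI)
    qed
  qed simp
  then show ?thesis by (simp add: outer_sphere[OF assms])
qed

text \<open>
  Reflections carry any point of the sphere to any other, so a null neighbourhood of one point
  would, by compactness, make the whole sphere null.
\<close>

lemma outer_sphere_open:
  assumes r: "0 < r" and U: "open U" and p: "p \<in> sph d r \<inter> U"
  shows "0 < hausdorff_outer d (sph d r \<inter> U)"
proof -
  obtain \<epsilon> where \<epsilon>: "0 < \<epsilon>" "ball p \<epsilon> \<subseteq> U" using U p by (auto simp: open_contains_ball)
  let ?h = "\<lambda>q. hausdorff_outer d (sph d r \<inter> ball q \<epsilon>)"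
  have transfer: "?h q \<le> ?h p"
    if q: "q \<in> sph d r" for q
  proof (cases "p = q")
    case False
    \<comment> \<open>the reflection that exchanges \<open>p\<close> and \<open>q\<close>\<close>
    define u where "u = p - q"
    define R where "R x = x - (2 * (u \<bullet> x) / (u \<bullet> u)) *\<^sub>R u" for x
    have u: "u \<bullet> u \<noteq> 0" "u \<in> euclid (Suc d)"
      using False p q by (auto simp: u_def sph_def intro!: subspace_diff subspace_euclid)
    have Rdiff: "R x - R y = R (x - y)" for x y
      by (simp add: R_def inner_diff_right algebra_simps diff_divide_distrib)
    have Rnorm: "norm (R x) = norm x" for x unfolding R_def by (rule norm_reflection)
    have Rdist: "dist (R x) (R y) = dist x y" for x y by (simp add: dist_norm Rdiff Rnorm)
    have RR: "R (R x) = x" for x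
      using u(1) by (simp add: R_def inner_diff_right)
    have "norm p = norm q" using p q by (simp add: sph_def)
    then have "p \<bullet> p = q \<bullet> q" by (simp add: norm_eq_sqrt_inner)
    then have "2 * (u \<bullet> p) = u \<bullet> u" by (simp add: u_def inner_diff_left inner_diff_right inner_commute)
    then have Rp: "R p = q" using u(1) by (simp add: R_def) (simp add: u_def)
    then have Rq: "R q = p" using RR[of p] by simp
    have "?h q \<le> ennreal (1 ^ d) * ?h p"
    proof (rule hausdorff_outer_lipschitz[where f = R])
      show "sph d r \<inter> ball q \<epsilon> \<subseteq> R ` (sph d r \<inter> ball p \<epsilon>)"
      proof
        fix x assume x: "x \<in> sph d r \<inter> ball q \<epsilon>"
        then have "R x \<in> sph d r"
          using u(2) by (auto simp: sph_def Rnorm) (auto simp: R_def intro!: subspace_diff subspace_scale subspace_euclid)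
        moreover have "R x \<in> ball p \<epsilon>" using x Rdist[of q x] by (simp add: Rq)
        ultimately show "x \<in> R ` (sph d r \<inter> ball p \<epsilon>)" using RR[of x, symmetric] by blast
      qed
    qed (auto simp: Rdist)
    then show ?thesis by simp
  qed simp
  show ?thesis
  proof (rule ccontr)
    assume "\<not> ?thesis"
    then have "?h p = 0"
      using hausdorff_outer_mono[of "sph d r \<inter> ball p \<epsilon>" "sph d r \<inter> U" d] \<epsilon>(2) by auto
    then have zero: "?h q = 0" if "q \<in> sph d r" for q
      using transfer[OF that] by simp
    have meas: "sph d r \<inter> ball q \<epsilon> \<in> sets borel" for q
      using compact_imp_closed[OF compact_sph] by (intro sets.Int borel_closed borel_open) auto
    have cover: "sph d r \<subseteq> (\<Union>q\<in>sph d r. ball q \<epsilon>)" using \<epsilon>(1) by auto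
    obtain F where F: "F \<subseteq> sph d r" "finite F" "sph d r \<subseteq> (\<Union>q\<in>F. ball q \<epsilon>)"
      by (rule compactE_image[OF compact_sph _ cover]) auto
    then have "sph d r = (\<Union>q\<in>F. sph d r \<inter> ball q \<epsilon>)" by auto
    then have "emeasure (hausdorff_measure d) (sph d r) \<le> (\<Sum>q\<in>F. emeasure (hausdorff_measure d) (sph d r \<inter> ball q \<epsilon>))"
      using emeasure_subadditive_finite[OF F(2), of "\<lambda>q. sph d r \<inter> ball q \<epsilon>" "hausdorff_measure d"] meas by auto
    also have "\<dots> = 0"
      using F(1) zero by (intro sum.neutral) (auto simp: emeasure_hausdorff[OF meas])
    finally have "hausdorff_outer d (sph d r) = 0"
      using emeasure_hausdorff[of "sph d r"] compact_imp_closed[OF compact_sph] by simp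
    then show False using outer_sphere[OF r] vol_pos r by simp
  qed
qed

end

context revolution
begin

text \<open>
  Over the disk of radius \<open>r / 2\<close> the square of the height is at least \<open>r\<^sup>2 / 4\<close>, so its square root is
  Lipschitz there.
\<close>

lemma cap_lipschitz:
  assumes \<sigma>: "\<bar>\<sigma>\<bar> = 1" and x: "x \<in> disk (r / 2)" and y: "y \<in> disk (r / 2)"
  shows "dist (cap \<sigma> x) (cap \<sigma> y) \<le> 3 * dist x y"
proof -
  define g where "g u = r\<^sup>2 + \<beta> u - u" for u
  have sq: "z \<bullet> z \<le> r\<^sup>2 / 4" if "z \<in> disk (r / 2)" for z
  proof -
    have "(norm z)\<^sup>2 \<le> (r / 2)\<^sup>2" using that by (intro power_mono) (auto simp: disk_def)
    then show ?thesis by (simp add: power2_norm_eq_inner power_divide)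
  qed
  have low: "r / 2 \<le> sqrt (g (z \<bullet> z))" if "z \<in> disk (r / 2)" for z
  proof (rule real_le_rsqrt)
    have "(r / 2)\<^sup>2 = r\<^sup>2 / 4" by (simp add: power_divide)
    then show "(r / 2)\<^sup>2 \<le> g (z \<bullet> z)"
      using sq[OF that] \<beta>_nonneg[of "z \<bullet> z"] zero_le_power2[of r] unfolding g_def by linarith
  qed
  have lip: "\<bar>g u - g w\<bar> \<le> 2 * \<bar>u - w\<bar>" if "0 \<le> u" "0 \<le> w" for u w
  proof -
    have "norm (\<beta> u - \<beta> w) \<le> \<kappa> * norm (u - w)"
      by (rule field_differentiable_bound[of "{0..}" \<beta> \<beta>1 \<kappa>])
        (use that \<beta>1_le in \<open>auto intro: has_field_derivative_at_within[OF deriv_\<beta>] convex_real_interval\<close>)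
    also have "\<dots> \<le> 1 * norm (u - w)" using \<kappa> by (intro mult_right_mono) auto
    finally have "\<bar>\<beta> u - \<beta> w\<bar> \<le> \<bar>u - w\<bar>" by simp
    moreover have "g u - g w = (\<beta> u - \<beta> w) - (u - w)" by (simp add: g_def)
    moreover have "\<bar>(\<beta> u - \<beta> w) - (u - w)\<bar> \<le> \<bar>\<beta> u - \<beta> w\<bar> + \<bar>u - w\<bar>" by (rule abs_triangle_ineq4)
    ultimately show ?thesis by simp
  qed
  define a where "a = sqrt (g (x \<bullet> x))"
  define b where "b = sqrt (g (y \<bullet> y))"
  have ab: "r / 2 \<le> a" "r / 2 \<le> b" using low x y by (auto simp: a_def b_def)
  have ga: "a * a = g (x \<bullet> x)" "b * b = g (y \<bullet> y)"
  proof -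
    have "0 < a" "0 < b" using ab r by linarith+
    then have "0 \<le> g (x \<bullet> x)" "0 \<le> g (y \<bullet> y)" by (simp_all add: a_def b_def)
    then show "a * a = g (x \<bullet> x)" "b * b = g (y \<bullet> y)" by (simp_all add: a_def b_def)
  qed
  have "\<bar>a - b\<bar> * r \<le> \<bar>a - b\<bar> * (a + b)" using ab by (intro mult_left_mono) auto
  also have "\<dots> = \<bar>a * a - b * b\<bar>"
    using ab r by (simp add: abs_mult square_diff_square_factored)
  also have "\<dots> \<le> 2 * \<bar>x \<bullet> x - y \<bullet> y\<bar>" unfolding ga by (rule lip) auto
  also have "x \<bullet> x - y \<bullet> y = (x - y) \<bullet> (x + y)"
    by (simp add: inner_diff_left inner_diff_right inner_right_distrib inner_commute[of y x])
  also have "\<bar>(x - y) \<bullet> (x + y)\<bar> \<le> norm (x - y) * norm (x + y)" by (rule Cauchy_Schwarz_ineq2)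
  also have "\<dots> \<le> norm (x - y) * r"
    using x y norm_triangle_ineq[of x y] by (intro mult_left_mono) (auto simp: disk_def)
  finally have "\<bar>a - b\<bar> * r \<le> (2 * norm (x - y)) * r" by simp
  then have h: "\<bar>a - b\<bar> \<le> 2 * norm (x - y)" using r by simp
  have "cap \<sigma> x - cap \<sigma> y = (x - y) + (\<sigma> * (a - b)) *\<^sub>R axis"
    by (simp add: cap_def a_def b_def g_def algebra_simps)
  then have "norm (cap \<sigma> x - cap \<sigma> y) \<le> norm (x - y) + \<bar>a - b\<bar>"
    using norm_triangle_ineq[of "x - y" "(\<sigma> * (a - b)) *\<^sub>R axis"] \<sigma> by (simp add: abs_mult)
  then show ?thesis using h by (simp add: dist_norm)
qed

lemma sqrt_s: "0 < sqrt s" "sqrt s \<le> r / 4"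
proof -
  show "0 < sqrt s" using s by simp
  have "s \<le> (r / 4)\<^sup>2" using s by (simp add: power_divide)
  then show "sqrt s \<le> r / 4" using r by (intro real_le_lsqrt) auto
qed

lemma M_outer_part: "M \<inter> {x. s < Y x} = sph d r \<inter> {x. s < Y x}"
  using \<beta>_zero r by (auto simp: M_def sph_def norm_eq_sqrt_inner real_sqrt_unique)

lemma disk_mono: "a \<le> b \<Longrightarrow> disk a \<subseteq> disk b"
  by (auto simp: disk_def)

lemma open_Y: "open {x. s < Y x}"
  by (intro open_Collect_less continuous_on_const continuous_on_Y)

lemma borel_M [measurable]: "M \<in> sets borel"
  using closed_M by simp

lemma borel_Y [measurable]: "Y \<in> borel_measurable borel"
  by (rule borel_measurable_continuous_onI[OF continuous_on_Y])

end

locale measured_revolution = revolution + nondegenerate d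
begin

abbreviation "H \<equiv> (hausdorff_measure d :: fsvec measure)"

text \<open>
  The part of the hypersurface over the disk of radius \<open>sqrt s\<close> consists of two graphs, Lipschitz images
  of the disk.
\<close>

lemma emeasure_bump: "emeasure H (M \<inter> {x. Y x \<le> s}) \<le> ennreal (2 * (3 * sqrt s) ^ d * sphere_vol d)"
proof -
  have half: "emeasure H (cap \<sigma> ` disk (sqrt s)) \<le> ennreal ((3 * sqrt s) ^ d * sphere_vol d)"
    if "\<bar>\<sigma>\<bar> = 1" for \<sigma>
  proof -
    have "closed (cap \<sigma> ` disk (sqrt s))"
      by (intro compact_imp_closed compact_continuous_image continuous_on_cap compact_disk)
    then have "emeasure H (cap \<sigma> ` disk (sqrt s)) = hausdorff_outer d (cap \<sigma> ` disk (sqrt s))"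
      by (intro emeasure_hausdorff) simp
    also have "\<dots> \<le> ennreal (3 ^ d) * hausdorff_outer d (disk (sqrt s))"
    proof (rule hausdorff_outer_lipschitz[where f = "cap \<sigma>"])
      show "dist (cap \<sigma> x) (cap \<sigma> y) \<le> 3 * dist x y" if "x \<in> disk (sqrt s)" "y \<in> disk (sqrt s)" for x y
        using that sqrt_s r disk_mono[of "sqrt s" "r / 2"] \<open>\<bar>\<sigma>\<bar> = 1\<close> by (intro cap_lipschitz) auto
    qed auto
    also have "\<dots> \<le> ennreal (3 ^ d) * ennreal (sqrt s ^ d * sphere_vol d)"
      unfolding disk_def by (intro mult_left_mono outer_disk sqrt_s) auto
    also have "\<dots> = ennreal ((3 * sqrt s) ^ d * sphere_vol d)"
      by (simp add: ennreal_mult'[symmetric] power_mult_distrib mult.assoc)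
    finally show ?thesis .
  qed
  have meas: "cap \<sigma> ` disk (sqrt s) \<in> sets H" for \<sigma>
    using compact_imp_closed[OF compact_continuous_image[OF continuous_on_cap compact_disk]] by simp
  have sub: "M \<inter> {x. Y x \<le> s} \<subseteq> cap 1 ` disk (sqrt s) \<union> cap (-1) ` disk (sqrt s)"
  proof
    fix x assume x: "x \<in> M \<inter> {x. Y x \<le> s}"
    then have fd: "flat x \<in> disk (sqrt s)" if "flat x \<in> disk r"
      using that by (auto simp: disk_def norm_flat_Y)
    show "x \<in> cap 1 ` disk (sqrt s) \<union> cap (-1) ` disk (sqrt s)"
    proof (cases "0 \<le> x \<bullet> axis")
      case True
      then show ?thesis using M_eq_cap[of x 1] x fd by auto
    next
      case False
      then show ?thesis using M_eq_cap[of x "-1"] x fd by auto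
    qed
  qed
  have "emeasure H (M \<inter> {x. Y x \<le> s}) \<le> emeasure H (cap 1 ` disk (sqrt s) \<union> cap (-1) ` disk (sqrt s))"
    using sub meas by (intro emeasure_mono) auto
  also have "\<dots> \<le> emeasure H (cap 1 ` disk (sqrt s)) + emeasure H (cap (-1) ` disk (sqrt s))"
    using meas by (intro emeasure_subadditive) auto
  also have "\<dots> \<le> ennreal ((3 * sqrt s) ^ d * sphere_vol d) + ennreal ((3 * sqrt s) ^ d * sphere_vol d)"
    by (intro add_mono half) auto
  also have "\<dots> = ennreal (2 * (3 * sqrt s) ^ d * sphere_vol d)"
    using vol_pos s by (subst ennreal_plus[symmetric]) (auto simp: algebra_simps)
  finally show ?thesis .
qed

lemma emeasure_sphere: "emeasure H (sph d r) = ennreal (r ^ d * sphere_vol d)"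
  using emeasure_hausdorff[of "sph d r"] compact_imp_closed[OF compact_sph] outer_sphere[OF r] by simp

lemma emeasure_M_split: "emeasure H M = emeasure H (M \<inter> {x. Y x \<le> s}) + emeasure H (sph d r \<inter> {x. s < Y x})"
proof -
  have "emeasure H M = emeasure H ((M \<inter> {x. Y x \<le> s}) \<union> (M \<inter> {x. s < Y x}))"
    by (rule arg_cong[of _ _ "emeasure H"]) auto
  also have "\<dots> = emeasure H (M \<inter> {x. Y x \<le> s}) + emeasure H (M \<inter> {x. s < Y x})"
    by (rule plus_emeasure[symmetric]) auto
  finally show ?thesis by (simp add: M_outer_part)
qed

lemma emeasure_M_le: "emeasure H M \<le> ennreal ((r ^ d + 2 * (3 * sqrt s) ^ d) * sphere_vol d)"
proof -
  have "emeasure H (sph d r \<inter> {x. s < Y x}) \<le> emeasure H (sph d r)"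
    using compact_imp_closed[OF compact_sph] by (intro emeasure_mono) auto
  then have "emeasure H M \<le> ennreal (2 * (3 * sqrt s) ^ d * sphere_vol d) + ennreal (r ^ d * sphere_vol d)"
    unfolding emeasure_M_split using emeasure_bump by (intro add_mono) (auto simp: emeasure_sphere)
  also have "\<dots> = ennreal ((r ^ d + 2 * (3 * sqrt s) ^ d) * sphere_vol d)"
    using vol_pos s r by (subst ennreal_plus[symmetric]) (auto simp: algebra_simps)
  finally show ?thesis .
qed

text \<open>
  Off the bump, a relatively open piece of \<open>M\<close> contains one of the sphere. Near the bump, moving points
  parallel to the axis is a Lipschitz map from \<open>M\<close> to the sphere, whose image of the piece contains a
  relatively open piece of the sphere.
\<close>

lemma emeasure_M_open:
  assumes U: "open U" and p: "p \<in> M \<inter> U"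
  shows "0 < emeasure H (M \<inter> U)"
proof -
  have "M \<inter> U \<in> sets borel" using U closed_M by simp
  then have *: "emeasure H (M \<inter> U) = hausdorff_outer d (M \<inter> U)" by (rule emeasure_hausdorff)
  show ?thesis
  proof (cases "s < Y p")
    case True
    have "p \<in> sph d r \<inter> (U \<inter> {x. s < Y x})" using p True M_outer_part by blast
    then have "0 < hausdorff_outer d (sph d r \<inter> (U \<inter> {x. s < Y x}))"
      by (intro outer_sphere_open r open_Int U open_Y)
    also have "\<dots> \<le> hausdorff_outer d (M \<inter> U)"
      using M_outer_part by (intro hausdorff_outer_mono) blast
    finally show ?thesis by (simp add: *)
  next
    case False
    interpret sphere: revolution d D r s 0 "\<lambda>_. 0" "\<lambda>_. 0" "\<lambda>_. 0" "\<lambda>_. 0"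
      using dims r s by unfold_locales auto
    have sphM: "sphere.M = sph d r"
      using r by (auto simp: sphere.M_def sph_def norm_eq_sqrt_inner real_sqrt_unique)
    obtain \<sigma> :: real where \<sigma>: "\<sigma> = 1 \<or> \<sigma> = -1" "0 \<le> \<sigma> * (p \<bullet> axis)"
      by (cases "0 \<le> p \<bullet> axis") (auto intro: that[of 1] that[of "-1"])
    then have \<sigma>1: "\<bar>\<sigma>\<bar> = 1" by auto
    let ?U = "{x. 0 < \<sigma> * (x \<bullet> axis)} \<inter> {x. norm (flat x) < r / 2} \<inter> (\<lambda>x. cap \<sigma> (flat x)) -` U"
    have cflat: "continuous_on A flat" for A by (rule linear_continuous_on[OF bounded_linear_perp])
    have oU: "open ?U"
      by (intro open_Int open_Collect_less continuous_intros cflat open_vimage U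
          continuous_on_compose2[OF continuous_on_cap[of UNIV]]) auto
    have pc: "p = cap \<sigma> (flat p)" "flat p \<in> disk r" using M_eq_cap[of p \<sigma>] p \<sigma> by auto
    have fp: "norm (flat p) < r / 2"
    proof -
      have "norm (flat p) \<le> sqrt s" using False by (simp add: norm_flat_Y)
      then show ?thesis using sqrt_s r by linarith
    qed
    define x0 where "x0 = sphere.cap \<sigma> (flat p)"
    have x0: "flat x0 = flat p" "x0 \<in> sph d r" "x0 \<bullet> axis = \<sigma> * sqrt (r\<^sup>2 - flat p \<bullet> flat p)"
      using sphere.disk_cap[OF pc(2), of \<sigma>] sphere.cap_in_M[OF pc(2) \<sigma>1] by (auto simp: x0_def sphM)
    have "flat p \<bullet> flat p < r\<^sup>2"
      using False s_less_r2 by (simp add: flat_inner_flat Y_def)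
    then have "0 < \<sigma> * (x0 \<bullet> axis)" using \<sigma>(1) x0(3) by auto
    then have "x0 \<in> sph d r \<inter> ?U" using x0 fp pc p by auto
    then have "0 < hausdorff_outer d (sph d r \<inter> ?U)" by (rule outer_sphere_open[OF r oU])
    also have "\<dots> \<le> ennreal (3 ^ d) * hausdorff_outer d (M \<inter> U \<inter> {x. norm (flat x) \<le> r / 2})"
    proof (rule hausdorff_outer_lipschitz[where f = "\<lambda>x. sphere.cap \<sigma> (flat x)"])
      fix x y assume xy: "x \<in> M \<inter> U \<inter> {x. norm (flat x) \<le> r / 2}" "y \<in> M \<inter> U \<inter> {x. norm (flat x) \<le> r / 2}"
      then have "flat x \<in> disk (r / 2)" "flat y \<in> disk (r / 2)"
        using M_W flat_W by (auto simp: disk_def flat_inner_axis)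
      then have "dist (sphere.cap \<sigma> (flat x)) (sphere.cap \<sigma> (flat y)) \<le> 3 * dist (flat x) (flat y)"
        by (intro sphere.cap_lipschitz \<sigma>1)
      also have "dist (flat x) (flat y) \<le> dist x y"
        using norm_flat_le[of "x - y"] by (simp add: dist_norm perp_diff)
      finally show "dist (sphere.cap \<sigma> (flat x)) (sphere.cap \<sigma> (flat y)) \<le> 3 * dist x y" by simp
    next
      show "sph d r \<inter> ?U \<subseteq> (\<lambda>x. sphere.cap \<sigma> (flat x)) ` (M \<inter> U \<inter> {x. norm (flat x) \<le> r / 2})"
      proof
        fix x assume x: "x \<in> sph d r \<inter> ?U"
        then have xc: "x = sphere.cap \<sigma> (flat x)" "flat x \<in> disk r"
          using sphere.M_eq_cap[of x \<sigma>] \<sigma> sphM by auto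
        let ?m = "cap \<sigma> (flat x)"
        have "flat ?m = flat x" "?m \<in> M" using disk_cap[OF xc(2), of \<sigma>] cap_in_M[OF xc(2) \<sigma>1] by auto
        then have "?m \<in> M \<inter> U \<inter> {x. norm (flat x) \<le> r / 2}" "x = sphere.cap \<sigma> (flat ?m)" using x xc by auto
        then show "x \<in> (\<lambda>x. sphere.cap \<sigma> (flat x)) ` (M \<inter> U \<inter> {x. norm (flat x) \<le> r / 2})" by blast
      qed
    qed simp
    also have "\<dots> \<le> ennreal (3 ^ d) * hausdorff_outer d (M \<inter> U)"
      by (intro mult_left_mono hausdorff_outer_mono) auto
    finally have "hausdorff_outer d (M \<inter> U) \<noteq> 0" by auto
    then show ?thesis by (simp add: * zero_less_iff_neq_zero)
  qed
qed

end

section \<open>The laws in the model\<close>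

text \<open>
  The orthogonal projection onto \<open>euclid n\<close>. It makes explicit the projections of arbitrary elements of
  the infinite-dimensional ambient type, over which \<^const>\<open>grassmannian_dist\<close> takes its supremum.
\<close>

definition trunc :: "nat \<Rightarrow> fsvec \<Rightarrow> fsvec" where
  "trunc n x = (\<Sum>i<n. coord x i *\<^sub>R unit_fsvec i)"

lemma trunc_in: "trunc n x \<in> euclid n"
  unfolding trunc_def by (intro subspace_sum subspace_scale subspace_euclid) auto

lemma coord_trunc: "coord (trunc n x) i = (if i < n then coord x i else 0)"
  by (auto simp: trunc_def coord_sum scaleR_fsvec.rep_eq unit_fsvec.rep_eq of_bool_def
      if_distrib[of "\<lambda>u. _ * u"] cong: if_cong)

lemma trunc_orthogonal:
  assumes "w \<in> euclid n"
  shows "(x - trunc n x) \<bullet> w = 0"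
  using inner_euclid[OF assms, of "x - trunc n x"]
  by (simp add: inner_commute[of w] minus_fsvec.rep_eq coord_trunc)

lemma orth_proj_hyperplane:
  assumes \<nu>: "norm \<nu> = 1" "\<nu> \<in> euclid n"
  shows "orth_proj {v \<in> euclid n. \<nu> \<bullet> v = 0} x = trunc n x - (\<nu> \<bullet> x) *\<^sub>R \<nu>"
proof -
  let ?T = "{v \<in> euclid n. \<nu> \<bullet> v = 0}"
  let ?y = "trunc n x - (\<nu> \<bullet> x) *\<^sub>R \<nu>"
  have T: "subspace ?T"
    using subspace_euclid[of n] by (auto simp: subspace_def inner_right_distrib)
  have "\<nu> \<bullet> trunc n x = \<nu> \<bullet> x"
    using trunc_orthogonal[OF \<nu>(2), of x] by (simp add: inner_diff_right inner_commute[of _ \<nu>])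
  then have y: "?y \<in> ?T"
    using \<nu> by (auto intro!: subspace_diff subspace_scale subspace_euclid trunc_in
        simp: inner_diff_right inner_unit[OF \<nu>(1)])
  have o: "(x - ?y) \<bullet> w = 0" if "w \<in> ?T" for w
  proof -
    have eq: "x - ?y = (x - trunc n x) + (\<nu> \<bullet> x) *\<^sub>R \<nu>" by simp
    show ?thesis unfolding eq inner_left_distrib using that trunc_orthogonal[of w n x] by simp
  qed
  show ?thesis
    unfolding orth_proj_def
  proof (rule the_equality)
    show "?y \<in> ?T \<and> (\<forall>w\<in>?T. (x - ?y) \<bullet> w = 0)" using y o by blast
    fix y' assume y': "y' \<in> ?T \<and> (\<forall>w\<in>?T. (x - y') \<bullet> w = 0)"
    have d: "y' - ?y \<in> ?T" by (rule subspace_diff[OF T _ y]) (use y' in simp)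
    have "(y' - ?y) \<bullet> (y' - ?y) = (x - ?y) \<bullet> (y' - ?y) - (x - y') \<bullet> (y' - ?y)"
      by (simp add: inner_diff_left)
    then have "(y' - ?y) \<bullet> (y' - ?y) = 0" using o[OF d] y' d by auto
    then show "y' = ?y" by (simp only: inner_eq_zero_iff right_minus_eq)
  qed
qed

text \<open>
  Both projections subtract from the projection onto \<open>\<real>\<^sup>n\<close> the component along the unit normal, so only
  the normals remain in the difference.
\<close>

lemma grassmannian_dist_hyperplanes:
  assumes "norm \<mu> = 1" "\<mu> \<in> euclid n" "norm \<nu> = 1" "\<nu> \<in> euclid n"
  shows "grassmannian_dist {v \<in> euclid n. \<mu> \<bullet> v = 0} {v \<in> euclid n. \<nu> \<bullet> v = 0} \<le> 2 * norm (\<mu> - \<nu>)"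
  unfolding grassmannian_dist_def
proof (rule onorm_bound)
  fix x
  have "norm ((\<nu> \<bullet> x) *\<^sub>R \<nu> - (\<mu> \<bullet> x) *\<^sub>R \<mu>) = norm (((\<nu> - \<mu>) \<bullet> x) *\<^sub>R \<nu> + (\<mu> \<bullet> x) *\<^sub>R (\<nu> - \<mu>))"
    by (simp add: inner_diff_left algebra_simps)
  also have "\<dots> \<le> \<bar>(\<nu> - \<mu>) \<bullet> x\<bar> + \<bar>\<mu> \<bullet> x\<bar> * norm (\<nu> - \<mu>)"
    using norm_triangle_ineq[of "((\<nu> - \<mu>) \<bullet> x) *\<^sub>R \<nu>" "(\<mu> \<bullet> x) *\<^sub>R (\<nu> - \<mu>)"] assms by simp
  also have "\<dots> \<le> norm (\<nu> - \<mu>) * norm x + (1 * norm x) * norm (\<nu> - \<mu>)"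
    using Cauchy_Schwarz_ineq2[of "\<nu> - \<mu>" x] Cauchy_Schwarz_ineq2[of \<mu> x] assms
    by (intro add_mono mult_right_mono) auto
  finally show "norm (orth_proj {v \<in> euclid n. \<mu> \<bullet> v = 0} x - orth_proj {v \<in> euclid n. \<nu> \<bullet> v = 0} x)
      \<le> 2 * norm (\<mu> - \<nu>) * norm x"
    using assms by (simp add: orth_proj_hyperplane norm_minus_commute mult_ac)
qed simp

context measured_revolution
begin

abbreviation "E \<equiv> euclid D"

lemma M_E: "M \<subseteq> E" using M_W W_sub by blast

lemma M_nonempty: "M \<noteq> {}"
  using cap_in_M[of 0 1] equator_in_disk[of 0 r] r by auto

definition V :: real where "V = measure H M"

lemma emeasure_V: "emeasure H M = ennreal V" and V_pos: "0 < V"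
proof -
  have fin: "emeasure H M \<noteq> \<infinity>" using emeasure_M_le by (auto simp: top_unique)
  then show *: "emeasure H M = ennreal V" unfolding V_def by (simp add: emeasure_eq_ennreal_measure)
  obtain p where "p \<in> M" using M_nonempty by blast
  then have "0 < emeasure H M" using emeasure_M_open[of UNIV p] by simp
  then show "0 < V" by (simp add: *)
qed

definition Q :: "fsvec measure" where
  "Q = density (restrict_space H E) (\<lambda>x. ennreal (1 / V) * indicator M x)"

lemma space_Q [simp]: "space Q = E"
  by (simp add: Q_def space_restrict_space)

lemma sets_Q: "sets Q = sets (restrict_space borel E)"
  unfolding Q_def by (simp add: sets_restrict_space)

lemma borel_E [measurable]: "E \<in> sets borel"
  using closed_euclid by simp

lemma nn_integral_Q:
  assumes f: "f \<in> borel_measurable borel"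
  shows "(\<integral>\<^sup>+x. f x \<partial>Q) = (\<integral>\<^sup>+x. ennreal (1 / V) * (f x * indicator M x) \<partial>H)"
proof -
  have m: "g \<in> borel_measurable (restrict_space H E)" if "g \<in> borel_measurable borel" for g :: "fsvec \<Rightarrow> ennreal"
    using that by (intro measurable_restrict_space1) (simp add: measurable_cong_sets[OF sets_hausdorff refl])
  have "(\<integral>\<^sup>+x. f x \<partial>Q) = (\<integral>\<^sup>+x. ennreal (1 / V) * indicator M x * f x \<partial>restrict_space H E)"
    unfolding Q_def by (rule nn_integral_density) (auto intro!: m f)
  also have "\<dots> = (\<integral>\<^sup>+x. ennreal (1 / V) * indicator M x * f x * indicator E x \<partial>H)"
    by (rule nn_integral_restrict_space) simp
  also have "\<dots> = (\<integral>\<^sup>+x. ennreal (1 / V) * (f x * indicator M x) \<partial>H)"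
    using M_E by (intro nn_integral_cong) (auto simp: indicator_def ac_simps)
  finally show ?thesis .
qed

lemma emeasure_Q:
  assumes A: "A \<in> sets borel"
  shows "emeasure Q (A \<inter> E) = ennreal (1 / V) * emeasure H (M \<inter> A)"
proof -
  have "A \<inter> E \<in> sets Q" using A by (auto simp: sets_Q sets_restrict_space)
  then have "emeasure Q (A \<inter> E) = (\<integral>\<^sup>+x. indicator (A \<inter> E) x \<partial>Q)" by simp
  also have "\<dots> = (\<integral>\<^sup>+x. ennreal (1 / V) * (indicator (A \<inter> E) x * indicator M x) \<partial>H)"
    using A by (intro nn_integral_Q) auto
  also have "\<dots> = (\<integral>\<^sup>+x. ennreal (1 / V) * indicator (M \<inter> A) x \<partial>H)"
    using M_E by (intro nn_integral_cong) (auto simp: indicator_def)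
  also have "\<dots> = ennreal (1 / V) * emeasure H (M \<inter> A)"
    using A by (intro nn_integral_cmult_indicator) auto
  finally show ?thesis .
qed

lemma inverse_V: "ennreal (1 / V) * ennreal V = 1"
  using V_pos by (simp add: ennreal_mult'[symmetric])

lemma prob_Q: "prob_space Q"
proof
  show "emeasure Q (space Q) = 1"
    using emeasure_Q[of UNIV] by (simp add: emeasure_V inverse_V)
qed

lemma support_Q: "measure_support Q = M"
proof
  show "measure_support Q \<subseteq> M"
  proof
    fix x assume x: "x \<in> measure_support Q"
    show "x \<in> M"
    proof (rule ccontr)
      assume "x \<notin> M"
      moreover have "open (- M)" using closed_M by auto
      ultimately have "0 < emeasure Q (- M \<inter> E)" using x by (auto simp: measure_support_def)
      moreover have "emeasure Q (- M \<inter> E) = 0" using emeasure_Q[of "- M"] by simp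
      ultimately show False by simp
    qed
  qed
  show "M \<subseteq> measure_support Q"
  proof
    fix x assume x: "x \<in> M"
    have "0 < emeasure Q (U \<inter> E)" if "open U" "x \<in> U" for U
    proof -
      have "0 < emeasure H (M \<inter> U)" using emeasure_M_open[of U x] that x by auto
      then show ?thesis
        using that V_pos by (simp add: emeasure_Q ennreal_zero_less_mult_iff)
    qed
    then show "x \<in> measure_support Q" using x M_E by (auto simp: measure_support_def)
  qed
qed

lemma Q_point_law:
  assumes "t \<le> r * (1 - \<kappa>) / (1 + 3 * \<kappa>)" "2 / r\<^sup>2 \<le> L" "fmin \<le> 1 / V"
  shows "Q \<in> point_laws E d t L fmin"
proof -
  have "Q = density (restrict_space H E) (\<lambda>x. ennreal (1 / V) * indicator (measure_support Q) x)"
    unfolding support_Q by (rule Q_def)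
  moreover have "measure_support Q \<in> manifold_class E d t L"
    unfolding support_Q by (rule manifold_class_M[OF assms(1,2)])
  ultimately show ?thesis
    unfolding point_laws_def using prob_Q sets_Q assms(3)
    by (intro CollectI conjI exI[of _ "\<lambda>_. 1 / V"]) auto
qed

definition unit_nrm :: "fsvec \<Rightarrow> fsvec" where "unit_nrm x = nrm x /\<^sub>R norm (nrm x)"

lemma unit_nrm: "x \<in> M \<Longrightarrow> norm (unit_nrm x) = 1" "x \<in> M \<Longrightarrow> unit_nrm x \<in> W"
  "x \<in> M \<Longrightarrow> tangent_space M x = {v \<in> W. unit_nrm x \<bullet> v = 0}"
proof -
  assume x: "x \<in> M"
  have n: "0 < norm (nrm x)" by (rule nrm_pos[OF x])
  show "norm (unit_nrm x) = 1" using n by (simp add: unit_nrm_def)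
  show "unit_nrm x \<in> W" unfolding unit_nrm_def using x M_W by (intro subspace_scale subspace_euclid nrm_W) auto
  show "tangent_space M x = {v \<in> W. unit_nrm x \<bullet> v = 0}"
    unfolding tangent_space_M[OF x] unit_nrm_def using n by auto
qed

lemma continuous_on_unit_nrm: "continuous_on M unit_nrm"
  unfolding unit_nrm_def using nrm_pos
  by (intro continuous_intros continuous_on_nrm) force

lemma tangent_grassmannian:
  assumes "x \<in> M"
  shows "tangent_space M x \<in> grassmannian E d"
proof -
  have "subspace (tangent_space M x)"
    unfolding unit_nrm(3)[OF assms] using subspace_euclid[of "Suc d"]
    by (auto simp: subspace_def inner_right_distrib)
  moreover have "dim (tangent_space M x) = d"
    unfolding unit_nrm(3)[OF assms]
    using dim_hyperplane_section[OF unit_nrm(1,2)[OF assms]] by (simp add: inner_commute)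
  moreover have "tangent_space M x \<subseteq> E"
    using W_sub by (auto simp: tangent_space_M[OF assms])
  ultimately show ?thesis by (simp add: grassmannian_def)
qed

text \<open>
  The tangent space depends continuously on the unit normal, which depends continuously on the point.
\<close>

lemma measurable_tangent: "tangent_space M \<in> restrict_space borel M \<rightarrow>\<^sub>M grassmannian_borel E d"
  unfolding grassmannian_borel_def
proof (rule measurable_measure_of)
  show "tangent_space M \<in> space (restrict_space borel M) \<rightarrow> grassmannian E d"
    using tangent_grassmannian by (auto simp: space_restrict_space)
next
  fix \<U> assume "\<U> \<in> {\<U>. \<U> \<subseteq> grassmannian E d \<and>
    (\<forall>T\<in>\<U>. \<exists>\<epsilon>>0. \<forall>T'\<in>grassmannian E d. grassmannian_dist T T' < \<epsilon> \<longrightarrow> T' \<in> \<U>)}"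
  then have \<U>: "\<And>T. T \<in> \<U> \<Longrightarrow> \<exists>\<epsilon>>0. \<forall>T'\<in>grassmannian E d. grassmannian_dist T T' < \<epsilon> \<longrightarrow> T' \<in> \<U>"
    by blast
  let ?T = "tangent_space M -` \<U> \<inter> M"
  have "openin (top_of_set M) (?T)"
    unfolding openin_euclidean_subtopology_iff
  proof (intro conjI ballI)
    fix x assume x: "x \<in> ?T"
    then obtain \<epsilon> where \<epsilon>: "\<epsilon> > 0"
      "\<And>T'. T' \<in> grassmannian E d \<Longrightarrow> grassmannian_dist (tangent_space M x) T' < \<epsilon> \<Longrightarrow> T' \<in> \<U>"
      using \<U> by blast
    have "0 < \<epsilon> / 2" using \<epsilon>(1) by simp
    then obtain \<delta> where \<delta>: "\<delta> > 0" "\<And>y. y \<in> M \<Longrightarrow> dist y x < \<delta> \<Longrightarrow> dist (unit_nrm y) (unit_nrm x) < \<epsilon> / 2"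
      using continuous_on_unit_nrm x unfolding continuous_on_iff by blast
    have "y \<in> ?T" if y: "y \<in> M" "dist y x < \<delta>" for y
    proof -
      have xM: "x \<in> M" using x by simp
      have "grassmannian_dist (tangent_space M x) (tangent_space M y) \<le> 2 * norm (unit_nrm x - unit_nrm y)"
        unfolding unit_nrm(3)[OF xM] unit_nrm(3)[OF y(1)]
        by (intro grassmannian_dist_hyperplanes unit_nrm xM y(1))
      also have "\<dots> < \<epsilon>" using \<delta>(2)[OF y] by (simp add: dist_norm norm_minus_commute)
      finally show ?thesis using \<epsilon>(2) tangent_grassmannian y(1) by simp
    qed
    then show "\<exists>e>0. \<forall>x'\<in>M. dist x' x < e \<longrightarrow> x' \<in> ?T"
      using \<delta>(1) by blast
  qed auto
  then obtain O' where "open O'" "?T = M \<inter> O'"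
    by (auto simp: openin_open)
  then show "tangent_space M -` \<U> \<inter> space (restrict_space borel M) \<in> sets (restrict_space borel M)"
    by (auto simp: space_restrict_space sets_restrict_space)
qed auto

lemma sets_restrict_Q: "sets (restrict_space Q M) = sets (restrict_space borel M)"
proof -
  have "E \<inter> M = M" using M_E by blast
  then show ?thesis
    using sets_restrict_space_cong[OF sets_Q, of M] sets_restrict_restrict_space[of borel E M] by simp
qed

lemma measurable_sample [measurable]:
  "(\<lambda>x. (x, tangent_space M x)) \<in> restrict_space borel M \<rightarrow>\<^sub>M obs_space E d"
  unfolding obs_space_def
proof (rule measurable_Pair)
  show "(\<lambda>x. x) \<in> restrict_space borel M \<rightarrow>\<^sub>M restrict_space borel E"
    using M_E by (intro measurable_restrict_space2 measurable_restrict_space1) (auto simp: space_restrict_space)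
qed (rule measurable_tangent)

definition P :: "(fsvec \<times> fsvec set) measure" where "P = tangent_law E d Q"

lemma P_eq: "P = distr (restrict_space Q M) (obs_space E d) (\<lambda>x. (x, tangent_space M x))"
  by (simp add: P_def tangent_law_def support_Q)

lemma sets_P [measurable_cong]: "sets P = sets (obs_space E d)"
  by (simp add: P_eq)

lemma measurable_sample_Q:
  "(\<lambda>x. (x, tangent_space M x)) \<in> restrict_space Q M \<rightarrow>\<^sub>M obs_space E d"
  using measurable_sample by (simp add: measurable_cong_sets[OF sets_restrict_Q refl])

lemma M_in_Q: "M \<inter> space Q \<in> sets Q"
  using M_E by (auto simp: sets_Q sets_restrict_space intro!: image_eqI[of _ _ M])

lemma nn_integral_P:
  assumes F: "F \<in> borel_measurable (obs_space E d)"
  shows "(\<integral>\<^sup>+z. F z \<partial>P) = (\<integral>\<^sup>+x. ennreal (1 / V) * (F (x, tangent_space M x) * indicator M x) \<partial>H)"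
proof -
  have FM: "(\<lambda>x. F (x, tangent_space M x)) \<in> borel_measurable (restrict_space borel M)"
    using measurable_compose[OF measurable_sample F] .
  then have g: "(\<lambda>x. F (x, tangent_space M x) * indicator M x) \<in> borel_measurable borel"
    by (subst (asm) borel_measurable_restrict_space_iff_ennreal) auto
  have "(\<integral>\<^sup>+z. F z \<partial>P) = (\<integral>\<^sup>+x. F (x, tangent_space M x) \<partial>restrict_space Q M)"
    unfolding P_eq by (rule nn_integral_distr[OF measurable_sample_Q]) (simp add: F)
  also have "\<dots> = (\<integral>\<^sup>+x. F (x, tangent_space M x) * indicator M x \<partial>Q)"
    by (rule nn_integral_restrict_space[OF M_in_Q])
  also have "\<dots> = (\<integral>\<^sup>+x. ennreal (1 / V) * (F (x, tangent_space M x) * indicator M x * indicator M x) \<partial>H)"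
    by (rule nn_integral_Q[OF g])
  also have "\<dots> = (\<integral>\<^sup>+x. ennreal (1 / V) * (F (x, tangent_space M x) * indicator M x) \<partial>H)"
    by (intro nn_integral_cong) (auto simp: indicator_def)
  finally show ?thesis .
qed

lemma prob_P: "prob_space P"
proof
  have "emeasure P (space P) = (\<integral>\<^sup>+z. 1 \<partial>P)" by simp
  also have "\<dots> = (\<integral>\<^sup>+x. ennreal (1 / V) * (1 * indicator M x) \<partial>H)"
    by (rule nn_integral_P) simp
  also have "\<dots> = ennreal (1 / V) * emeasure H M"
    by (simp add: nn_integral_cmult_indicator)
  finally show "emeasure P (space P) = 1" by (simp add: emeasure_V inverse_V)
qed

lemma law_reach_P: "law_reach E P = reach E M"
proof -
  have "distr P (restrict_space borel E) fst = Q"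
  proof (rule measure_eqI)
    show "sets (distr P (restrict_space borel E) fst) = sets Q" by (simp add: sets_Q)
    fix A assume "A \<in> sets (distr P (restrict_space borel E) fst)"
    then have A: "A \<in> sets (restrict_space borel E)" by simp
    have fst: "fst \<in> obs_space E d \<rightarrow>\<^sub>M restrict_space borel E" by (simp add: obs_space_def)
    have id: "(\<lambda>x. x) \<in> restrict_space Q M \<rightarrow>\<^sub>M restrict_space borel E"
      using measurable_compose[OF measurable_sample_Q fst] by simp
    have "distr P (restrict_space borel E) fst = distr (restrict_space Q M) (restrict_space borel E) (\<lambda>x. x)"
      unfolding P_eq by (subst distr_distr[OF fst measurable_sample_Q]) (simp add: comp_def)
    then have "emeasure (distr P (restrict_space borel E) fst) A = emeasure (restrict_space Q M) (A \<inter> M)"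
      using A by (simp add: emeasure_distr[OF id] space_restrict_space Int_absorb2[OF M_E])
    also have "\<dots> = emeasure Q (A \<inter> M)"
      by (rule emeasure_restrict_space[OF M_in_Q]) auto
    also have "\<dots> = emeasure Q A"
    proof -
      obtain B where B: "B \<in> sets borel" "A = B \<inter> E" using A by (auto simp: sets_restrict_space)
      then have "A \<inter> M = (B \<inter> M) \<inter> E" using M_E by blast
      then show ?thesis
        using emeasure_Q[of "B \<inter> M"] emeasure_Q[of B] B by (simp add: Int_commute Int_left_commute)
    qed
    finally show "emeasure (distr P (restrict_space borel E) fst) A = emeasure Q A" .
  qed
  then show ?thesis by (simp add: law_reach_def support_Q)
qed

text \<open>
  Away from the bump, the law does not depend on the perturbation except through the normalising
  constant.
\<close>

definition off_bump :: "(fsvec \<times> fsvec set) set" where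
  "off_bump = {z \<in> space (obs_space E d). s < Y (fst z)}"

lemma off_bump_measurable [measurable]: "off_bump \<in> sets (obs_space E d)"
proof -
  have "(\<lambda>z. Y (fst z)) \<in> borel_measurable (obs_space E d)"
    unfolding obs_space_def
    by (intro measurable_compose[OF measurable_fst] measurable_restrict_space1) simp
  then show ?thesis unfolding off_bump_def by measurable
qed

lemma nn_integral_off_bump:
  assumes F: "F \<in> borel_measurable (obs_space E d)"
  shows "(\<integral>\<^sup>+z. F z * indicator off_bump z \<partial>P) = ennreal (1 / V) *
    (\<integral>\<^sup>+x. F (x, {v \<in> W. x \<bullet> v = 0}) * indicator (sph d r \<inter> {x. s < Y x}) x \<partial>H)"
proof -
  let ?G = "\<lambda>x. F (x, tangent_space M x) * indicator off_bump (x, tangent_space M x) * indicator M x"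
  let ?K = "\<lambda>x. F (x, {v \<in> W. x \<bullet> v = 0}) * indicator (sph d r \<inter> {x. s < Y x}) x"
  have g: "(\<lambda>z. F z * indicator off_bump z) \<in> borel_measurable (obs_space E d)"
    using F by measurable
  have FM: "(\<lambda>x. ?G x) \<in> borel_measurable borel"
    using measurable_compose[OF measurable_sample g]
    by (subst (asm) borel_measurable_restrict_space_iff_ennreal) auto
  have "(\<integral>\<^sup>+z. F z * indicator off_bump z \<partial>P) = (\<integral>\<^sup>+x. ennreal (1 / V) *
      (?G x) \<partial>H)"
    by (rule nn_integral_P[OF g])
  also have "\<dots> = ennreal (1 / V) *
      (\<integral>\<^sup>+x. ?G x \<partial>H)"
    using FM by (intro nn_integral_cmult) (simp add: measurable_cong_sets[OF sets_hausdorff refl])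
  also have "(\<integral>\<^sup>+x. ?G x \<partial>H) =
      (\<integral>\<^sup>+x. ?K x \<partial>H)"
  proof (intro nn_integral_cong)
    fix x
    show "?G x =
      ?K x"
    proof (cases "x \<in> M \<and> s < Y x")
      case True
      then have "nrm x = x" using \<beta>1_zero[of "Y x"] by (simp add: nrm_def)
      then have "tangent_space M x = {v \<in> W. x \<bullet> v = 0}" using True tangent_space_M by simp
      moreover have "(x, tangent_space M x) \<in> off_bump"
        using True measurable_space[OF measurable_sample, of x] by (auto simp: off_bump_def space_restrict_space)
      moreover have "x \<in> sph d r \<inter> {x. s < Y x}" using True M_outer_part by blast
      ultimately show ?thesis using True by simp
    next
      case False
      then have "x \<notin> sph d r \<inter> {x. s < Y x}" using M_outer_part by blast
      moreover have "x \<notin> M \<or> (x, tangent_space M x) \<notin> off_bump" using False by (auto simp: off_bump_def)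
      ultimately show ?thesis by auto
    qed
  qed
  finally show ?thesis .
qed

lemma V_le: "V \<le> (r ^ d + 2 * (3 * sqrt s) ^ d) * sphere_vol d"
  using emeasure_M_le vol_pos r s by (simp add: emeasure_V ennreal_le_iff)

end

section \<open>The bump\<close>

lemma has_real_derivative_max_power:
  fixes w :: real
  shows "((\<lambda>w. max 0 w ^ Suc (Suc m)) has_real_derivative real (Suc (Suc m)) * max 0 w ^ Suc m) (at w)"
proof -
  consider "w < 0" | "0 < w" | "w = 0" by linarith
  then show ?thesis
  proof cases
    case 1
    have "((\<lambda>w. max 0 w ^ Suc (Suc m)) has_real_derivative 0) (at w)"
      by (rule has_field_derivative_transform_within_open[OF DERIV_const[of 0], of "{..<0}"])
        (use 1 in \<open>auto simp: max_def\<close>)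
    then show ?thesis using 1 by (simp add: max_def)
  next
    case 2
    have "((\<lambda>w. w ^ Suc (Suc m)) has_real_derivative real (Suc (Suc m)) * w ^ Suc m) (at w)"
      using DERIV_pow[of "Suc (Suc m)" w] by simp
    then have "((\<lambda>w. max 0 w ^ Suc (Suc m)) has_real_derivative real (Suc (Suc m)) * w ^ Suc m) (at w)"
      by (rule has_field_derivative_transform_within_open[of _ _ _ "{0<..}"])
        (use 2 in \<open>auto simp: max_def\<close>)
    then show ?thesis using 2 by (simp add: max_def)
  next
    case 3
    have "((\<lambda>h::real. max 0 h ^ Suc (Suc m) / h) \<longlongrightarrow> 0) (at 0)"
    proof (rule Lim_null_comparison)
      show "\<forall>\<^sub>F h in at 0. norm (max 0 h ^ Suc (Suc m) / h) \<le> \<bar>h\<bar> ^ Suc m"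
      proof (rule always_eventually, rule allI)
        fix h :: real
        show "norm (max 0 h ^ Suc (Suc m) / h) \<le> \<bar>h\<bar> ^ Suc m"
        proof (cases "0 < h")
          case False
          then have eq: "max 0 h = 0" by simp
          show ?thesis unfolding eq by simp
        qed (simp add: max_def)
      qed
      show "((\<lambda>h::real. \<bar>h\<bar> ^ Suc m) \<longlongrightarrow> 0) (at 0)"
        using tendsto_power[OF tendsto_rabs[OF tendsto_ident_at[of "0::real" UNIV]], of "Suc m"] by simp
    qed
    then show ?thesis using 3 by (simp add: DERIV_def)
  qed
qed

definition ramp :: "real \<Rightarrow> real \<Rightarrow> nat \<Rightarrow> real \<Rightarrow> real" where
  "ramp c s k u = c * max 0 (1 - u / s) ^ k"

lemma deriv_ramp:
  assumes "s \<noteq> 0"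
  shows "(ramp c s (Suc (Suc m)) has_real_derivative ramp (- (real (Suc (Suc m)) * c / s)) s (Suc m) u) (at u)"
proof -
  have "((\<lambda>u. 1 - u / s) has_real_derivative - (1 / s)) (at u)"
    using assms by (auto intro!: derivative_eq_intros)
  from DERIV_cmult[OF DERIV_chain2[OF has_real_derivative_max_power this], of c]
  show ?thesis unfolding ramp_def by (rule DERIV_cong) simp
qed

lemma ramp_bound:
  assumes "0 < s" "0 \<le> u" "0 < k" "0 \<le> g" "\<bar>c\<bar> * G \<le> b" "0 \<le> G" "u \<le> s \<Longrightarrow> g \<le> G"
  shows "\<bar>ramp c s k u\<bar> * g \<le> b"
proof (cases "u \<le> s")
  case True
  then have "0 \<le> max 0 (1 - u / s)" "max 0 (1 - u / s) \<le> 1" using assms by auto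
  then have "\<bar>max 0 (1 - u / s) ^ k\<bar> \<le> 1" by (simp add: power_le_one)
  then have "\<bar>ramp c s k u\<bar> \<le> \<bar>c\<bar> * 1"
    unfolding ramp_def abs_mult by (intro mult_left_mono) auto
  then have "\<bar>ramp c s k u\<bar> * g \<le> \<bar>c\<bar> * G"
    using assms True by (intro mult_mono) auto
  then show ?thesis using assms by linarith
next
  case False
  then have "1 < u / s" using assms by simp
  then have "max 0 (1 - u / s) = 0" by simp
  then have "ramp c s k u = 0" using assms(3) by (simp add: ramp_def)
  moreover have "0 \<le> b" using assms(5,6) by (smt (verit) mult_nonneg_nonneg abs_ge_zero)
  ultimately show ?thesis by simp
qed

lemma ramp_zero: "0 < s \<Longrightarrow> s \<le> u \<Longrightarrow> 0 < k \<Longrightarrow> ramp c s k u = 0"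
  by (simp add: ramp_def max_def field_simps)

lemma sphere_revolution:
  assumes "1 \<le> d" "d < D" "0 < r" "0 < \<delta>" "\<delta> \<le> 1 / 4"
  shows "revolution d D r ((\<delta> * r)\<^sup>2) 0 (\<lambda>_. 0) (\<lambda>_. 0) (\<lambda>_. 0) (\<lambda>_. 0)"
proof -
  have "(\<delta> * r)\<^sup>2 \<le> (1 / 4 * r)\<^sup>2" using assms by (intro power_mono mult_right_mono) auto
  then show ?thesis using assms by unfold_locales (auto simp: power_mult_distrib power_divide)
qed

text \<open>
  The height of the bump is of the order of the cube of its width, which keeps its third derivatives
  bounded; its curvature is then of the order of its width. The constant \<open>2400\<close> makes the largest of the
  factors that occur, the \<open>24\<close> of the third derivative, equal to \<open>\<kappa> = 1 / 100\<close>.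
\<close>

lemma bump_revolution:
  fixes r \<delta> :: real
  assumes "1 \<le> d" "d < D" and r: "0 < r" and \<delta>: "0 < \<delta>" "\<delta> \<le> 1 / 4"
  defines "s \<equiv> (\<delta> * r)\<^sup>2" and "c \<equiv> \<delta> ^ 3 * r\<^sup>2 / 2400"
  shows "revolution d D r s (1 / 100) (ramp c s 4) (ramp (- (4 * c / s)) s 3)
     (ramp (12 * c / s\<^sup>2) s 2) (ramp (- (24 * c / s ^ 3)) s 1)"
proof -
  have s0: "0 < s" using r \<delta> by (simp add: s_def)
  have c0: "0 < c" using r \<delta> by (simp add: c_def)
  have sq: "sqrt s = \<delta> * r" using r \<delta> by (simp add: s_def)
  have cs: "c / s = \<delta> / 2400" using r \<delta> by (simp add: c_def s_def field_simps eval_nat_numeral)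
  have cs2: "c / s\<^sup>2 * sqrt s = 1 / (2400 * r)"
    unfolding sq unfolding c_def s_def using r \<delta> by (simp add: field_simps eval_nat_numeral)
  have "(\<delta> * r)\<^sup>2 \<le> (1 / 4 * r)\<^sup>2" using r \<delta> by (intro power_mono mult_right_mono) auto
  then have s16: "16 * s \<le> r\<^sup>2" by (simp add: s_def power_mult_distrib power_divide)
  show ?thesis
  proof
    show "(ramp c s 4 has_real_derivative ramp (- (4 * c / s)) s 3 u) (at u)" for u
      using deriv_ramp[of s c 2 u] s0 by (simp add: eval_nat_numeral)
    show "(ramp (- (4 * c / s)) s 3 has_real_derivative ramp (12 * c / s\<^sup>2) s 2 u) (at u)" for u
      using deriv_ramp[of s "- (4 * c / s)" 1 u] s0 by (simp add: eval_nat_numeral)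
    show "(ramp (12 * c / s\<^sup>2) s 2 has_real_derivative ramp (- (24 * c / s ^ 3)) s 1 u) (at u)" for u
      using deriv_ramp[of s "12 * c / s\<^sup>2" 0 u] s0 by (simp add: eval_nat_numeral mult.assoc)
    show "continuous_on UNIV (ramp (- (24 * c / s ^ 3)) s 1)"
      unfolding ramp_def using s0 by (intro continuous_intros) auto
    show "0 \<le> ramp c s 4 u" for u using c0 by (simp add: ramp_def)
    show "ramp c s 4 u = 0" "ramp (- (4 * c / s)) s 3 u = 0" if "s \<le> u" for u
      using that s0 by (auto intro: ramp_zero)
    fix u :: real assume u: "0 \<le> u"
    have "\<bar>ramp (- (4 * c / s)) s 3 u\<bar> * 1 \<le> 1 / 100"
    proof (rule ramp_bound[OF s0 u, where G = 1])
      have "4 * c / s = 4 * (c / s)" by simp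
      then show "\<bar>- (4 * c / s)\<bar> * 1 \<le> 1 / 100" using \<delta> unfolding cs by simp
    qed auto
    then show "\<bar>ramp (- (4 * c / s)) s 3 u\<bar> \<le> 1 / 100" by simp
    show "\<bar>ramp (12 * c / s\<^sup>2) s 2 u\<bar> * u \<le> 1 / 100"
    proof (rule ramp_bound[OF s0 u, where G = s])
      have "\<bar>12 * c / s\<^sup>2\<bar> * s = 12 * (c / s)" using s0 c0 by (simp add: power2_eq_square)
      then show "\<bar>12 * c / s\<^sup>2\<bar> * s \<le> 1 / 100" using \<delta> unfolding cs by simp
    qed (use s0 u in auto)
    show "\<bar>ramp (12 * c / s\<^sup>2) s 2 u\<bar> * sqrt u \<le> 1 / 100 / r"
    proof (rule ramp_bound[OF s0 u, where G = "sqrt s"])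
      have "\<bar>12 * c / s\<^sup>2\<bar> * sqrt s = 12 * (c / s\<^sup>2 * sqrt s)" using s0 c0 by simp
      also have "\<dots> \<le> 1 / 100 / r" unfolding cs2 using r by (simp add: field_simps)
      finally show "\<bar>12 * c / s\<^sup>2\<bar> * sqrt s \<le> 1 / 100 / r" .
    qed (use s0 u in auto)
    show "\<bar>ramp (- (24 * c / s ^ 3)) s 1 u\<bar> * sqrt u ^ 3 \<le> 1 / 100 / r"
    proof (rule ramp_bound[OF s0 u, where G = "sqrt s ^ 3"])
      have "sqrt s ^ 3 = s * sqrt s" using s0 by (simp add: power3_eq_cube)
      then have "\<bar>- (24 * c / s ^ 3)\<bar> * sqrt s ^ 3 = 24 * (c / s\<^sup>2 * sqrt s)"
        using s0 c0 by (simp add: power3_eq_cube power2_eq_square)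
      also have "\<dots> \<le> 1 / 100 / r" unfolding cs2 using r by (simp add: field_simps)
      finally show "\<bar>- (24 * c / s ^ 3)\<bar> * sqrt s ^ 3 \<le> 1 / 100 / r" .
    qed (use s0 u in \<open>auto intro: power_mono\<close>)
  qed (use assms(1,2) r s0 s16 in auto)
qed

section \<open>Two-point lower bound\<close>

text \<open>
  The domination of one law by the other on \<open>C\<close> passes to products by integrating one coordinate at a
  time.
\<close>

lemma PiM_lower_bound:
  fixes P0 P1 :: "'a measure"
  assumes P0: "prob_space P0" and P1: "prob_space P1" and sets: "sets P1 = sets P0"
    and C: "C \<in> sets P0"
    and le: "\<And>F. F \<in> borel_measurable P0 \<Longrightarrow> l * (\<integral>\<^sup>+z. F z * indicator C z \<partial>P0) \<le> (\<integral>\<^sup>+z. F z \<partial>P1)"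
    and F: "F \<in> borel_measurable (PiM {..<n} (\<lambda>_. P0))"
  shows "l ^ n * (\<integral>\<^sup>+s. F s * (\<Prod>i<n. indicator C (s i)) \<partial>PiM {..<n} (\<lambda>_. P0))
     \<le> (\<integral>\<^sup>+s. F s \<partial>PiM {..<n} (\<lambda>_. P1))"
  using F
proof (induction n arbitrary: F)
  case 0
  interpret A: product_sigma_finite "\<lambda>_::nat. P0" using P0 by (simp add: product_sigma_finite_def prob_space_imp_sigma_finite)
  interpret B: product_sigma_finite "\<lambda>_::nat. P1" using P1 by (simp add: product_sigma_finite_def prob_space_imp_sigma_finite)
  show ?case by (simp add: A.nn_integral_empty B.nn_integral_empty)
next
  case (Suc n)
  interpret P0: prob_space P0 by (rule P0)
  interpret A: product_sigma_finite "\<lambda>_::nat. P0" using P0 by (simp add: product_sigma_finite_def prob_space_imp_sigma_finite)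
  interpret B: product_sigma_finite "\<lambda>_::nat. P1" using P1 by (simp add: product_sigma_finite_def prob_space_imp_sigma_finite)
  have ss: "sets (PiM I (\<lambda>_::nat. P1)) = sets (PiM I (\<lambda>_. P0))" for I
    using sets by (intro sets_PiM_cong) auto
  note [measurable] = C
  let ?N0 = "PiM {..<n} (\<lambda>_. P0)" and ?N1 = "PiM {..<n} (\<lambda>_. P1)" and ?I0 = "PiM (insert n {..<n}) (\<lambda>_. P0)"
  have F [measurable]: "F \<in> borel_measurable (?I0)"
    using Suc.prems by (simp add: lessThan_Suc)
  have F1: "F \<in> borel_measurable (PiM (insert n {..<n}) (\<lambda>_. P1))"
    using F by (simp add: measurable_cong_sets[OF ss refl])
  have upd: "(\<lambda>(x, y). x(n := y)) \<in> ?N0 \<Otimes>\<^sub>M P0 \<rightarrow>\<^sub>M ?I0"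
    by (rule measurable_add_dim)
  define G where "G x = (\<integral>\<^sup>+y. F (x(n := y)) * indicator C y \<partial>P0)" for x
  have Fu: "(\<lambda>(x, y). F (x(n := y))) \<in> borel_measurable (?N0 \<Otimes>\<^sub>M P0)"
    using measurable_compose[OF upd F] by (simp add: split_beta')
  have G: "G \<in> borel_measurable (?N0)"
    unfolding G_def
  proof (rule P0.borel_measurable_nn_integral)
    show "(\<lambda>(x, y). F (x(n := y)) * indicator C y) \<in> borel_measurable (?N0 \<Otimes>\<^sub>M P0)"
      using Fu by (simp add: split_beta')
  qed
  have "l ^ Suc n * (\<integral>\<^sup>+s. F s * (\<Prod>i<Suc n. indicator C (s i)) \<partial>PiM {..<Suc n} (\<lambda>_. P0))
      = l * (l ^ n * (\<integral>\<^sup>+x. G x * (\<Prod>i<n. indicator C (x i)) \<partial>?N0))"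
  proof -
    have "(\<integral>\<^sup>+s. F s * (\<Prod>i<Suc n. indicator C (s i)) \<partial>PiM {..<Suc n} (\<lambda>_. P0)) =
      (\<integral>\<^sup>+x. (\<integral>\<^sup>+y. F (x(n := y)) * (\<Prod>i<Suc n. indicator C ((x(n := y)) i)) \<partial>P0) \<partial>?N0)"
      unfolding lessThan_Suc
    proof (rule A.product_nn_integral_insert)
      show "(\<lambda>x. F x * (\<Prod>i\<in>insert n {..<n}. indicator C (x i))) \<in> borel_measurable (?I0)"
        by measurable
    qed auto
    also have "\<dots> = (\<integral>\<^sup>+x. G x * (\<Prod>i<n. indicator C (x i)) \<partial>?N0)"
    proof (rule nn_integral_cong)
      fix x assume x: "x \<in> space (?N0)"
      have m: "(\<lambda>y. F (x(n := y))) \<in> borel_measurable P0"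
        using measurable_compose[OF measurable_component_update[OF x] F] by simp
      have "(\<Prod>i<Suc n. indicator C ((x(n := y)) i)) = indicator C y * (\<Prod>i<n. indicator C (x i) :: ennreal)" for y
        by (simp add: mult.commute)
      then have "(\<integral>\<^sup>+y. F (x(n := y)) * (\<Prod>i<Suc n. indicator C ((x(n := y)) i)) \<partial>P0) =
          (\<integral>\<^sup>+y. (F (x(n := y)) * indicator C y) * (\<Prod>i<n. indicator C (x i)) \<partial>P0)"
        by (simp only: mult.assoc)
      also have "\<dots> = G x * (\<Prod>i<n. indicator C (x i))"
        unfolding G_def
        by (rule nn_integral_multc) (rule borel_measurable_times_ennreal[OF m borel_measurable_indicator[OF C]])
      finally show "(\<integral>\<^sup>+y. F (x(n := y)) * (\<Prod>i<Suc n. indicator C ((x(n := y)) i)) \<partial>P0) =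
          G x * (\<Prod>i<n. indicator C (x i))" .
    qed
    finally show ?thesis by (simp add: mult.assoc)
  qed
  also have "\<dots> \<le> l * (\<integral>\<^sup>+x. G x \<partial>?N1)"
    by (intro mult_left_mono Suc.IH G) auto
  also have "\<dots> = (\<integral>\<^sup>+x. l * G x \<partial>?N1)"
    using G by (intro nn_integral_cmult[symmetric]) (simp add: measurable_cong_sets[OF ss refl])
  also have "\<dots> \<le> (\<integral>\<^sup>+x. (\<integral>\<^sup>+y. F (x(n := y)) \<partial>P1) \<partial>?N1)"
  proof (rule nn_integral_mono)
    fix x assume "x \<in> space (?N1)"
    then have x: "x \<in> space (?N0)" using sets_eq_imp_space_eq[OF ss] by simp
    have m: "(\<lambda>y. F (x(n := y))) \<in> borel_measurable P0"
      using measurable_compose[OF measurable_component_update[OF x] F] by simp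
    show "l * G x \<le> (\<integral>\<^sup>+y. F (x(n := y)) \<partial>P1)"
      unfolding G_def by (rule le[OF m])
  qed
  also have "\<dots> = (\<integral>\<^sup>+s. F s \<partial>PiM {..<Suc n} (\<lambda>_. P1))"
    unfolding lessThan_Suc by (rule B.product_nn_integral_insert[symmetric]) (auto intro: F1)
  finally show ?case .
qed

text \<open>
  On samples that lie entirely in \<open>C\<close> both errors can be integrated against the same law, and for each
  sample one of them is at least \<open>\<Delta>\<close>.
\<close>

lemma two_point_bound:
  fixes P0 P1 :: "'a measure" and t :: "(nat \<Rightarrow> 'a) \<Rightarrow> real"
  assumes P0: "prob_space P0" and P1: "prob_space P1" and sets: "sets P1 = sets P0"
    and C: "C \<in> sets P0" and l: "l \<le> 1"
    and le: "\<And>F. F \<in> borel_measurable P0 \<Longrightarrow> l * (\<integral>\<^sup>+z. F z * indicator C z \<partial>P0) \<le> (\<integral>\<^sup>+z. F z \<partial>P1)"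
    and t: "t \<in> borel_measurable (PiM {..<n} (\<lambda>_. P0))" and p: "0 \<le> p"
    and \<Delta>: "0 \<le> \<Delta>" "2 * \<Delta> \<le> \<theta>1 - \<theta>0"
  shows "(l * emeasure P0 C) ^ n * ennreal (\<Delta> powr p) \<le>
    (\<integral>\<^sup>+s. ennreal (\<bar>\<theta>0 - t s\<bar> powr p) \<partial>PiM {..<n} (\<lambda>_. P0)) +
    (\<integral>\<^sup>+s. ennreal (\<bar>\<theta>1 - t s\<bar> powr p) \<partial>PiM {..<n} (\<lambda>_. P1))"
proof -
  interpret P0: prob_space P0 by (rule P0)
  interpret A: product_sigma_finite "\<lambda>_::nat. P0" using P0 by (simp add: product_sigma_finite_def prob_space_imp_sigma_finite)
  note [measurable] = C t
  let ?N = "PiM {..<n} (\<lambda>_. P0)"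
  define I where "I s = (\<Prod>i<n. indicator C (s i) :: ennreal)" for s :: "nat \<Rightarrow> 'a"
  have [measurable]: "I \<in> borel_measurable ?N" unfolding I_def by measurable
  have I1: "I s \<le> 1" for s unfolding I_def by (intro prod_le_1) (auto simp: indicator_def)
  define f where "f \<theta> s = ennreal (\<bar>\<theta> - t s\<bar> powr p)" for \<theta> s
  have f [measurable]: "f \<theta> \<in> borel_measurable ?N" for \<theta> unfolding f_def by measurable
  have pw: "ennreal (\<Delta> powr p) \<le> f \<theta>0 s + f \<theta>1 s" for s
  proof -
    have "\<Delta> \<le> \<bar>\<theta>0 - t s\<bar> \<or> \<Delta> \<le> \<bar>\<theta>1 - t s\<bar>" using \<Delta> by linarith
    then show ?thesis
    proof
      assume "\<Delta> \<le> \<bar>\<theta>0 - t s\<bar>"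
      then have "ennreal (\<Delta> powr p) \<le> f \<theta>0 s"
        unfolding f_def using \<Delta> p by (intro ennreal_leI powr_mono2) auto
      then show ?thesis by (rule order_trans) simp
    next
      assume "\<Delta> \<le> \<bar>\<theta>1 - t s\<bar>"
      then have "ennreal (\<Delta> powr p) \<le> f \<theta>1 s"
        unfolding f_def using \<Delta> p by (intro ennreal_leI powr_mono2) auto
      then show ?thesis by (rule order_trans) simp
    qed
  qed
  have "(\<integral>\<^sup>+s. I s \<partial>?N) = (\<Prod>i<n. \<integral>\<^sup>+x. indicator C x \<partial>P0)"
    unfolding I_def by (rule A.product_nn_integral_prod) auto
  then have "(l * emeasure P0 C) ^ n * ennreal (\<Delta> powr p) = l ^ n * (ennreal (\<Delta> powr p) * (\<integral>\<^sup>+s. I s \<partial>?N))"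
    by (simp add: power_mult_distrib mult_ac)
  also have "\<dots> = l ^ n * (\<integral>\<^sup>+s. ennreal (\<Delta> powr p) * I s \<partial>?N)"
    by (subst nn_integral_cmult) auto
  also have "\<dots> \<le> l ^ n * (\<integral>\<^sup>+s. f \<theta>0 s * I s + f \<theta>1 s * I s \<partial>?N)"
    using pw by (intro mult_left_mono nn_integral_mono) (auto simp: distrib_right[symmetric] intro: mult_right_mono)
  also have "\<dots> = l ^ n * (\<integral>\<^sup>+s. f \<theta>0 s * I s \<partial>?N) + l ^ n * (\<integral>\<^sup>+s. f \<theta>1 s * I s \<partial>?N)"
    by (subst nn_integral_add) (auto simp: distrib_left)
  also have "\<dots> \<le> (\<integral>\<^sup>+s. f \<theta>0 s \<partial>?N) + (\<integral>\<^sup>+s. f \<theta>1 s \<partial>PiM {..<n} (\<lambda>_. P1))"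
  proof (rule add_mono)
    have "l ^ n * (\<integral>\<^sup>+s. f \<theta>0 s * I s \<partial>?N) \<le> 1 * (\<integral>\<^sup>+s. f \<theta>0 s * 1 \<partial>?N)"
      using I1 l by (intro mult_mono nn_integral_mono mult_left_mono power_le_one) auto
    then show "l ^ n * (\<integral>\<^sup>+s. f \<theta>0 s * I s \<partial>?N) \<le> (\<integral>\<^sup>+s. f \<theta>0 s \<partial>?N)" by simp
    show "l ^ n * (\<integral>\<^sup>+s. f \<theta>1 s * I s \<partial>?N) \<le> (\<integral>\<^sup>+s. f \<theta>1 s \<partial>PiM {..<n} (\<lambda>_. P1))"
      unfolding I_def by (rule PiM_lower_bound[OF P0 P1 sets C le f])
  qed
  finally show ?thesis by (simp add: f_def)
qed

lemma enn2real_inverse_le: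
  assumes "ennreal a \<le> x" "0 < a"
  shows "enn2real (inverse x) \<le> 1 / a"
proof (cases x)
  case (real y)
  then have "a \<le> y" "0 < y" using assms by (auto simp: ennreal_le_iff)
  then show ?thesis using real assms by (simp add: inverse_ennreal frac_le inverse_eq_divide)
qed (use assms in auto)

lemma enn2real_inverse_ge:
  assumes "x \<le> ennreal b" "0 < x" "0 < b"
  shows "1 / b \<le> enn2real (inverse x)"
proof (cases x)
  case (real y)
  then have "y \<le> b" "0 < y" using assms by (auto simp: ennreal_le_iff)
  then show ?thesis using real assms by (simp add: inverse_ennreal frac_le inverse_eq_divide)
qed (use assms in \<open>auto simp: top_unique\<close>)

text \<open>
  The sample size \<open>n\<close> and the relative width \<open>\<delta>\<close> of the bump are still independent here. The number
  \<open>x = 2 (3 \<delta>)\<^sup>d\<close> bounds the mass of the bump, and that of the part of the sphere below it, relative to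
  the mass of the sphere. The two laws then have at least the mass \<open>(1 - x) / (1 + x) \<ge> exp (- 3 x)\<close>
  in common.
\<close>

lemma minimax_risk_two_point:
  fixes \<tau> L fmin p \<delta> :: real
  assumes dims: "1 \<le> d" "d < D" and \<tau>: "0 < \<tau>" and p: "1 \<le> p" and \<delta>: "0 < \<delta>" "\<delta> \<le> 1 / 4"
    and L: "1 / (2 * \<tau> ^ 2) \<le> L"
    and fmin: "0 < fmin" "fmin \<le> 1 / (2 ^ (d + 1) * \<tau> ^ d * sphere_vol d)"
    and x: "2 * (3 * \<delta>) ^ d \<le> 1 / 2"
  shows "ennreal (exp (- 3 * (2 * (3 * \<delta>) ^ d)) ^ n * (\<delta> / (153600 * \<tau>)) powr p)
     \<le> 2 * minimax_risk (euclid D) d \<tau> L fmin p n"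
proof -
  define x where "x = 2 * (3 * \<delta>) ^ d"
  define r where "r = 2 * \<tau>"
  define s where "s = (\<delta> * r)\<^sup>2"
  define c where "c = \<delta> ^ 3 * r\<^sup>2 / 2400"
  define \<sigma> where "\<sigma> = sphere_vol d"
  have r: "0 < r" using \<tau> by (simp add: r_def)
  have x01: "0 < x" "x \<le> 1 / 2" using assms(10) \<delta> by (auto simp: x_def)
  have vol: "sphere_vol d \<noteq> 0" using fmin by auto
  interpret S: measured_revolution d D r s 0 "\<lambda>_. 0" "\<lambda>_. 0" "\<lambda>_. 0" "\<lambda>_. 0"
    unfolding s_def by (intro measured_revolution.intro sphere_revolution nondegenerate.intro dims r \<delta> vol)
  interpret B: measured_revolution d D r s "1 / 100" "ramp c s 4" "ramp (- (4 * c / s)) s 3"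
      "ramp (12 * c / s\<^sup>2) s 2" "ramp (- (24 * c / s ^ 3)) s 1"
    unfolding s_def c_def by (intro measured_revolution.intro bump_revolution nondegenerate.intro dims r \<delta> vol)
  have \<sigma>: "0 < \<sigma>" using S.vol_pos by (simp add: \<sigma>_def)
  have sqs: "sqrt s = \<delta> * r" using r \<delta> by (simp add: s_def)
  let ?O = "sph d r \<inter> {x. s < S.Y x}"
  have total: "(r ^ d + 2 * (3 * sqrt s) ^ d) * sphere_vol d = (1 + x) * (r ^ d * \<sigma>)"
    by (simp add: sqs x_def \<sigma>_def power_mult_distrib algebra_simps)
  have V1: "S.V \<le> (1 + x) * (r ^ d * \<sigma>)" "B.V \<le> (1 + x) * (r ^ d * \<sigma>)"
    using S.V_le B.V_le by (simp_all only: total)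
  have sphM: "S.M = sph d r"
    using r by (auto simp: S.M_def sph_def norm_eq_sqrt_inner real_sqrt_unique)
  have V0: "S.V = r ^ d * \<sigma>"
    using S.emeasure_V S.emeasure_sphere r \<sigma> S.V_pos by (simp add: sphM \<sigma>_def)
  have dens: "fmin \<le> 1 / v" if "0 < v" "v \<le> (1 + x) * (r ^ d * \<sigma>)" for v
  proof -
    have "(1 + x) * (r ^ d * \<sigma>) \<le> 2 * (r ^ d * \<sigma>)"
      using x01 r \<sigma> by (intro mult_right_mono) auto
    also have "\<dots> = 2 ^ (d + 1) * \<tau> ^ d * sphere_vol d"
      by (simp add: r_def \<sigma>_def power_mult_distrib)
    finally have "v \<le> 2 ^ (d + 1) * \<tau> ^ d * sphere_vol d" using that by linarith
    then have "1 / (2 ^ (d + 1) * \<tau> ^ d * sphere_vol d) \<le> 1 / v" using that by (intro frac_le) auto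
    then show ?thesis using fmin by linarith
  qed
  have L': "2 / r\<^sup>2 \<le> L" using L by (simp add: r_def power_mult_distrib)
  have Q0: "S.Q \<in> point_laws (euclid D) d \<tau> L fmin"
    by (rule S.Q_point_law[OF _ L' dens]) (use V1 S.V_pos \<tau> in \<open>auto simp: r_def\<close>)
  have Q1: "B.Q \<in> point_laws (euclid D) d \<tau> L fmin"
    by (rule B.Q_point_law[OF _ L' dens]) (use V1 B.V_pos \<tau> in \<open>auto simp: r_def\<close>)
  have model: "S.P \<in> model (euclid D) d \<tau> L fmin" "B.P \<in> model (euclid D) d \<tau> L fmin"
    unfolding model_def S.P_def B.P_def using Q0 Q1 by auto
  have reach0: "enn2real (inverse (law_reach (euclid D) S.P)) \<le> 1 / r"
    unfolding S.law_reach_P using S.reach_M r by (intro enn2real_inverse_le) auto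
  define y where "y = \<delta> / 38400"
  have reach1: "1 / (r * (1 - y)) \<le> enn2real (inverse (law_reach (euclid D) B.P))"
  proof -
    define R where "R = sqrt (r\<^sup>2 + ramp c s 4 0)"
    have b0: "ramp c s 4 0 = c" by (simp add: ramp_def)
    \<comment> \<open>half of \<open>c r / (4 s)\<close>, a distance from the centre below which the rim is closer than the pole; it
      is of order \<open>\<delta> r\<close> and so exceeds the growth of \<open>R\<close>, which is of order \<open>\<delta>\<^sup>3 r\<close>\<close>
    define \<zeta> where "\<zeta> = \<delta> * r / 19200"
    have d2: "\<delta>\<^sup>2 \<le> 1 / 16" using power_mono[OF \<delta>(2), of 2] \<delta> by (simp add: power_divide)
    have c0: "0 < c" using \<delta> r by (simp add: c_def)
    have R_le: "R \<le> r * (1 + \<delta> ^ 3 / 4800)"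
      unfolding R_def b0
    proof (rule real_le_lsqrt)
      have "(r * (1 + a))\<^sup>2 = r\<^sup>2 + 2 * a * r\<^sup>2 + (r * a)\<^sup>2" for a
        by (simp add: power2_eq_square algebra_simps)
      from this[of "\<delta> ^ 3 / 4800"] show "r\<^sup>2 + c \<le> (r * (1 + \<delta> ^ 3 / 4800))\<^sup>2" by (simp add: c_def)
    qed (use r \<delta> c0 in auto)
    have R_ge: "r \<le> R" unfolding R_def b0 using c0 r by (intro real_le_rsqrt) auto
    have low: "r * (1 - \<delta>\<^sup>2) \<le> sqrt (r\<^sup>2 - s)"
    proof (rule real_le_rsqrt)
      have "r\<^sup>2 - a * r\<^sup>2 - (r * (1 - a))\<^sup>2 = r\<^sup>2 * (a * (1 - a))" for a
        by (simp add: power2_eq_square algebra_simps)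
      from this[of "\<delta>\<^sup>2"] have "r\<^sup>2 - s - (r * (1 - \<delta>\<^sup>2))\<^sup>2 = r\<^sup>2 * (\<delta>\<^sup>2 * (1 - \<delta>\<^sup>2))"
        by (simp only: s_def power_mult_distrib)
      moreover have "0 \<le> r\<^sup>2 * (\<delta>\<^sup>2 * (1 - \<delta>\<^sup>2))" using d2 by simp
      ultimately show "(r * (1 - \<delta>\<^sup>2))\<^sup>2 \<le> r\<^sup>2 - s" by linarith
    qed
    have cube: "\<delta> ^ 3 \<le> \<delta>\<^sup>2 * (1 / 4)" "\<delta> ^ 3 \<le> \<delta> * (1 / 16)"
      using mult_left_mono[OF \<delta>(2), of "\<delta>\<^sup>2"] mult_left_mono[OF d2, of \<delta>] \<delta>(1)
      by (simp_all add: power3_eq_cube power2_eq_square mult.assoc)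
    have "R - sqrt (r\<^sup>2 - s) \<le> r * (\<delta> ^ 3 / 4800 + \<delta>\<^sup>2)"
      using R_le low by (simp add: algebra_simps)
    also have "\<dots> \<le> r * (2 * \<delta>\<^sup>2)"
    proof (intro mult_left_mono)
      have "0 \<le> \<delta>\<^sup>2" by simp
      then show "\<delta> ^ 3 / 4800 + \<delta>\<^sup>2 \<le> 2 * \<delta>\<^sup>2" using cube(1) by linarith
    qed (use r in auto)
    finally have "2 * \<zeta> * (R - sqrt (r\<^sup>2 - s)) \<le> 2 * \<zeta> * (r * (2 * \<delta>\<^sup>2))"
      using r \<delta> by (intro mult_left_mono) (auto simp: \<zeta>_def)
    also have "\<dots> = c / 2" by (simp add: \<zeta>_def c_def power3_eq_cube power2_eq_square)
    finally have gap: "2 * \<zeta> * (R - sqrt (r\<^sup>2 - s)) < c" using c0 by linarith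
    have \<zeta>0: "0 < \<zeta>" using r \<delta> by (simp add: \<zeta>_def)
    have \<zeta>R: "\<zeta> \<le> R"
    proof -
      have "\<zeta> = r * (\<delta> / 19200)" by (simp add: \<zeta>_def)
      also have "\<dots> \<le> r * 1" using r \<delta> by (intro mult_left_mono) auto
      finally show ?thesis using R_ge by simp
    qed
    have "reach (euclid D) B.M \<le> ennreal (R - \<zeta>)"
      unfolding R_def
    proof (rule B.reach_M_le[OF \<zeta>0 _ \<zeta>R[unfolded R_def]])
      show "2 * \<zeta> * (sqrt (r\<^sup>2 + ramp c s 4 0) - sqrt (r\<^sup>2 - s)) < ramp c s 4 0"
        using gap by (simp only: R_def b0)
    qed
    also have "\<dots> \<le> ennreal (r * (1 - y))"
    proof (rule ennreal_leI)
      have "R - \<zeta> \<le> r * (1 + \<delta> ^ 3 / 4800 - \<delta> / 19200)" using R_le by (simp add: \<zeta>_def algebra_simps)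
      also have "\<dots> \<le> r * (1 - y)"
      proof (rule mult_left_mono)
        show "1 + \<delta> ^ 3 / 4800 - \<delta> / 19200 \<le> 1 - y" using cube(2) \<delta>(1) unfolding y_def by linarith
      qed (use r in simp)
      finally show "R - \<zeta> \<le> r * (1 - y)" .
    qed
    finally have le: "reach (euclid D) B.M \<le> ennreal (r * (1 - y))" .
    have "0 < r * (1 - 1 / 100) / (1 + 3 * (1 / 100))" using r by simp
    then have pos: "0 < reach (euclid D) B.M"
      using B.reach_M by (intro less_le_trans[OF _ B.reach_M]) simp
    show ?thesis
      unfolding B.law_reach_P by (rule enn2real_inverse_ge[OF le pos]) (use r \<delta> in \<open>simp add: y_def\<close>)
  qed
  define \<Delta> where "\<Delta> = \<delta> / (153600 * \<tau>)"
  have sep: "2 * \<Delta> \<le> enn2real (inverse (law_reach (euclid D) B.P)) - enn2real (inverse (law_reach (euclid D) S.P))"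
  proof -
    have "(1 + y) * (1 - y) \<le> 1" by (simp add: algebra_simps)
    then have "1 + y \<le> 1 / (1 - y)" using \<delta> by (subst pos_le_divide_eq) (auto simp: y_def)
    then have "(1 + y) / r \<le> (1 / (1 - y)) / r" using r by (intro divide_right_mono) auto
    then have "1 / r + y / r \<le> 1 / (r * (1 - y))" by (simp add: add_divide_distrib mult.commute)
    moreover have "y / r = 2 * \<Delta>" by (simp add: y_def r_def \<Delta>_def)
    ultimately show ?thesis using reach0 reach1 by linarith
  qed
  have sets: "sets B.P = sets S.P" by (simp add: S.sets_P B.sets_P)
  define l where "l = ennreal (1 / (1 + x))"
  have l1: "l \<le> 1" using x01 by (simp add: l_def)
  have C: "S.off_bump \<in> sets S.P" using S.off_bump_measurable by (simp add: S.sets_P)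
  have le: "l * (\<integral>\<^sup>+z. F z * indicator S.off_bump z \<partial>S.P) \<le> (\<integral>\<^sup>+z. F z \<partial>B.P)"
    if F: "F \<in> borel_measurable S.P" for F
  proof -
    have F': "F \<in> borel_measurable (obs_space (euclid D) d)"
      using F by (simp add: measurable_cong_sets[OF S.sets_P refl])
    let ?J = "\<integral>\<^sup>+x. F (x, {v \<in> euclid (Suc d). x \<bullet> v = 0}) * indicator (?O) x \<partial>hausdorff_measure d"
    have "1 / (1 + x) * (1 / S.V) = 1 / ((1 + x) * (r ^ d * \<sigma>))" by (simp add: V0)
    also have "\<dots> \<le> 1 / B.V" using V1 B.V_pos by (intro frac_le) auto
    finally have k: "l * ennreal (1 / S.V) \<le> ennreal (1 / B.V)"
      unfolding l_def using x01 S.V_pos by (subst ennreal_mult[symmetric]) (auto intro: ennreal_leI)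
    have "l * (\<integral>\<^sup>+z. F z * indicator S.off_bump z \<partial>S.P) = (l * ennreal (1 / S.V)) * ?J"
      by (simp only: S.nn_integral_off_bump[OF F'] mult.assoc)
    also have "\<dots> \<le> ennreal (1 / B.V) * ?J" by (rule mult_right_mono[OF k]) simp
    also have "\<dots> = (\<integral>\<^sup>+z. F z * indicator S.off_bump z \<partial>B.P)"
      by (rule B.nn_integral_off_bump[OF F', symmetric])
    also have "\<dots> \<le> (\<integral>\<^sup>+z. F z \<partial>B.P)"
      by (intro nn_integral_mono) (auto simp: indicator_def)
    finally show ?thesis .
  qed
  have mass: "ennreal (1 - x) \<le> emeasure S.P S.off_bump"
  proof -
    have "emeasure S.P S.off_bump = (\<integral>\<^sup>+z. 1 * indicator S.off_bump z \<partial>S.P)" using C by simp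
    also have "\<dots> = ennreal (1 / S.V) * emeasure (hausdorff_measure d) (?O)"
    proof -
      have "?O \<in> sets borel"
        using S.open_Y compact_imp_closed[OF compact_sph] by (intro sets.Int) auto
      then show ?thesis by (subst S.nn_integral_off_bump) auto
    qed
    finally have e: "emeasure S.P S.off_bump = ennreal (1 / S.V) * emeasure (hausdorff_measure d) (?O)" .
    have "ennreal S.V \<le> ennreal (2 * (3 * sqrt s) ^ d * sphere_vol d) + emeasure (hausdorff_measure d) (?O)"
      using add_right_mono[OF S.emeasure_bump] S.emeasure_M_split by (simp add: S.emeasure_V)
    also have "2 * (3 * sqrt s) ^ d * sphere_vol d = x * S.V"
      by (simp add: V0 x_def sqs \<sigma>_def power_mult_distrib)
    finally have "ennreal (1 / S.V) * ennreal S.V \<le>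
        ennreal (1 / S.V) * (ennreal (x * S.V) + emeasure (hausdorff_measure d) (?O))"
      by (rule mult_left_mono) simp
    then have "1 \<le> ennreal x + emeasure S.P S.off_bump"
      using S.V_pos x01 by (simp add: S.inverse_V distrib_left e ennreal_mult'[symmetric])
    then have "1 - ennreal x \<le> emeasure S.P S.off_bump" by (simp add: ennreal_minus_le_iff)
    then show ?thesis using x01 by (simp add: ennreal_minus[symmetric])
  qed
  have lower: "ennreal (exp (- 3 * x)) \<le> l * emeasure S.P S.off_bump"
  proof -
    have "1 + x \<le> exp x" "1 + 2 * x \<le> exp (2 * x)"
      using exp_ge_add_one_self[of x] exp_ge_add_one_self[of "2 * x"] by auto
    then have "(1 + x) * (1 + 2 * x) \<le> exp x * exp (2 * x)" using x01 by (intro mult_mono) auto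
    then have e: "(1 + x) * (1 + 2 * x) \<le> exp (3 * x)" by (simp add: exp_add[symmetric])
    have "x * x \<le> x * (1 / 2)" using x01 by (intro mult_left_mono) auto
    then have "1 \<le> (1 - x) * (1 + 2 * x)" by (simp add: algebra_simps)
    then have "(1 + x) * 1 \<le> (1 + x) * ((1 - x) * (1 + 2 * x))" using x01 by (intro mult_left_mono) auto
    also have "\<dots> = (1 - x) * ((1 + x) * (1 + 2 * x))" by (simp add: mult_ac)
    also have "\<dots> \<le> (1 - x) * exp (3 * x)" using e x01 by (intro mult_left_mono) auto
    finally have "exp (- 3 * x) \<le> 1 / (1 + x) * (1 - x)"
      using x01 by (simp add: exp_minus field_simps)
    then have "ennreal (exp (- 3 * x)) \<le> l * ennreal (1 - x)"
      unfolding l_def using x01 by (subst ennreal_mult[symmetric]) (auto intro: ennreal_leI)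
    also have "\<dots> \<le> l * emeasure S.P S.off_bump" by (rule mult_left_mono[OF mass]) simp
    finally show ?thesis .
  qed
  let ?B = "exp (- 3 * x) ^ n * \<Delta> powr p"
  have "2 * minimax_risk (euclid D) d \<tau> L fmin p n \<ge> ennreal (?B)"
  proof -
    have "ennreal (?B / 2) \<le> minimax_risk (euclid D) d \<tau> L fmin p n"
      unfolding minimax_risk_def
    proof (rule INF_greatest)
      fix \<tau>h assume \<tau>h: "\<tau>h \<in> estimators (euclid D) d n"
      define t where "t s = enn2real (inverse (\<tau>h s))" for s
      define risk where "risk P = (\<integral>\<^sup>+ s. ennreal (\<bar>enn2real (inverse (law_reach (euclid D) P)) - t s\<bar> powr p)
          \<partial>PiM {..<n} (\<lambda>_. P))" for P
      let ?S = "SUP P\<in>model (euclid D) d \<tau> L fmin. risk P"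
      have eq: "sets (PiM {..<n} (\<lambda>_. S.P)) = sets (PiM {..<n} (\<lambda>_. obs_space (euclid D) d))"
        by (intro sets_PiM_cong) (auto simp: S.sets_P)
      have "\<tau>h \<in> borel_measurable (PiM {..<n} (\<lambda>_. S.P))"
        unfolding measurable_cong_sets[OF eq refl] using \<tau>h by (simp add: estimators_def)
      then have tm: "t \<in> borel_measurable (PiM {..<n} (\<lambda>_. S.P))"
        unfolding t_def by measurable
      have "ennreal (?B) = ennreal (exp (- 3 * x)) ^ n * ennreal (\<Delta> powr p)"
        by (subst ennreal_mult) (auto simp: ennreal_power)
      also have "\<dots> \<le> (l * emeasure S.P S.off_bump) ^ n * ennreal (\<Delta> powr p)"
        by (intro mult_right_mono power_mono lower) auto
      also have "\<dots> \<le> risk S.P + risk B.P"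
        unfolding risk_def
        by (rule two_point_bound[OF S.prob_P B.prob_P sets C l1 le tm _ _ sep])
          (use p \<delta> \<tau> in \<open>auto simp: \<Delta>_def\<close>)
      also have "\<dots> \<le> ?S + ?S"
        by (intro add_mono SUP_upper model)
      finally have le2: "ennreal (?B) \<le> 2 * ?S"
        by (simp add: mult_2)
      have "ennreal (?B) = 2 * ennreal (?B / 2)"
        using ennreal_mult'[of 2 "?B / 2"] by simp
      then have "2 * ennreal (?B / 2) \<le> 2 * ?S"
        using le2 by simp
      then have "ennreal (?B / 2) \<le> ?S"
        by (subst (asm) ennreal_mult_le_mult_iff) auto
      then show "ennreal (?B / 2) \<le> (SUP P\<in>model (euclid D) d \<tau> L fmin.
          \<integral>\<^sup>+ s. ennreal (\<bar>enn2real (inverse (law_reach (euclid D) P)) - enn2real (inverse (\<tau>h s))\<bar> powr p)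
          \<partial>PiM {..<n} (\<lambda>_. P))"
        by (simp only: risk_def t_def)
    qed
    then have "2 * ennreal (?B / 2) \<le> 2 * minimax_risk (euclid D) d \<tau> L fmin p n"
      by (rule mult_left_mono) simp
    then show ?thesis
      using ennreal_mult'[of 2 "?B / 2"] by simp
  qed
  then show ?thesis by (simp only: x_def \<Delta>_def)
qed

theorem proposition5p6:
  shows "\<exists>c :: nat \<Rightarrow> real. (\<forall>d\<ge>1. c d > 0) \<and>
    (\<forall>(d::nat) (D::nat) (\<tau>min::real) (L::real) (fmin::real) (p::real).
       2 \<le> D \<and> 1 \<le> d \<and> d < D \<and> \<tau>min > 0 \<and> L > 0 \<and> fmin > 0 \<and> p \<ge> 1 \<and>
       L \<ge> 1 / (2 * \<tau>min ^ 2) \<and>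
       fmin \<le> 1 / (2 ^ (d + 1) * \<tau>min ^ d * sphere_vol d) \<longrightarrow>
       (\<forall>\<^sub>F n in sequentially.
          minimax_risk (euclid D) d \<tau>min L fmin p n
            \<ge> ennreal ((c d / \<tau>min) powr p * real n powr (- p / real d))))"
proof -
  \<comment> \<open>a lower bound for the \<open>n\<close>-th power of the common mass of the two laws, halved on passing from the
    sum of two risks to their maximum\<close>
  define q :: "nat \<Rightarrow> real" where "q d = exp (- 6 * 3 ^ d) / 2" for d
  have q: "0 < q d" "q d \<le> 1" for d
  proof -
    have "exp (- 6 * 3 ^ d) \<le> (1::real)" unfolding exp_le_one_iff by simp
    then show "q d \<le> 1" unfolding q_def by linarith
    show "0 < q d" by (simp add: q_def)
  qed
  define c where "c d = q d / 153600" for d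
  have main: "ennreal ((c d / \<tau>) powr p * real n powr (- p / real d)) \<le> minimax_risk (euclid D) d \<tau> L fmin p n"
    if "1 \<le> d" "d < D" "0 < \<tau>" "0 < fmin" "1 \<le> p" "1 / (2 * \<tau> ^ 2) \<le> L"
      "fmin \<le> 1 / (2 ^ (d + 1) * \<tau> ^ d * sphere_vol d)" and n: "4 ^ d + 4 * 3 ^ d \<le> n"
    for d D :: nat and \<tau> L fmin p :: real and n :: nat
  proof -
    have n0: "0 < n" "4 ^ d \<le> real n" "4 * 3 ^ d \<le> real n"
    proof -
      have "4 ^ d \<le> n" "4 * 3 ^ d \<le> n" using n by auto
      then have "real (4 ^ d) \<le> real n" "real (4 * 3 ^ d) \<le> real n" by (simp_all only: of_nat_le_iff)
      then show "4 ^ d \<le> real n" "4 * 3 ^ d \<le> real n" by simp_all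
      have "0 < (4::nat) ^ d" by simp
      then show "0 < n" using \<open>4 ^ d \<le> n\<close> by linarith
    qed
    define \<delta> where "\<delta> = real n powr (- 1 / real d)"
    have \<delta>0: "0 < \<delta>" using n0 by (simp add: \<delta>_def)
    have \<delta>d: "\<delta> ^ d = 1 / real n"
    proof -
      have "\<delta> ^ d = \<delta> powr real d" using \<delta>0 by (simp add: powr_realpow)
      also have "\<dots> = real n powr (- 1)" unfolding \<delta>_def powr_powr using that(1) by simp
      also have "\<dots> = 1 / real n" using n0 by (simp add: powr_minus inverse_eq_divide)
      finally show ?thesis .
    qed
    \<comment> \<open>the first summand of the threshold for \<open>n\<close> gives this bound, the second one that on \<open>2 (3 \<delta>)\<^sup>d\<close>\<close>
    have \<delta>4: "\<delta> \<le> 1 / 4"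
    proof (rule power_le_imp_le_base[of _ "d - 1"])
      show "\<delta> ^ Suc (d - 1) \<le> (1 / 4) ^ Suc (d - 1)"
        using that(1) n0 by (simp add: \<delta>d power_divide frac_le)
    qed simp
    have x: "2 * (3 * \<delta>) ^ d = 2 * 3 ^ d / real n" by (simp add: power_mult_distrib \<delta>d)
    have xh: "2 * (3 * \<delta>) ^ d \<le> 1 / 2" unfolding x using n0 by (simp add: field_simps)
    have "exp (- 3 * (2 * (3 * \<delta>) ^ d)) ^ n = exp (real n * (- 3 * (2 * (3 * \<delta>) ^ d)))"
      by (rule exp_of_nat_mult[symmetric])
    also have "real n * (- 3 * (2 * (3 * \<delta>) ^ d)) = - 6 * 3 ^ d" unfolding x using n0 by simp
    finally have ex: "exp (- 3 * (2 * (3 * \<delta>) ^ d)) ^ n = 2 * q d" by (simp add: q_def)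
    have w: "0 < \<delta> / (153600 * \<tau>)" using \<delta>0 that by simp
    have "(c d / \<tau>) powr p * real n powr (- p / real d) = (c d / \<tau>) powr p * \<delta> powr p"
      by (simp add: \<delta>_def powr_powr)
    also have "\<dots> = (q d * (\<delta> / (153600 * \<tau>))) powr p"
      using q[of d] \<delta>0 that by (subst powr_mult[symmetric]) (auto simp: c_def)
    also have "\<dots> = q d powr p * (\<delta> / (153600 * \<tau>)) powr p"
      by (rule powr_mult)
    \<comment> \<open>since \<open>p \<ge> 1\<close> and \<open>q d \<le> 1\<close>, the constant may be moved out of the power\<close>
    also have "\<dots> \<le> q d * (\<delta> / (153600 * \<tau>)) powr p"
      using q[of d] that powr_mono'[of 1 p "q d"] by (intro mult_right_mono) auto
    finally have B: "2 * ((c d / \<tau>) powr p * real n powr (- p / real d))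
        \<le> exp (- 3 * (2 * (3 * \<delta>) ^ d)) ^ n * (\<delta> / (153600 * \<tau>)) powr p"
      unfolding ex by simp
    have "2 * ennreal ((c d / \<tau>) powr p * real n powr (- p / real d)) =
        ennreal (2 * ((c d / \<tau>) powr p * real n powr (- p / real d)))"
      by (simp add: ennreal_mult')
    also have "\<dots> \<le> 2 * minimax_risk (euclid D) d \<tau> L fmin p n"
      using minimax_risk_two_point[OF that(1-3,5) \<delta>0 \<delta>4 that(6,4,7) xh]
      by (rule order_trans[OF ennreal_leI[OF B]])
    finally show ?thesis by (subst (asm) ennreal_mult_le_mult_iff) auto
  qed
  show ?thesis
  proof (intro exI[of _ c] conjI allI impI)
    show "0 < c d" for d using q[of d] by (simp add: c_def)
    fix d D :: nat and \<tau> L fmin p :: real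
    assume "2 \<le> D \<and> 1 \<le> d \<and> d < D \<and> \<tau> > 0 \<and> L > 0 \<and> fmin > 0 \<and> p \<ge> 1 \<and>
       L \<ge> 1 / (2 * \<tau> ^ 2) \<and> fmin \<le> 1 / (2 ^ (d + 1) * \<tau> ^ d * sphere_vol d)"
    then show "\<forall>\<^sub>F n in sequentially.
          minimax_risk (euclid D) d \<tau> L fmin p n
            \<ge> ennreal ((c d / \<tau>) powr p * real n powr (- p / real d))"
      by (intro eventually_sequentiallyI[of "4 ^ d + 4 * 3 ^ d"] main) auto
  qed
qed

end
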